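(* Let $M$ be a matroid on a finite ground set $S$. The following are equivalent. (i) $M$ is an elementary split matroid. (ii) $M$ has no minor isomorphic to $U_{0,1}\oplus U_{1,2}\oplus U_{1,1}$. (iii) $M$ is a loopless and coloopless matroid whose proper cyclic flats form a clutter, or $M$ is the direct sum of a uniform matroid with either a rank-0 matroid or a free matroid. (iv) $M$ is a connected split matroid or the direct sum of two uniform matroids.
   Context: All matroids are on finite ground sets. $U_{k,n}$ is the uniform matroid of rank $k$ on $n$ elements ($0\le k\le n$); $n=0$ is allowed, giving the empty matroid. A free matroid is a $U_{n,n}$ and a rank-0 matroid is a $U_{0,n}$ (possibly empty). $\oplus$ denotes direct sum. A clutter is a family of sets none of which is a proper subset of another. A set is cyclic if it is a (possibly empty) union of circuits. A flat is proper if it has nonzero rank and is not equal to the ground set; a proper cyclic flat is a proper flat that is cyclic. $M$ is connected if any two distinct elements lie in a common circuit. Elementary split matroid: $M$ is an elementary split matroid if there exist non-negative integers $r,r_1,\dots,r_q$ ($q\ge0$) with $|S|\ge r$ and a (possibly empty) collection $\{H_1,\dots,H_q\}$ of subsets of $S$ satisfying $|H_i\cap H_j|\le r_i+r_j-r$ for all $1\le i<j\le q$, such that the family of independent sets of $M$ is $\{X\subseteq S\mid |X|\le r,\ |X\cap H_i|\le r_i\text{ for }1\le i\le q\}$. (Such a family always is the family of independent sets of a matroid.) Split matroid: Let $M$ have rank function $r_M$ and rank $r=r_M(S)$. The base polytope $P(M)\subseteq\mathbb{R}^S$ is the convex hull of the characteristic vectors of the bases of $M$, and $\Delta(r,S)$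 is the convex hull of all 0-1 vectors in $\mathbb{R}^S$ with exactly $r$ ones. For a flat $F$, let $H(F)=\{x\in\mathbb{R}^S\mid x(F)=r_M(F)\}$, where $x(F)=\sum_{e\in F}x_e$; this is the $F$-hyperplane, and $P(M)\cap H(F)$ is the face of $P(M)$ defined by $F$. A flat $F$ is a flacet if it defines a facet of $P(M)$ and is inclusionwise minimal among the flats defining this face. A split of a polytope $P$ is a subdivision of $P$ without new vertices that has exactly two maximal cells; the affine span of the intersection of the two cells is its split hyperplane. Two splits of $P$ are compatible if their split hyperplanes do not meet in a relative interior point of $P$. A flacet $F$ is a split flacet if $H(F)$ defines a split of $\Delta(r,S)$. $M$ is a split matroid if its split flacets form a compatible system (i.e. pairwise compatible) of splits of the polytope obtained by intersecting the affine hull of $P(M)$ with the unit cube $[0,1]^S$. For connected $M$ the following known description of these notions may be used: the split flacets of $M$ are exactly the proper flats $F$ with $|F|\ge 2$ such that $M|F$ and $M/F$ are both connected, and for distinct split flacets $F,G$ the corresponding splits are compatible if and only if $|F\cap G|+r_M(S)\le r_M(F)+r_M(G)$. Thus a connected matroid is a split matroid if and only if this inequality holds for all pairs of distinct split flacets $F,G$. *)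

theory Defs
  imports "HOL-Analysis.Analysis"
begin

section \<open>Finite matroids\<close>

record 'a indep_system =
  ground :: "'a set"
  indep :: "'a set set"

locale matroid =
  fixes M :: "'a indep_system"
  assumes finite_ground: "finite (ground M)"
    and indep_ground: "X \<in> indep M \<Longrightarrow> X \<subseteq> ground M"
    and indep_empty: "{} \<in> indep M"
    and indep_hereditary: "X \<in> indep M \<Longrightarrow> Y \<subseteq> X \<Longrightarrow> Y \<in> indep M"
    and indep_augment:
      "X \<in> indep M \<Longrightarrow> Y \<in> indep M \<Longrightarrow> card X < card Y \<Longrightarrow> \<exists>e\<in>Y - X. insert e X \<in> indep M"

definition rk :: "'a indep_system \<Rightarrow> 'a set \<Rightarrow> nat" where
  "rk M X = Max (card ` {Y \<in> indep M. Y \<subseteq> X})"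

definition base :: "'a indep_system \<Rightarrow> 'a set \<Rightarrow> bool" where
  "base M B \<longleftrightarrow> B \<in> indep M \<and> (\<forall>X\<in>indep M. \<not> B \<subset> X)"

definition circuit :: "'a indep_system \<Rightarrow> 'a set \<Rightarrow> bool" where
  "circuit M C \<longleftrightarrow> C \<subseteq> ground M \<and> C \<notin> indep M \<and> (\<forall>X. X \<subset> C \<longrightarrow> X \<in> indep M)"

definition loopless :: "'a indep_system \<Rightarrow> bool" where
  "loopless M \<longleftrightarrow> (\<forall>e\<in>ground M. {e} \<in> indep M)"

definition coloopless :: "'a indep_system \<Rightarrow> bool" where
  "coloopless M \<longleftrightarrow> (\<forall>e\<in>ground M. \<exists>B. base M B \<and> e \<notin> B)"

definition connected_matroid :: "'a indep_system \<Rightarrow> bool" where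
  "connected_matroid M \<longleftrightarrow>
    (\<forall>e\<in>ground M. \<forall>f\<in>ground M. e \<noteq> f \<longrightarrow> (\<exists>C. circuit M C \<and> e \<in> C \<and> f \<in> C))"

definition flat :: "'a indep_system \<Rightarrow> 'a set \<Rightarrow> bool" where
  "flat M F \<longleftrightarrow> F \<subseteq> ground M \<and> (\<forall>e\<in>ground M - F. rk M F < rk M (insert e F))"

definition proper_flat :: "'a indep_system \<Rightarrow> 'a set \<Rightarrow> bool" where
  "proper_flat M F \<longleftrightarrow> flat M F \<and> rk M F \<noteq> 0 \<and> F \<noteq> ground M"

definition cyclic_set :: "'a indep_system \<Rightarrow> 'a set \<Rightarrow> bool" where
  "cyclic_set M X \<longleftrightarrow> (\<exists>\<C>. (\<forall>C\<in>\<C>. circuit M C) \<and> X = \<Union>\<C>)"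

definition proper_cyclic_flat :: "'a indep_system \<Rightarrow> 'a set \<Rightarrow> bool" where
  "proper_cyclic_flat M F \<longleftrightarrow> proper_flat M F \<and> cyclic_set M F"

definition clutter :: "'a set set \<Rightarrow> bool" where
  "clutter \<A> \<longleftrightarrow> (\<forall>A\<in>\<A>. \<forall>B\<in>\<A>. \<not> A \<subset> B)"

subsection \<open>Minors, isomorphism, direct sums, uniform matroids\<close>

definition deletion :: "'a indep_system \<Rightarrow> 'a set \<Rightarrow> 'a indep_system" where
  "deletion M D = \<lparr>ground = ground M - D, indep = {X \<in> indep M. X \<inter> D = {}}\<rparr>"

text \<open>The rank function of the contraction of \<open>C\<close> is \<open>X \<mapsto> rk M (X \<union> C) - rk M C\<close>; a set is
  independent there iff this value is its cardinality.\<close>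

definition contraction :: "'a indep_system \<Rightarrow> 'a set \<Rightarrow> 'a indep_system" where
  "contraction M C =
    \<lparr>ground = ground M - C,
     indep = {X. X \<subseteq> ground M - C \<and> rk M (X \<union> C) = card X + rk M C}\<rparr>"

definition minor_of :: "'a indep_system \<Rightarrow> 'a indep_system \<Rightarrow> bool" where
  "minor_of N M \<longleftrightarrow>
    (\<exists>C D. C \<subseteq> ground M \<and> D \<subseteq> ground M \<and> C \<inter> D = {} \<and> N = deletion (contraction M C) D)"

definition isomorphic :: "'a indep_system \<Rightarrow> 'b indep_system \<Rightarrow> bool" where
  "isomorphic M N \<longleftrightarrow>
    (\<exists>f. bij_betw f (ground M) (ground N) \<and>
         (\<forall>X. X \<subseteq> ground M \<longrightarrow> (X \<in> indep M \<longleftrightarrow> f ` X \<in> indep N)))"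

text \<open>Meant for disjoint ground sets.\<close>

definition direct_sum :: "'a indep_system \<Rightarrow> 'a indep_system \<Rightarrow> 'a indep_system" where
  "direct_sum M N =
    \<lparr>ground = ground M \<union> ground N, indep = {X \<union> Y |X Y. X \<in> indep M \<and> Y \<in> indep N}\<rparr>"

definition is_direct_sum :: "'a indep_system \<Rightarrow> 'a indep_system \<Rightarrow> 'a indep_system \<Rightarrow> bool" where
  "is_direct_sum M N\<^sub>1 N\<^sub>2 \<longleftrightarrow> ground N\<^sub>1 \<inter> ground N\<^sub>2 = {} \<and> M = direct_sum N\<^sub>1 N\<^sub>2"

definition unif :: "nat \<Rightarrow> 'a set \<Rightarrow> 'a indep_system" where
  "unif k E = \<lparr>ground = E, indep = {X. X \<subseteq> E \<and> card X \<le> k}\<rparr>"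

definition uniform_matroid :: "'a indep_system \<Rightarrow> bool" where
  "uniform_matroid M \<longleftrightarrow> (\<exists>k E. finite E \<and> k \<le> card E \<and> M = unif k E)"

definition free_matroid :: "'a indep_system \<Rightarrow> bool" where
  "free_matroid M \<longleftrightarrow> (\<exists>E. finite E \<and> M = unif (card E) E)"

definition rank0_matroid :: "'a indep_system \<Rightarrow> bool" where
  "rank0_matroid M \<longleftrightarrow> (\<exists>E. finite E \<and> M = unif 0 E)"

text \<open>A copy of \<open>U\<^sub>0\<^sub>,\<^sub>1 \<oplus> U\<^sub>1\<^sub>,\<^sub>2 \<oplus> U\<^sub>1\<^sub>,\<^sub>1\<close>.\<close>

definition forbidden_matroid :: "nat indep_system" where
  "forbidden_matroid = direct_sum (direct_sum (unif 0 {0}) (unif 1 {1, 2})) (unif 1 {3})"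

section \<open>Elementary split matroids\<close>

definition elementary_split :: "'a indep_system \<Rightarrow> bool" where
  "elementary_split M \<longleftrightarrow>
    (\<exists>(r::nat) (q::nat) (\<rho> :: nat \<Rightarrow> nat) (H :: nat \<Rightarrow> 'a set).
       r \<le> card (ground M) \<and>
       (\<forall>i\<in>{1..q}. H i \<subseteq> ground M) \<and>
       (\<forall>i j. 1 \<le> i \<and> i < j \<and> j \<le> q \<longrightarrow>
          int (card (H i \<inter> H j)) \<le> int (\<rho> i) + int (\<rho> j) - int r) \<and>
       indep M = {X. X \<subseteq> ground M \<and> card X \<le> r \<and> (\<forall>i\<in>{1..q}. card (X \<inter> H i) \<le> \<rho> i)})"

section \<open>Splits of polytopes\<close>

definition polytopal_subdivision :: "'v::euclidean_space set \<Rightarrow> 'v set set \<Rightarrow> bool" where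
  "polytopal_subdivision P \<C> \<longleftrightarrow>
     finite \<C> \<and> (\<forall>C\<in>\<C>. polytope C) \<and> \<Union>\<C> = P \<and>
     (\<forall>C\<in>\<C>. \<forall>F. F face_of C \<longrightarrow> F \<in> \<C>) \<and>
     (\<forall>C\<in>\<C>. \<forall>D\<in>\<C>. C \<inter> D face_of C \<and> C \<inter> D face_of D)"

definition maximal_cells :: "'v set set \<Rightarrow> 'v set set" where
  "maximal_cells \<C> = {C \<in> \<C>. \<forall>D\<in>\<C>. \<not> C \<subset> D}"

definition is_split :: "'v::euclidean_space set \<Rightarrow> 'v set set \<Rightarrow> bool" where
  "is_split P \<C> \<longleftrightarrow>
     polytopal_subdivision P \<C> \<and>
     (\<forall>C\<in>\<C>. \<forall>v. v extreme_point_of C \<longrightarrow> v extreme_point_of P) \<and>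
     card (maximal_cells \<C>) = 2"

definition split_hyperplane :: "'v::euclidean_space set set \<Rightarrow> 'v set" where
  "split_hyperplane \<C> = affine hull (\<Inter>(maximal_cells \<C>))"

text \<open>\<open>P\<close> need not be full-dimensional and its split hyperplanes are hyperplanes of
  \<open>affine hull P\<close>, so an ambient hyperplane \<open>H\<close> has to be cut down to \<open>affine hull P\<close>.\<close>

definition split_along :: "'v::euclidean_space set \<Rightarrow> 'v set \<Rightarrow> 'v set set \<Rightarrow> bool" where
  "split_along P H \<C> \<longleftrightarrow> is_split P \<C> \<and> split_hyperplane \<C> = H \<inter> affine hull P"

definition defines_split :: "'v::euclidean_space set \<Rightarrow> 'v set \<Rightarrow> bool" where
  "defines_split P H \<longleftrightarrow> (\<exists>\<C>. split_along P H \<C>)"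

definition compatible_splits :: "'v::euclidean_space set \<Rightarrow> 'v set set \<Rightarrow> 'v set set \<Rightarrow> bool" where
  "compatible_splits P \<C> \<D> \<longleftrightarrow> split_hyperplane \<C> \<inter> split_hyperplane \<D> \<inter> rel_interior P = {}"

section \<open>Split matroids\<close>

text \<open>For a ground set \<open>S\<close> inside a finite type \<open>'a\<close>, the space \<open>\<real>\<^sup>S\<close> is the coordinate
  subspace of \<^typ>\<open>real ^ 'a\<close> of the vectors vanishing outside \<open>S\<close>.\<close>

definition coord_space :: "'a set \<Rightarrow> (real ^ 'a::finite) set" where
  "coord_space S = {x. \<forall>i. i \<notin> S \<longrightarrow> x $ i = 0}"

definition char_vec :: "'a set \<Rightarrow> real ^ 'a::finite" where
  "char_vec X = (\<chi> i. if i \<in> X then 1 else 0)"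

definition base_polytope :: "'a::finite indep_system \<Rightarrow> (real ^ 'a) set" where
  "base_polytope M = convex hull (char_vec ` {B. base M B})"

definition hypersimplex :: "nat \<Rightarrow> 'a set \<Rightarrow> (real ^ 'a::finite) set" where
  "hypersimplex r S = convex hull (char_vec ` {X. X \<subseteq> S \<and> card X = r})"

definition unit_cube :: "'a set \<Rightarrow> (real ^ 'a::finite) set" where
  "unit_cube S = {x \<in> coord_space S. \<forall>i\<in>S. 0 \<le> x $ i \<and> x $ i \<le> 1}"

definition flat_hyperplane :: "'a::finite indep_system \<Rightarrow> 'a set \<Rightarrow> (real ^ 'a) set" where
  "flat_hyperplane M F = {x \<in> coord_space (ground M). (\<Sum>e\<in>F. x $ e) = real (rk M F)}"

definition flat_face :: "'a::finite indep_system \<Rightarrow> 'a set \<Rightarrow> (real ^ 'a) set" where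
  "flat_face M F = base_polytope M \<inter> flat_hyperplane M F"

definition flacet :: "'a::finite indep_system \<Rightarrow> 'a set \<Rightarrow> bool" where
  "flacet M F \<longleftrightarrow>
     flat M F \<and> flat_face M F facet_of base_polytope M \<and>
     (\<forall>G. flat M G \<and> flat_face M G = flat_face M F \<longrightarrow> \<not> G \<subset> F)"

definition split_flacet :: "'a::finite indep_system \<Rightarrow> 'a set \<Rightarrow> bool" where
  "split_flacet M F \<longleftrightarrow>
     flacet M F \<and>
     defines_split (hypersimplex (rk M (ground M)) (ground M)) (flat_hyperplane M F)"

definition ambient_polytope :: "'a::finite indep_system \<Rightarrow> (real ^ 'a) set" where
  "ambient_polytope M = affine hull (base_polytope M) \<inter> unit_cube (ground M)"

definition split_matroid :: "'a::finite indep_system \<Rightarrow> bool" where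
  "split_matroid M \<longleftrightarrow>
     (\<forall>F. split_flacet M F \<longrightarrow> defines_split (ambient_polytope M) (flat_hyperplane M F)) \<and>
     (\<forall>F G \<C> \<D>. split_flacet M F \<and> split_flacet M G \<and> F \<noteq> G \<and>
        split_along (ambient_polytope M) (flat_hyperplane M F) \<C> \<and>
        split_along (ambient_polytope M) (flat_hyperplane M G) \<D> \<longrightarrow>
        compatible_splits (ambient_polytope M) \<C> \<D>)"

end

theory Submission
  imports Defs
begin

text \<open>A forbidden minor amounts to an independent set \<open>I\<close> and elements \<open>a, b, c, d\<close> such that, after
  contracting \<open>I\<close>, \<open>a\<close> is a loop, \<open>b\<close> and \<open>c\<close> are parallel and \<open>d\<close> is a coloop. In an elementary
  split matroid, \<open>a\<close> and \<open>{b, c}\<close> single out two hyperedges violating the intersection inequality.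
  Conversely a loop or a coloop together with a non-uniform remainder, or a nested pair of proper cyclic
  flats, yields such a configuration, and if the proper cyclic flats form a clutter, then they
  serve as hyperedges.

  For connected \<open>M\<close> the ambient polytope is the hypersimplex, whose relative interior consists of the points
  with coordinates strictly between 0 and 1. In a clutter of proper cyclic flats the inequality
  \<open>|F \<inter> G| + r \<le> r(F) + r(G)\<close> keeps the hyperplanes of \<open>F\<close> and \<open>G\<close> from meeting there. Conversely, a nested
  pair \<open>F \<subset> G\<close> of proper cyclic flats gives two split flacets whose hyperplanes do meet: shrink \<open>F\<close> to a
  component of \<open>M|F\<close>; if \<open>M/F\<close> is then disconnected, use the complements of two components of \<open>M/F\<close>;
  otherwise enlarge \<open>G\<close> until \<open>M/G\<close> is connected, and use \<open>F\<close> and \<open>G\<close> if \<open>M|G\<close> is connected, or two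
  components of \<open>M|G\<close> if not. In each case a common interior point is constant on three blocks.\<close>

section \<open>Rank and circuits\<close>

text \<open>The conditions are joined in one cycle: (i) to (ii) to (iii) to (iv) and back to (i).
  Connectedness of the minor on \<open>T - A\<close> is expressed by ranks of sets between
  \<open>A\<close> and \<open>T\<close>, so submodularity alone relates separators of different
  minors of \<open>M\<close>. The obstacle on the polytopal side is that a flat needs both
  \<open>M|F\<close> and \<open>M/F\<close> connected to define a facet, and repairing one of the
  two may destroy the other; this forces the case distinction for nested flats. The point on three
  blocks has to be interior, so each block must receive a value strictly between 0 and its size:
  this is where flatness, dependence and the absence of loops and coloops enter. A hyperplane cut
  creates no new vertices because the rank values are integers. Compatibility depends on the
  hyperplanes alone, so it does not matter which subdivision realises a split.\<close>

context matroid
begin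

lemma indep_finite: "X \<in> indep M \<Longrightarrow> finite X"
  using finite_ground indep_ground finite_subset by blast

lemma finite_indep_below: "finite {Y \<in> indep M. Y \<subseteq> X}"
  by (rule finite_subset[of _ "Pow (ground M)"]) (auto simp: finite_ground dest: indep_ground)

lemma card_le_rk: "Y \<in> indep M \<Longrightarrow> Y \<subseteq> X \<Longrightarrow> card Y \<le> rk M X"
  unfolding rk_def by (rule Max_ge) (use finite_indep_below in auto)

lemma rk_basis: obtains Y where "Y \<in> indep M" "Y \<subseteq> X" "card Y = rk M X"
proof -
  have "rk M X \<in> card ` {Y \<in> indep M. Y \<subseteq> X}"
    unfolding rk_def by (rule Max_in) (use finite_indep_below indep_empty in auto)
  then show thesis using that by auto
qed

lemma rk_extend:
  assumes "Y \<in> indep M" "Y \<subseteq> X"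
  obtains Z where "Z \<in> indep M" "Y \<subseteq> Z" "Z \<subseteq> X" "card Z = rk M X"
proof -
  have "\<exists>Z. Z \<in> indep M \<and> Y \<subseteq> Z \<and> Z \<subseteq> X \<and> card Z = rk M X"
    using assms
  proof (induction "rk M X - card Y" arbitrary: Y rule: less_induct)
    case less
    show ?case
    proof (cases "card Y = rk M X")
      case False
      then have lt: "card Y < rk M X" using card_le_rk less.prems by (metis le_neq_implies_less)
      obtain B where B: "B \<in> indep M" "B \<subseteq> X" "card B = rk M X" by (rule rk_basis)
      then obtain e where e: "e \<in> B - Y" "insert e Y \<in> indep M"
        using indep_augment[OF less.prems(1) B(1)] lt by auto
      then have "card (insert e Y) = Suc (card Y)" using indep_finite less.prems by simp
      then have "\<exists>Z. Z \<in> indep M \<and> insert e Y \<subseteq> Z \<and> Z \<subseteq> X \<and> card Z = rk M X"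
        using e B less.prems lt by (intro less.hyps) auto
      then show ?thesis by blast
    qed (use less.prems in auto)
  qed
  then show thesis using that by blast
qed

lemma rk_mono: "X \<subseteq> Y \<Longrightarrow> rk M X \<le> rk M Y"
  by (metis card_le_rk dual_order.trans rk_basis)

lemma rk_le_insert: "rk M X \<le> rk M (insert e X)"
  by (rule rk_mono) blast

lemma rk_le_card: "finite X \<Longrightarrow> rk M X \<le> card X"
  by (metis card_mono rk_basis)

lemma rk_indep: "X \<in> indep M \<Longrightarrow> rk M X = card X"
  by (simp add: card_le_rk indep_finite le_antisym rk_le_card)

lemma indep_iff_rk: "X \<in> indep M \<longleftrightarrow> X \<subseteq> ground M \<and> rk M X = card X"
  by (metis card_subset_eq finite_ground indep_ground infinite_super rk_basis rk_indep)

lemma rk_empty [simp]: "rk M {} = 0"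
  by (simp add: rk_indep indep_empty)

text \<open>A basis of \<open>X \<inter> Y\<close> is extended to a basis of \<open>X\<close> and
  then to one, \<open>K\<close>, of \<open>X \<union> Y\<close>; counting \<open>K\<close> inside
  \<open>X\<close> and inside \<open>Y\<close> gives the inequality.\<close>

lemma rk_submod: "rk M (X \<union> Y) + rk M (X \<inter> Y) \<le> rk M X + rk M Y"
proof -
  obtain I where I: "I \<in> indep M" "I \<subseteq> X \<inter> Y" "card I = rk M (X \<inter> Y)" by (rule rk_basis)
  obtain J where J: "J \<in> indep M" "I \<subseteq> J" "J \<subseteq> X" "card J = rk M X"
    using rk_extend[OF I(1)] I(2) by (metis le_inf_iff)
  obtain K where K: "K \<in> indep M" "J \<subseteq> K" "K \<subseteq> X \<union> Y" "card K = rk M (X \<union> Y)"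
    using rk_extend[OF J(1)] J(3) by (metis le_supI1)
  have "K \<inter> X \<in> indep M" "K \<inter> Y \<in> indep M" using K indep_hereditary by blast+
  then have c: "card (K \<inter> X) \<le> rk M X" "card (K \<inter> Y) \<le> rk M Y" using card_le_rk by auto
  have "card K + card (K \<inter> X \<inter> Y) = card (K \<inter> X) + card (K \<inter> Y)"
    using card_Un_Int[of "K \<inter> X" "K \<inter> Y"] indep_finite[OF K(1)] K(3)
    by (simp add: Int_Un_distrib[symmetric] Int_absorb2 inf_assoc inf_left_commute)
  moreover have "card I \<le> card (K \<inter> X \<inter> Y)"
    using I J K indep_finite by (intro card_mono) auto
  ultimately show ?thesis using c I K by linarith
qed

lemma rk_singleton_le: "rk M {e} \<le> 1"
  using rk_le_card[of "{e}"] by simp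

lemma rk_union_le: "rk M (X \<union> Y) \<le> rk M X + rk M Y"
  using rk_submod[of X Y] by simp

lemma rk_insert_le: "rk M (insert e X) \<le> rk M X + 1"
  using rk_union_le[of X "{e}"] rk_singleton_le[of e] by simp

lemma rk_union_le_card: "finite Y \<Longrightarrow> rk M (X \<union> Y) \<le> rk M X + card Y"
  using rk_union_le[of X Y] rk_le_card[of Y] by simp

text \<open>Submodularity for \<open>insert e X\<close> and \<open>Y\<close>: what a set spans is
  spanned by every larger set.\<close>

lemma rk_insert_eq_mono:
  assumes "rk M (insert e X) = rk M X" "X \<subseteq> Y"
  shows "rk M (insert e Y) = rk M Y"
proof (cases "e \<in> Y")
  case False
  have "rk M (insert e X \<union> Y) + rk M (insert e X \<inter> Y) \<le> rk M (insert e X) + rk M Y"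
    by (rule rk_submod)
  moreover have "insert e X \<union> Y = insert e Y" "insert e X \<inter> Y = X" using assms False by auto
  moreover have "rk M Y \<le> rk M (insert e Y)" by (rule rk_mono) blast
  ultimately show ?thesis using assms by simp
qed (simp add: insert_absorb)

lemma rk_absorb:
  assumes "\<And>e. e \<in> Y \<Longrightarrow> rk M (insert e X) = rk M X"
  shows "rk M (X \<union> Y) = rk M X"
proof (rule ccontr)
  assume "rk M (X \<union> Y) \<noteq> rk M X"
  then have lt: "rk M X < rk M (X \<union> Y)" using rk_mono[of X "X \<union> Y"] by simp
  obtain I where I: "I \<in> indep M" "I \<subseteq> X" "card I = rk M X" by (rule rk_basis)
  obtain J where J: "J \<in> indep M" "J \<subseteq> X \<union> Y" "card J = rk M (X \<union> Y)" by (rule rk_basis)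
  obtain e where e: "e \<in> J - I" "insert e I \<in> indep M"
    using indep_augment[OF I(1) J(1)] lt I J by auto
  have "rk M X + 1 \<le> rk M (insert e X)"
    using card_le_rk[OF e(2), of "insert e X"] e I indep_finite by auto
  moreover have "rk M (insert e X) = rk M X"
    using assms e J by (cases "e \<in> X") (auto simp: insert_absorb)
  ultimately show False by simp
qed

section \<open>Bases, loops and coloops\<close>

lemma base_iff: "base M B \<longleftrightarrow> B \<in> indep M \<and> card B = rk M (ground M)"
proof
  assume B: "base M B"
  then have "B \<in> indep M" by (simp add: base_def)
  then obtain Z where Z: "Z \<in> indep M" "B \<subseteq> Z" "card Z = rk M (ground M)"
    using rk_extend[OF _ indep_ground] by metis
  then have "Z = B" using B unfolding base_def by blast
  with Z show "B \<in> indep M \<and> card B = rk M (ground M)" by auto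
next
  assume B: "B \<in> indep M \<and> card B = rk M (ground M)"
  then show "base M B"
    unfolding base_def using card_le_rk indep_ground
    by (metis indep_finite leD psubset_card_mono)
qed

lemma coloopless_iff:
  "coloopless M \<longleftrightarrow> (\<forall>e\<in>ground M. rk M (ground M - {e}) = rk M (ground M))"
proof -
  have "(\<exists>B. base M B \<and> e \<notin> B) \<longleftrightarrow> rk M (ground M - {e}) = rk M (ground M)"
    if "e \<in> ground M" for e
  proof
    assume "\<exists>B. base M B \<and> e \<notin> B"
    then obtain B where B: "B \<in> indep M" "card B = rk M (ground M)" "e \<notin> B"
      by (auto simp: base_iff)
    then have "B \<subseteq> ground M - {e}" using indep_ground by blast
    then have "rk M (ground M) \<le> rk M (ground M - {e})" using B card_le_rk by metis
    then show "rk M (ground M - {e}) = rk M (ground M)"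
      using rk_mono[of "ground M - {e}" "ground M"] by simp
  next
    assume "rk M (ground M - {e}) = rk M (ground M)"
    then show "\<exists>B. base M B \<and> e \<notin> B"
      by (metis Diff_iff base_iff insertI1 rk_basis subsetD)
  qed
  then show ?thesis unfolding coloopless_def by blast
qed

lemma loopless_iff: "loopless M \<longleftrightarrow> (\<forall>e\<in>ground M. rk M {e} = 1)"
  unfolding loopless_def by (auto simp: indep_iff_rk)

lemma loopless_rk_pos:
  assumes "loopless M" "X \<subseteq> ground M" "X \<noteq> {}" shows "0 < rk M X"
proof -
  obtain e where "e \<in> X" using assms by blast
  then show ?thesis using rk_mono[of "{e}" X] assms by (auto simp: loopless_iff)
qed

section \<open>Circuits and cyclic sets\<close>

lemma circuit_finite: "circuit M C \<Longrightarrow> finite C"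
  using finite_ground finite_subset unfolding circuit_def by blast

lemma dep_imp_circuit:
  assumes "X \<subseteq> ground M" "X \<notin> indep M"
  obtains C where "circuit M C" "C \<subseteq> X"
proof -
  have "finite X" using assms finite_ground finite_subset by blast
  then have "\<exists>C. circuit M C \<and> C \<subseteq> X" using assms
  proof (induction X rule: finite_psubset_induct)
    case (psubset X)
    show ?case
    proof (cases "\<forall>Y. Y \<subset> X \<longrightarrow> Y \<in> indep M")
      case True
      then show ?thesis using psubset.prems unfolding circuit_def by blast
    next
      case False
      then obtain Y where "Y \<subset> X" "Y \<notin> indep M" by blast
      then show ?thesis using psubset by (meson dual_order.trans psubset_imp_subset)
    qed
  qed
  then show thesis using that by blast
qed

lemma circuit_remove_indep: "circuit M C \<Longrightarrow> e \<in> C \<Longrightarrow> C - {e} \<in> indep M"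
  unfolding circuit_def by blast

lemma circuit_nonempty: "circuit M C \<Longrightarrow> C \<noteq> {}"
  using indep_empty unfolding circuit_def by blast

lemma circuit_rk:
  assumes "circuit M C" shows "card C = rk M C + 1"
proof -
  obtain e where e: "e \<in> C" using circuit_nonempty assms by blast
  then have "card (C - {e}) \<le> rk M C"
    using card_le_rk[OF circuit_remove_indep[OF assms e], of C] by blast
  moreover have "rk M C \<noteq> card C" using assms indep_iff_rk unfolding circuit_def by blast
  ultimately show ?thesis
    using rk_le_card[OF circuit_finite[OF assms]] e circuit_finite[OF assms] by simp
qed

lemma circuit_rk_remove:
  assumes "circuit M C" "e \<in> C" shows "rk M (C - {e}) = rk M C"
  using rk_indep[OF circuit_remove_indep[OF assms]] circuit_rk[OF assms(1)] assms
    circuit_finite[OF assms(1)] by simp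

lemma circuit_span:
  assumes "circuit M C" "e \<in> C" "C - {e} \<subseteq> X" shows "rk M (insert e X) = rk M X"
  using rk_insert_eq_mono[of e "C - {e}" X] circuit_rk_remove[OF assms(1,2)] assms
  by (simp add: insert_absorb)

text \<open>The fundamental circuit of \<open>e\<close> with respect to a basis \<open>I\<close> of
  \<open>X\<close>; it contains \<open>e\<close> because \<open>I\<close> is independent.\<close>

lemma span_imp_circuit:
  assumes "e \<in> ground M" "e \<notin> X" "X \<subseteq> ground M" "rk M (insert e X) = rk M X"
  obtains C where "circuit M C" "e \<in> C" "C \<subseteq> insert e X"
proof -
  obtain I where I: "I \<in> indep M" "I \<subseteq> X" "card I = rk M X" by (rule rk_basis)
  have "insert e I \<notin> indep M"
  proof
    assume "insert e I \<in> indep M"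
    then have "card (insert e I) \<le> rk M (insert e X)" using card_le_rk I by (metis insert_mono)
    moreover have "e \<notin> I" "finite I" using assms I indep_finite by auto
    ultimately show False using assms I by simp
  qed
  then obtain C where C: "circuit M C" "C \<subseteq> insert e I"
    using dep_imp_circuit[of "insert e I"] assms I by (metis insert_subset subset_trans)
  have "e \<in> C"
  proof (rule ccontr)
    assume "e \<notin> C"
    then have "C \<subseteq> I" using C by blast
    then have "C \<in> indep M" using I(1) indep_hereditary by blast
    then show False using C by (simp add: circuit_def)
  qed
  moreover have "C \<subseteq> insert e X" using C(2) I(2) by blast
  ultimately show thesis using that C(1) by blast
qed

text \<open>A union of circuits is a set whose restriction has no coloops. In this rank form the
  property is easily carried over to closures and separators.\<close>

lemma cyclic_iff:
  "cyclic_set M X \<longleftrightarrow> X \<subseteq> ground M \<and> (\<forall>e\<in>X. rk M (X - {e}) = rk M X)"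
proof
  assume "cyclic_set M X"
  then obtain \<C> where C: "\<forall>C\<in>\<C>. circuit M C" "X = \<Union>\<C>" unfolding cyclic_set_def by blast
  have "rk M (X - {e}) = rk M X" if "e \<in> X" for e
  proof -
    obtain C where "C \<in> \<C>" "e \<in> C" using C \<open>e \<in> X\<close> by auto
    then have "rk M (insert e (X - {e})) = rk M (X - {e})"
      using C by (intro circuit_span[of C e]) auto
    then show ?thesis using that by (simp add: insert_absorb)
  qed
  then show "X \<subseteq> ground M \<and> (\<forall>e\<in>X. rk M (X - {e}) = rk M X)"
    using C unfolding circuit_def by blast
next
  assume X: "X \<subseteq> ground M \<and> (\<forall>e\<in>X. rk M (X - {e}) = rk M X)"
  have "\<exists>C. circuit M C \<and> e \<in> C \<and> C \<subseteq> X" if "e \<in> X" for e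
  proof -
    have "rk M (insert e (X - {e})) = rk M (X - {e})" using X that by (simp add: insert_absorb)
    moreover have "e \<in> ground M" "e \<notin> X - {e}" "X - {e} \<subseteq> ground M" using X that by auto
    ultimately obtain C where "circuit M C" "e \<in> C" "C \<subseteq> insert e (X - {e})"
      using span_imp_circuit by metis
    then show ?thesis using that by (auto simp: insert_absorb)
  qed
  then have "X = \<Union>{C. circuit M C \<and> C \<subseteq> X}" by (intro equalityI subsetI) auto
  then show "cyclic_set M X"
    unfolding cyclic_set_def by (intro exI[of _ "{C. circuit M C \<and> C \<subseteq> X}"]) simp
qed

section \<open>Flats and closure\<close>

lemma flat_rk_less:
  assumes "flat M F" "F \<subset> X" "X \<subseteq> ground M" shows "rk M F < rk M X"
proof -
  obtain e where e: "e \<in> X" "e \<notin> F" using assms by blast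
  then have "rk M F < rk M (insert e F)" using assms unfolding flat_def by blast
  also have "\<dots> \<le> rk M X" using e assms by (intro rk_mono) auto
  finally show ?thesis .
qed

lemma flat_ground: "flat M F \<Longrightarrow> F \<subseteq> ground M"
  by (simp add: flat_def)

lemma flat_notinD:
  assumes "flat M F" "e \<in> ground M" "e \<notin> F" "X \<subseteq> F" shows "rk M X < rk M (insert e X)"
proof -
  have "rk M F < rk M (insert e F)" using assms unfolding flat_def by blast
  then have "rk M (insert e X) \<noteq> rk M X" using rk_insert_eq_mono[of e X F] assms by auto
  then show ?thesis using rk_le_insert[of X e] by linarith
qed

text \<open>The closure operator: for \<open>X\<close> inside the ground set, \<open>cl X\<close> is
  the smallest flat containing \<open>X\<close>.\<close>

definition cl :: "'a set \<Rightarrow> 'a set" where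
  "cl X = {e \<in> ground M. rk M (insert e X) = rk M X}"

lemma cl_ground: "cl X \<subseteq> ground M" by (auto simp: cl_def)

lemma subset_cl: "X \<subseteq> ground M \<Longrightarrow> X \<subseteq> cl X"
  by (auto simp: cl_def insert_absorb)

lemma rk_cl: "X \<subseteq> ground M \<Longrightarrow> rk M (cl X) = rk M X"
  using rk_absorb[of "cl X" X] subset_cl[of X] by (auto simp: cl_def Un_absorb1)

lemma flat_cl:
  assumes "X \<subseteq> ground M" shows "flat M (cl X)"
  unfolding flat_def
proof (intro conjI ballI)
  fix e assume e: "e \<in> ground M - cl X"
  then have "rk M (insert e X) \<noteq> rk M X" by (simp add: cl_def)
  then have "rk M X < rk M (insert e X)" using rk_le_insert[of X e] by linarith
  also have "\<dots> \<le> rk M (insert e (cl X))" using subset_cl[OF assms] by (intro rk_mono) auto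
  finally show "rk M (cl X) < rk M (insert e (cl X))" using rk_cl[OF assms] by simp
qed (rule cl_ground)

lemma cyclic_cl:
  assumes "cyclic_set M X" shows "cyclic_set M (cl X)"
proof -
  have X: "X \<subseteq> ground M" "\<And>e. e \<in> X \<Longrightarrow> rk M (X - {e}) = rk M X" using assms cyclic_iff by auto
  have "rk M (cl X - {e}) = rk M (cl X)" if e: "e \<in> cl X" for e
  proof -
    have "rk M X = rk M (X - {e})"
      using X(2) by (cases "e \<in> X") auto
    also have "\<dots> \<le> rk M (cl X - {e})" using subset_cl[OF X(1)] by (intro rk_mono) auto
    finally show ?thesis using rk_cl[OF X(1)] rk_mono[of "cl X - {e}" "cl X"] by auto
  qed
  then show ?thesis using cyclic_iff cl_ground by blast
qed

lemma cl_mono_flat: "X \<subseteq> F \<Longrightarrow> flat M F \<Longrightarrow> cl X \<subseteq> F"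
  using flat_notinD[of F _ X] unfolding cl_def by force

lemma circuit_cyclic: "circuit M C \<Longrightarrow> cyclic_set M C"
  unfolding cyclic_set_def by (rule exI[of _ "{C}"]) simp

text \<open>A circuit has rank one less than its size, so the bound on \<open>card C\<close> keeps
  the closure away from the ground set. Short circuits thereby turn into proper cyclic
  flats.\<close>

lemma proper_cyclic_flat_cl_circuit:
  assumes "loopless M" "circuit M C" "card C \<le> rk M (ground M)"
  shows "proper_cyclic_flat M (cl C)"
proof -
  have C: "C \<subseteq> ground M" using assms by (simp add: circuit_def)
  have "rk M (cl C) < rk M (ground M)" using circuit_rk[OF assms(2)] rk_cl[OF C] assms by simp
  then show ?thesis
    unfolding proper_cyclic_flat_def proper_flat_def
    using flat_cl[OF C] cyclic_cl[OF circuit_cyclic[OF assms(2)]] rk_cl[OF C]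
      loopless_rk_pos[OF assms(1) C] circuit_nonempty[OF assms(2)] by auto
qed

lemma coloop_of_rk_diff:
  assumes "A \<subseteq> T" "finite T" "rk M T = rk M A + card (T - A)" "e \<in> T - A"
  shows "rk M (T - {e}) < rk M T"
proof -
  have eq: "A \<union> (T - A - {e}) = T - {e}" using assms by blast
  have "rk M (T - {e}) \<le> rk M A + card (T - A - {e})"
    using rk_union_le_card[of "T - A - {e}" A] assms(2) eq by simp
  moreover have "card (T - A - {e}) < card (T - A)" using assms by (intro psubset_card_mono) auto
  ultimately show ?thesis using assms by linarith
qed

end

section \<open>Separators\<close>

context matroid
begin

text \<open>Separators of the minor obtained from \<open>M\<close> by restricting to \<open>T\<close> and contracting \<open>A\<close>; both
  \<open>A\<close> and the separating set keep the contracted elements, so that everything is expressed by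
  the rank function of \<open>M\<close>.\<close>

definition sep :: "'a set \<Rightarrow> 'a set \<Rightarrow> 'a set \<Rightarrow> bool" where
  "sep A T X \<longleftrightarrow> A \<subseteq> X \<and> X \<subseteq> T \<and> rk M X + rk M (A \<union> (T - X)) = rk M T + rk M A"

definition conn :: "'a set \<Rightarrow> 'a set \<Rightarrow> bool" where
  "conn A T \<longleftrightarrow> (\<forall>X. sep A T X \<longrightarrow> X = A \<or> X = T)"

lemma sep_ge:
  assumes "A \<subseteq> X" "X \<subseteq> T"
  shows "rk M T + rk M A \<le> rk M X + rk M (A \<union> (T - X))"
proof -
  have "X \<union> (A \<union> (T - X)) = T" "X \<inter> (A \<union> (T - X)) = A" using assms by auto
  then show ?thesis using rk_submod[of X "A \<union> (T - X)"] by simp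
qed

lemma sepI:
  assumes "A \<subseteq> X" "X \<subseteq> T" "rk M X + rk M (A \<union> (T - X)) \<le> rk M T + rk M A"
  shows "sep A T X"
  using assms sep_ge[OF assms(1,2)] unfolding sep_def by simp

lemma sep_compl: "sep A T X \<Longrightarrow> sep A T (A \<union> (T - X))"
proof -
  assume s: "sep A T X"
  then have "A \<union> (T - (A \<union> (T - X))) = X" unfolding sep_def by blast
  then show ?thesis using s unfolding sep_def by auto
qed

text \<open>Two submodular inequalities, for \<open>W\<close> with \<open>X\<close> and for
  \<open>W \<union> X\<close> with the other side of the separator, add up to one bound; the
  opposite bound is submodularity inside \<open>W\<close>.\<close>

lemma sep_restrict:
  assumes "sep A T X" "A \<subseteq> W" "W \<subseteq> T"
  shows "rk M W + rk M A = rk M (W \<inter> X) + rk M (A \<union> (W - X))"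
proof -
  have X: "A \<subseteq> X" "X \<subseteq> T" "rk M X + rk M (A \<union> (T - X)) = rk M T + rk M A"
    using assms by (auto simp: sep_def)
  have "rk M (W \<union> X) + rk M (W \<inter> X) \<le> rk M W + rk M X" by (rule rk_submod)
  moreover have "rk M (W \<union> X \<union> (A \<union> (T - X))) + rk M ((W \<union> X) \<inter> (A \<union> (T - X)))
      \<le> rk M (W \<union> X) + rk M (A \<union> (T - X))" by (rule rk_submod)
  moreover have "W \<union> X \<union> (A \<union> (T - X)) = T" "(W \<union> X) \<inter> (A \<union> (T - X)) = A \<union> (W - X)"
    using X assms by auto
  moreover have "rk M W + rk M A \<le> rk M (W \<inter> X) + rk M (A \<union> (W - X))"
  proof -
    have "(W \<inter> X) \<union> (A \<union> (W - X)) = W" "(W \<inter> X) \<inter> (A \<union> (W - X)) = A" using X assms by auto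
    then show ?thesis using rk_submod[of "W \<inter> X" "A \<union> (W - X)"] by simp
  qed
  ultimately show ?thesis using X by simp
qed

text \<open>Both parts of a circuit crossing the separator are independent and their ranks add up,
  so the circuit would have full rank.\<close>

lemma sep_circuit:
  assumes "sep {} (ground M) X" "circuit M C" shows "C \<subseteq> X \<or> C \<inter> X = {}"
proof (rule ccontr)
  assume "\<not> ?thesis"
  then have "C \<inter> X \<subset> C" "C - X \<subset> C" by auto
  then have "C \<inter> X \<in> indep M" "C - X \<in> indep M" using assms unfolding circuit_def by blast+
  then have "rk M (C \<inter> X) = card (C \<inter> X)" "rk M (C - X) = card (C - X)" using rk_indep by auto
  moreover have "rk M C = rk M (C \<inter> X) + rk M (C - X)"
    using sep_restrict[OF assms(1), of C] assms(2) by (simp add: circuit_def)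
  moreover have "card C = card (C \<inter> X) + card (C - X)"
    using card_Int_Diff circuit_finite[OF assms(2)] by metis
  ultimately show False using circuit_rk[OF assms(2)] by simp
qed

text \<open>Bases of the two sides together have more elements than the rank, so their union is
  dependent; a circuit in it cannot stay within one of the two independent halves.\<close>

lemma not_sep_circuit:
  assumes "X \<subseteq> ground M" "\<not> sep {} (ground M) X"
  obtains C where "circuit M C" "C \<inter> X \<noteq> {}" "\<not> C \<subseteq> X"
proof -
  obtain I where I: "I \<in> indep M" "I \<subseteq> X" "card I = rk M X" by (rule rk_basis)
  obtain J where J: "J \<in> indep M" "J \<subseteq> ground M - X" "card J = rk M (ground M - X)" by (rule rk_basis)
  have sub: "I \<union> J \<subseteq> ground M" using I J assms by blast
  have "I \<union> J \<notin> indep M"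
  proof
    assume "I \<union> J \<in> indep M"
    then have "card (I \<union> J) \<le> rk M (ground M)" using card_le_rk sub by blast
    moreover have "card (I \<union> J) = card I + card J"
      using I J by (intro card_Un_disjoint) (auto intro: indep_finite)
    ultimately show False using I J assms sepI[of "{}" X "ground M"] by simp
  qed
  then obtain C where C: "circuit M C" "C \<subseteq> I \<union> J" using dep_imp_circuit sub by metis
  have "\<not> C \<subseteq> I" "\<not> C \<subseteq> J"
    using C(1) I(1) J(1) indep_hereditary unfolding circuit_def by blast+
  then have "C \<inter> X \<noteq> {}" "\<not> C \<subseteq> X" using C(2) I(2) J(2) by blast+
  then show thesis using that C(1) by blast
qed

text \<open>The set \<open>C \<union> D - {x, y}\<close> spans \<open>x\<close> through
  \<open>D\<close>, which misses \<open>y\<close>, and together with \<open>x\<close> it spans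
  \<open>y\<close> through \<open>C\<close>. So it spans \<open>y\<close> by itself, and the
  fundamental circuit is the desired one.\<close>

lemma strong_circuit_elimination:
  assumes "circuit M C" "circuit M D" "x \<in> C \<inter> D" "y \<in> C - D"
  obtains E where "circuit M E" "y \<in> E" "E \<subseteq> C \<union> D - {x}"
proof -
  let ?T = "C \<union> D - {x, y}"
  have g: "C \<subseteq> ground M" "D \<subseteq> ground M" using assms by (auto simp: circuit_def)
  have "rk M (insert x ?T) = rk M ?T"
    using assms by (intro circuit_span[of D x]) auto
  moreover have "rk M (insert y (insert x ?T)) = rk M (insert x ?T)"
    using assms by (intro circuit_span[of C y]) auto
  moreover have "rk M (insert y ?T) \<le> rk M (insert y (insert x ?T))" by (rule rk_mono) blast
  ultimately have "rk M (insert y ?T) = rk M ?T" using rk_le_insert[of ?T y] by simp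
  then obtain E where "circuit M E" "y \<in> E" "E \<subseteq> insert y ?T"
    by (rule span_imp_circuit[rotated 3]) (use assms g in auto)
  moreover have "insert y ?T \<subseteq> C \<union> D - {x}" using assms by auto
  ultimately show thesis using that by blast
qed

text \<open>The standard argument: among the pairs of a circuit \<open>C\<close> through \<open>e\<close> and a circuit \<open>D\<close> through
  \<open>f\<close> that meet, one with minimal union yields a circuit through both elements.\<close>

lemma circuit_trans:
  assumes "circuit M C" "circuit M D" "e \<in> C" "f \<in> D" "C \<inter> D \<noteq> {}"
  shows "\<exists>E. circuit M E \<and> e \<in> E \<and> f \<in> E"
  using assms
proof (induction "card (C \<union> D)" arbitrary: C D rule: less_induct)
  case less
  show ?case
  proof (rule ccontr)
    assume no: "\<not> ?thesis"
    have fin: "finite (C \<union> D)" using less.prems circuit_finite by blast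
    have small: "x \<in> A \<union> B"
      if "circuit M A" "circuit M B" "e \<in> A" "f \<in> B" "A \<inter> B \<noteq> {}" "A \<union> B \<subseteq> C \<union> D"
        "x \<in> C \<union> D" for A B x
    proof (rule ccontr)
      assume "x \<notin> A \<union> B"
      then have "card (A \<union> B) < card (C \<union> D)" using that fin by (intro psubset_card_mono) auto
      from less.hyps[OF this that(1-5)] no show False by blast
    qed
    have ef: "e \<notin> D" "f \<notin> C" using no less.prems by blast+
    \<comment> \<open>Eliminating \<open>x\<close> yields circuits \<open>D'\<close> through
      \<open>f\<close> and \<open>C'\<close> through \<open>e\<close> that both miss
      \<open>x\<close>. If these two meet, they contradict minimality.\<close>
    obtain x where x: "x \<in> C" "x \<in> D" using less.prems by blast
    obtain D' where D': "circuit M D'" "f \<in> D'" "D' \<subseteq> C \<union> D - {x}"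
      by (rule strong_circuit_elimination[OF less.prems(2,1), of x f]) (use less.prems ef x in auto)
    obtain C' where C': "circuit M C'" "e \<in> C'" "C' \<subseteq> C \<union> D - {x}"
      by (rule strong_circuit_elimination[OF less.prems(1,2), of x e]) (use less.prems ef x in auto)
    have minimal: False if "circuit M A" "circuit M B" "A \<subseteq> B" "x \<in> B" "x \<notin> A" for A B
    proof -
      have "A \<subset> B" using that by blast
      then show False using that(1,2) by (simp add: circuit_def)
    qed
    have "D' \<inter> C \<noteq> {}"
    proof
      assume "D' \<inter> C = {}"
      then have "D' \<subseteq> D" using D' by blast
      then show False using minimal[OF D'(1) less.prems(2)] x D' by blast
    qed
    \<comment> \<open>The pair \<open>C\<close>, \<open>D'\<close> meets, so by minimality its union
      is all of \<open>C \<union> D\<close>. Hence \<open>D'\<close> contains everything outside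
      \<open>C\<close>, and \<open>C'\<close>, which is not a subset of \<open>C\<close>, must meet
      it.\<close>
    then have sub1: "D - C \<subseteq> D'"
      using small[OF less.prems(1) D'(1) less.prems(3) D'(2)] D' by blast
    have "\<not> C' \<subseteq> C" using minimal[OF C'(1) less.prems(1)] x C' by blast
    then have "C' \<inter> D' \<noteq> {}" using C' sub1 by blast
    then have "x \<in> C' \<union> D'"
      using small[OF C'(1) D'(1) C'(2) D'(2)] C' D' x by blast
    then show False using C' D' by blast
  qed
qed

lemma connected_iff_conn: "connected_matroid M \<longleftrightarrow> conn {} (ground M)"
proof
  assume c: "connected_matroid M"
  show "conn {} (ground M)"
    unfolding conn_def
  proof (intro allI impI)
    fix X assume s: "sep {} (ground M) X"
    show "X = {} \<or> X = ground M"
    proof (rule ccontr)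
      assume "\<not> ?thesis"
      moreover have "X \<subseteq> ground M" using s by (simp add: sep_def)
      ultimately obtain e f where "e \<in> X" "f \<in> ground M - X" by blast
      moreover from this obtain C where "circuit M C" "e \<in> C" "f \<in> C"
        using c \<open>X \<subseteq> ground M\<close> unfolding connected_matroid_def by (metis DiffD1 DiffD2 subsetD)
      ultimately show False using sep_circuit[OF s] by blast
    qed
  qed
next
  assume c: "conn {} (ground M)"
  have "\<exists>C. circuit M C \<and> e \<in> C \<and> f \<in> C" if e: "e \<in> ground M" "f \<in> ground M" "e \<noteq> f" for e f
  proof (rule ccontr)
    assume no: "\<not> ?thesis"
    \<comment> \<open>The class of \<open>e\<close> under lying in a common circuit. A circuit
      leaving the class could be chained with one through \<open>e\<close> by
      \<open>circuit_trans\<close>, so the class is a separator.\<close>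
    define X where "X = {g \<in> ground M. g = e \<or> (\<exists>C. circuit M C \<and> e \<in> C \<and> g \<in> C)}"
    have "e \<in> X" "f \<notin> X" "X \<subseteq> ground M" using e no by (auto simp: X_def)
    then have "\<not> sep {} (ground M) X" using c e unfolding conn_def by blast
    then obtain C where C: "circuit M C" "C \<inter> X \<noteq> {}" "\<not> C \<subseteq> X"
      using not_sep_circuit \<open>X \<subseteq> ground M\<close> by metis
    then obtain g h where gh: "g \<in> C" "g \<in> X" "h \<in> C" "h \<notin> X" by blast
    have "\<exists>E. circuit M E \<and> e \<in> E \<and> h \<in> E"
    proof (cases "g = e")
      case False
      then obtain D where "circuit M D" "e \<in> D" "g \<in> D" using gh by (auto simp: X_def)
      then show ?thesis using circuit_trans[of D C e h] C gh by blast
    qed (use C gh in blast)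
    moreover have "h \<in> ground M" using C(1) gh(3) by (auto simp: circuit_def)
    ultimately show False using gh(4) by (simp add: X_def)
  qed
  then show "connected_matroid M" unfolding connected_matroid_def by blast
qed

section \<open>Excluded minor\<close>

lemma indep_insertI:
  assumes "I \<in> indep M" "e \<in> ground M" "rk M (insert e I) \<noteq> rk M I"
  shows "insert e I \<in> indep M"
proof -
  have "e \<notin> I" using assms by (auto simp: insert_absorb)
  moreover have "rk M (insert e I) = rk M I + 1"
    using rk_insert_le[of e I] rk_le_insert[of I e] assms(3) by linarith
  ultimately show ?thesis
    using assms indep_ground[OF assms(1)] indep_finite[OF assms(1)] rk_indep[OF assms(1)]
    unfolding indep_iff_rk[of "insert e I"] by simp
qed

end

text \<open>After contracting \<open>I\<close> the element \<open>a\<close> is a loop, \<open>b\<close> and \<open>c\<close> are parallel and \<open>d\<close> is a coloop of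
  the restriction to these four elements.\<close>

definition obstruction :: "'a indep_system \<Rightarrow> bool" where
  "obstruction M \<longleftrightarrow> (\<exists>I a b c d.
     insert b (insert d I) \<in> indep M \<and> insert c (insert d I) \<in> indep M \<and>
     insert a I \<notin> indep M \<and> insert b (insert c I) \<notin> indep M \<and>
     a \<in> ground M \<and> d \<notin> I)"

lemma indep_direct_sumI: "X \<in> indep M \<Longrightarrow> Y \<in> indep N \<Longrightarrow> X \<union> Y \<in> indep (direct_sum M N)"
  by (auto simp: direct_sum_def)

lemma indep_unif: "X \<in> indep (unif k E) \<longleftrightarrow> X \<subseteq> E \<and> card X \<le> k"
  by (simp add: unif_def)

text \<open>\<open>0\<close> is the loop, \<open>1\<close> and \<open>2\<close> are the parallel
  pair and \<open>3\<close> is the coloop, so the only circuits are \<open>{0}\<close> and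
  \<open>{1, 2}\<close>.\<close>

lemma indep_forbidden_matroid:
  "X \<in> indep forbidden_matroid \<longleftrightarrow> X \<subseteq> {1, 2, 3} \<and> \<not> {1, 2} \<subseteq> X"
proof
  assume "X \<in> indep forbidden_matroid"
  then obtain Y Z where Y: "Y \<subseteq> {1, 2}" "card Y \<le> 1" and Z: "Z \<subseteq> {3}" and X: "X = Y \<union> Z"
    unfolding forbidden_matroid_def direct_sum_def unif_def
    by (auto simp: card_eq_0_iff dest: finite_subset)
  have "\<not> {1, 2} \<subseteq> Y"
  proof
    assume "{1, 2} \<subseteq> Y"
    then have "Y = {1, 2}" using Y by blast
    then show False using Y by simp
  qed
  then show "X \<subseteq> {1, 2, 3} \<and> \<not> {1, 2} \<subseteq> X" using X Y Z by auto
next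
  assume X: "X \<subseteq> {1, 2, 3} \<and> \<not> {1, 2} \<subseteq> X"
  have "X = ({} \<union> (X \<inter> {1, 2})) \<union> (X \<inter> {3})" using X by auto
  moreover have "card (X \<inter> {1, 2}) \<le> 1"
  proof -
    have "X \<inter> {1, 2} \<subseteq> {1} \<or> X \<inter> {1, 2} \<subseteq> {2}" using X by auto
    then show ?thesis by (metis card.empty card_insert_disjoint card_mono empty_iff finite.emptyI
          finite.insertI One_nat_def)
  qed
  moreover have "card (X \<inter> {3}) \<le> 1" using card_mono[of "{3}" "X \<inter> {3}"] by simp
  ultimately show "X \<in> indep forbidden_matroid"
    unfolding forbidden_matroid_def
    by (subst \<open>X = _\<close>, intro indep_direct_sumI) (simp_all add: indep_unif)
qed

lemma ground_forbidden_matroid: "ground forbidden_matroid = {0, 1, 2, 3}"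
  by (auto simp: forbidden_matroid_def direct_sum_def unif_def)

context matroid
begin

text \<open>\<open>I\<close> spans \<open>C\<close>, so adding \<open>C\<close> to
  \<open>X \<union> I\<close> does not change the rank. This is why \<open>obstruction\<close> can
  contract an independent set instead of an arbitrary one.\<close>

lemma indep_contraction_iff:
  assumes I: "I \<in> indep M" "I \<subseteq> C" "card I = rk M C" and C: "C \<subseteq> ground M"
    and X: "X \<subseteq> ground M - C"
  shows "X \<in> indep (contraction M C) \<longleftrightarrow> X \<union> I \<in> indep M"
proof -
  have "rk M (insert e I) = rk M I" if "e \<in> C" for e
    using rk_mono[of "insert e I" C] I that rk_indep[OF I(1)] rk_le_insert[of I e] by simp
  then have "rk M (insert e (X \<union> I)) = rk M (X \<union> I)" if "e \<in> C" for e
    using rk_insert_eq_mono[of e I "X \<union> I"] that by blast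
  then have "rk M ((X \<union> I) \<union> C) = rk M (X \<union> I)" by (rule rk_absorb)
  moreover have "X \<union> I \<union> C = X \<union> C" using I by blast
  moreover have "card (X \<union> I) = card X + card I"
    using I X C finite_ground by (intro card_Un_disjoint) (auto intro: finite_subset)
  moreover have "X \<union> I \<subseteq> ground M" using I X C by blast
  ultimately show ?thesis
    using X I by (simp add: contraction_def indep_iff_rk[of "X \<union> I"])
qed

text \<open>A basis of the contracted set serves as \<open>I\<close>; conversely, \<open>I\<close>
  is contracted and everything except the four elements is deleted.\<close>

lemma forbidden_minor_iff:
  "(\<exists>N. minor_of N M \<and> isomorphic N forbidden_matroid) \<longleftrightarrow> obstruction M"
proof
  assume "\<exists>N. minor_of N M \<and> isomorphic N forbidden_matroid"
  then obtain C D f where C: "C \<subseteq> ground M" "D \<subseteq> ground M" "C \<inter> D = {}"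
    and f: "bij_betw f (ground (deletion (contraction M C) D)) {0, 1, 2, 3 :: nat}"
    and fi: "\<And>X. X \<subseteq> ground (deletion (contraction M C) D) \<Longrightarrow>
       X \<in> indep (deletion (contraction M C) D) \<longleftrightarrow> f ` X \<in> indep forbidden_matroid"
    unfolding minor_of_def isomorphic_def ground_forbidden_matroid by blast
  have g: "ground (deletion (contraction M C) D) = ground M - C - D"
    by (simp add: deletion_def contraction_def)
  obtain I where I: "I \<in> indep M" "I \<subseteq> C" "card I = rk M C" by (rule rk_basis)
  have "\<exists>x\<in>ground M - C - D. f x = n" if "n \<in> {0, 1, 2, 3}" for n
    using f that unfolding bij_betw_def g by (metis imageE)
  then obtain a b c d where abcd: "a \<in> ground M - C - D" "b \<in> ground M - C - D"
    "c \<in> ground M - C - D" "d \<in> ground M - C - D" and fv: "f a = 0" "f b = 1" "f c = 2" "f d = 3"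
    by (metis insertCI)
  have ind: "X \<union> I \<in> indep M \<longleftrightarrow> f ` X \<in> indep forbidden_matroid" if "X \<subseteq> {a, b, c, d}" for X
  proof -
    have X: "X \<subseteq> ground M - C" "X \<inter> D = {}" "X \<subseteq> ground M - C - D" using that abcd by auto
    then have "X \<in> indep (contraction M C) \<longleftrightarrow> f ` X \<in> indep forbidden_matroid"
      using fi[of X] unfolding g by (simp add: deletion_def)
    then show ?thesis using indep_contraction_iff[OF I C(1) X(1)] by simp
  qed
  have "insert b (insert d I) \<in> indep M" "insert c (insert d I) \<in> indep M"
    "insert a I \<notin> indep M" "insert b (insert c I) \<notin> indep M"
    using ind[of "{b, d}"] ind[of "{c, d}"] ind[of "{a}"] ind[of "{b, c}"]
    by (simp_all add: indep_forbidden_matroid fv)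
  then show "obstruction M" unfolding obstruction_def using abcd I by blast
next
  assume "obstruction M"
  then obtain I a b c d where bd: "insert b (insert d I) \<in> indep M"
    and cd: "insert c (insert d I) \<in> indep M" and a: "insert a I \<notin> indep M" "a \<in> ground M"
    and bc: "insert b (insert c I) \<notin> indep M" and d: "d \<notin> I"
    unfolding obstruction_def by blast
  \<comment> \<open>A set consisting of elements of \<open>I\<close> and some of the four elements,
    without \<open>a\<close> and without the pair \<open>b\<close>, \<open>c\<close>, lies in one of
    these two independent sets.\<close>
  have her: "X \<in> indep M" if "X \<subseteq> insert b (insert d I) \<or> X \<subseteq> insert c (insert d I)" for X
    using that bd cd indep_hereditary by blast
  have I: "I \<in> indep M" by (rule her) blast
  \<comment> \<open>Beyond \<open>d \<notin> I\<close>, distinctness is forced: a coincidence would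
    contradict one of the four conditions on independence.\<close>
  have neq: "a \<notin> I" "b \<notin> I" "c \<notin> I" "a \<noteq> b" "a \<noteq> c" "a \<noteq> d" "b \<noteq> c" "b \<noteq> d" "c \<noteq> d"
  proof -
    show "a \<notin> I" using a I by (auto simp: insert_absorb)
    have "insert b I \<in> indep M" "insert c I \<in> indep M" "insert d I \<in> indep M"
      by (rule her; blast)+
    then show "b \<notin> I" "c \<notin> I" "b \<noteq> c" "a \<noteq> b" "a \<noteq> c" "a \<noteq> d"
      using bc a by (auto simp: insert_absorb)
    show "b \<noteq> d" "c \<noteq> d" using bc cd bd by (auto simp: insert_commute)
  qed
  have gr: "{a, b, c, d} \<subseteq> ground M" "I \<subseteq> ground M" using a bd cd indep_ground by blast+
  define D where "D = ground M - I - {a, b, c, d}"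
  define N where "N = deletion (contraction M I) D"
  define f where "f x = (if x = a then 0 else if x = b then 1 else if x = c then 2 else 3 :: nat)" for x
  have gN: "ground N = {a, b, c, d}"
    using gr neq d by (auto simp: N_def deletion_def contraction_def D_def)
  have inN: "X \<in> indep N \<longleftrightarrow> X \<union> I \<in> indep M" if "X \<subseteq> {a, b, c, d}" for X
  proof -
    have X: "X \<subseteq> ground M - I" "X \<inter> D = {}" using that gr neq d by (auto simp: D_def)
    then show ?thesis
      using indep_contraction_iff[OF I _ _ gr(2) X(1)] rk_indep[OF I]
      by (simp add: N_def deletion_def)
  qed
  have "bij_betw f (ground N) (ground forbidden_matroid)"
    unfolding gN ground_forbidden_matroid using neq
    by (auto simp: bij_betw_def inj_on_def f_def)
  moreover have "X \<in> indep N \<longleftrightarrow> f ` X \<in> indep forbidden_matroid" if "X \<subseteq> ground N" for X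
  proof -
    have X: "X \<subseteq> {a, b, c, d}" using that gN by simp
    have "f ` X \<subseteq> {1, 2, 3} \<longleftrightarrow> a \<notin> X" using X neq by (auto simp: f_def)
    moreover have "1 \<in> f ` X \<longleftrightarrow> b \<in> X" "2 \<in> f ` X \<longleftrightarrow> c \<in> X"
      using X neq by (auto simp: f_def image_iff split: if_splits)
    ultimately have fX: "f ` X \<in> indep forbidden_matroid \<longleftrightarrow> a \<notin> X \<and> \<not> (b \<in> X \<and> c \<in> X)"
      by (simp add: indep_forbidden_matroid)
    have "X \<union> I \<in> indep M \<longleftrightarrow> a \<notin> X \<and> \<not> (b \<in> X \<and> c \<in> X)"
    proof
      assume XI: "X \<union> I \<in> indep M"
      have "insert a I \<in> indep M" if "a \<in> X"
        using indep_hereditary[OF XI, of "insert a I"] that by blast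
      moreover have "insert b (insert c I) \<in> indep M" if "b \<in> X" "c \<in> X"
        using indep_hereditary[OF XI, of "insert b (insert c I)"] that by blast
      ultimately show "a \<notin> X \<and> \<not> (b \<in> X \<and> c \<in> X)" using a bc by blast
    next
      assume "a \<notin> X \<and> \<not> (b \<in> X \<and> c \<in> X)"
      then show "X \<union> I \<in> indep M" using X by (intro her) blast
    qed
    then show ?thesis using fX inN[OF X] by simp
  qed
  ultimately have "isomorphic N forbidden_matroid" unfolding isomorphic_def by blast
  moreover have "minor_of N M"
    unfolding minor_of_def N_def using gr by (intro exI[of _ I] exI[of _ D]) (auto simp: D_def)
  ultimately show "\<exists>N. minor_of N M \<and> isomorphic N forbidden_matroid" by blast
qed

end

section \<open>Combinatorial equivalences\<close>

lemma direct_sum_unif_iff: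
  assumes "finite E" "finite L" "E \<inter> L = {}"
  shows "X \<in> indep (direct_sum (unif k E) (unif l L)) \<longleftrightarrow>
    X \<subseteq> E \<union> L \<and> card (X \<inter> E) \<le> k \<and> card (X \<inter> L) \<le> l"
proof
  assume "X \<in> indep (direct_sum (unif k E) (unif l L))"
  then obtain Y Z where YZ: "X = Y \<union> Z" "Y \<subseteq> E" "card Y \<le> k" "Z \<subseteq> L" "card Z \<le> l"
    by (auto simp: direct_sum_def unif_def)
  then have "X \<inter> E = Y" "X \<inter> L = Z" using assms(3) by auto
  then show "X \<subseteq> E \<union> L \<and> card (X \<inter> E) \<le> k \<and> card (X \<inter> L) \<le> l" using YZ by auto
next
  assume X: "X \<subseteq> E \<union> L \<and> card (X \<inter> E) \<le> k \<and> card (X \<inter> L) \<le> l"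
  then have eq: "X = (X \<inter> E) \<union> (X \<inter> L)" by auto
  have "(X \<inter> E) \<union> (X \<inter> L) \<in> indep (direct_sum (unif k E) (unif l L))"
    using X by (intro indep_direct_sumI) (auto simp: indep_unif)
  then show "X \<in> indep (direct_sum (unif k E) (unif l L))" using eq by simp
qed

lemma ground_direct_sum_unif: "ground (direct_sum (unif k E) (unif l L)) = E \<union> L"
  by (simp add: direct_sum_def unif_def)

text \<open>The two summands themselves are the hyperedges, for rank \<open>k + l\<close>. They are
  disjoint and satisfy the intersection inequality with equality.\<close>

lemma elementary_split_direct_sum_unif:
  assumes "finite E" "finite L" "E \<inter> L = {}" "k \<le> card E" "l \<le> card L"
  shows "elementary_split (direct_sum (unif k E) (unif l L))"
  unfolding elementary_split_def
proof (intro exI conjI)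
  let ?\<rho> = "\<lambda>i::nat. if i = 1 then k else l" and ?H = "\<lambda>i::nat. if i = 1 then E else L"
  show "k + l \<le> card (ground (direct_sum (unif k E) (unif l L)))"
    using assms by (simp add: ground_direct_sum_unif card_Un_disjoint)
  show "\<forall>i\<in>{1..2}. ?H i \<subseteq> ground (direct_sum (unif k E) (unif l L))"
    by (simp add: ground_direct_sum_unif)
  show "\<forall>i j. 1 \<le> i \<and> i < j \<and> j \<le> 2 \<longrightarrow>
      int (card (?H i \<inter> ?H j)) \<le> int (?\<rho> i) + int (?\<rho> j) - int (k + l)"
  proof (intro allI impI)
    fix i j :: nat assume "1 \<le> i \<and> i < j \<and> j \<le> 2"
    then have "i = 1" "j = 2" by auto
    then show "int (card (?H i \<inter> ?H j)) \<le> int (?\<rho> i) + int (?\<rho> j) - int (k + l)"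
      using assms(3) by simp
  qed
  have "card X \<le> k + l" if "X \<subseteq> E \<union> L" "card (X \<inter> E) \<le> k" "card (X \<inter> L) \<le> l" for X
  proof -
    have "X = (X \<inter> E) \<union> (X \<inter> L)" using that by blast
    then have "card X \<le> card (X \<inter> E) + card (X \<inter> L)" using card_Un_le by metis
    then show ?thesis using that by simp
  qed
  moreover have "{1..2::nat} = {1, 2}" by auto
  ultimately show "indep (direct_sum (unif k E) (unif l L)) =
      {X. X \<subseteq> ground (direct_sum (unif k E) (unif l L)) \<and> card X \<le> k + l \<and>
          (\<forall>i\<in>{1..2}. card (X \<inter> ?H i) \<le> ?\<rho> i)}"
    using direct_sum_unif_iff[OF assms(1-3)] by (auto simp: ground_direct_sum_unif)
qed

lemma elementary_split_uniform_sum: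
  assumes "is_direct_sum M N\<^sub>1 N\<^sub>2" "uniform_matroid N\<^sub>1" "uniform_matroid N\<^sub>2"
  shows "elementary_split M"
proof -
  obtain k E l L where "finite E" "k \<le> card E" "N\<^sub>1 = unif k E" "finite L" "l \<le> card L" "N\<^sub>2 = unif l L"
    using assms unfolding uniform_matroid_def by auto
  then show ?thesis
    using assms elementary_split_direct_sum_unif[of E L k l] by (simp add: is_direct_sum_def unif_def)
qed

section \<open>Obstructions and clutters of proper cyclic flats\<close>

context matroid
begin

text \<open>The hyperedge violated by \<open>insert a I\<close> holds at least
  \<open>\<rho> i\<close> elements of \<open>I\<close>, the one violated on adding \<open>b\<close>
  and \<open>c\<close> holds at least \<open>\<rho> j - 1\<close>, and \<open>I\<close> has at most
  \<open>r - 2\<close> elements. By inclusion-exclusion \<open>H i\<close> and \<open>H j\<close>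
  share at least \<open>\<rho> i + \<rho> j - r + 1\<close> elements, one too many.\<close>

lemma elementary_split_no_obstruction:
  assumes "elementary_split M" shows "\<not> obstruction M"
proof
  obtain r q :: nat and \<rho> and H where "r \<le> card (ground M)"
    and Hg: "\<forall>i\<in>{1..q}. H i \<subseteq> ground M"
    and compat: "\<forall>i j. 1 \<le> i \<and> i < j \<and> j \<le> q \<longrightarrow>
          int (card (H i \<inter> H j)) \<le> int (\<rho> i) + int (\<rho> j) - int r"
    and ind: "indep M = {X. X \<subseteq> ground M \<and> card X \<le> r \<and> (\<forall>i\<in>{1..q}. card (X \<inter> H i) \<le> \<rho> i)}"
    using assms unfolding elementary_split_def by (elim exE conjE) (rule that)
  assume "obstruction M"
  then obtain I a b c d where bd: "insert b (insert d I) \<in> indep M"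
    and cd: "insert c (insert d I) \<in> indep M" and a: "insert a I \<notin> indep M" "a \<in> ground M"
    and bc: "insert b (insert c I) \<notin> indep M" and d: "d \<notin> I"
    unfolding obstruction_def by blast
  have b: "insert b I \<in> indep M" by (rule indep_hereditary[OF bd]) blast
  have c: "insert c I \<in> indep M" by (rule indep_hereditary[OF cd]) blast
  have I: "I \<in> indep M" by (rule indep_hereditary[OF b]) blast
  have fin: "finite I" and Ig: "I \<subseteq> ground M" using I indep_finite indep_ground by auto
  have neq: "a \<notin> I" "b \<notin> I" "c \<notin> I" "b \<noteq> c" "b \<noteq> d"
    using a b c I bc cd by (auto simp: insert_absorb insert_commute)
  have bcg: "b \<in> ground M" "c \<in> ground M" using b c indep_ground by auto
  have le: "card (insert b (insert d I)) \<le> r" using bd ind by simp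
  \<comment> \<open>This leaves room for two more elements, so the two dependent sets are not too
    large and each must violate a hyperedge.\<close>
  then have r2: "card I + 2 \<le> r" using neq d fin by simp
  have upper: "card (X \<inter> H i) \<le> \<rho> i" if "X \<in> indep M" "i \<in> {1..q}" for X i
    using that ind by simp
  obtain i where i: "i \<in> {1..q}" "card (insert a I \<inter> H i) > \<rho> i"
  proof -
    have "card (insert a I) \<le> r" using fin neq r2 by simp
    then show thesis using a Ig that unfolding ind by (auto simp: not_le)
  qed
  obtain j where j: "j \<in> {1..q}" "card (insert b (insert c I) \<inter> H j) > \<rho> j"
  proof -
    have "card (insert b (insert c I)) \<le> r" using fin neq r2 by simp
    then show thesis using bc bcg Ig that unfolding ind by (auto simp: not_le)
  qed
  have ai: "a \<in> H i" using i upper[OF I i(1)] by (cases "a \<in> H i") auto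
  then have Ii: "card (I \<inter> H i) \<ge> \<rho> i" using i fin neq by (simp add: card_insert_if)
  have bi: "b \<notin> H i"
  proof
    assume "b \<in> H i"
    then have "card (insert b I \<inter> H i) = Suc (card (I \<inter> H i))" using neq fin by simp
    then show False using upper[OF b i(1)] Ii by simp
  qed
  have bj: "b \<in> H j" using j upper[OF c j(1)] by (cases "b \<in> H j") auto
  have cj: "c \<in> H j"
  proof (rule ccontr)
    assume "c \<notin> H j"
    then have "insert b (insert c I) \<inter> H j = insert b I \<inter> H j" by auto
    then show False using j upper[OF b j(1)] by simp
  qed
  have "card (insert b (insert c I) \<inter> H j) = card (I \<inter> H j) + 2" using bj cj neq fin by simp
  then have Ij: "card (I \<inter> H j) + 1 \<ge> \<rho> j" using j by simp
  \<comment> \<open>The element \<open>b\<close> tells the hyperedges apart: \<open>H j\<close> is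
    violated only with its help, whereas \<open>H i\<close> is already full on \<open>I\<close> and
    cannot contain it.\<close>
  have "i \<noteq> j" using bi bj by blast
  then have comp: "int (card (H i \<inter> H j)) \<le> int (\<rho> i) + int (\<rho> j) - int r"
    using compat[rule_format, of i j] compat[rule_format, of j i] i(1) j(1)
    by (cases "i < j") (auto simp: Int_commute)
  have "card (I \<inter> H i) + card (I \<inter> H j) = card (I \<inter> H i \<union> I \<inter> H j) + card ((I \<inter> H i) \<inter> (I \<inter> H j))"
    using fin by (intro card_Un_Int) auto
  moreover have "card (I \<inter> H i \<union> I \<inter> H j) \<le> card I" using fin by (intro card_mono) auto
  moreover have "card ((I \<inter> H i) \<inter> (I \<inter> H j)) \<le> card (H i \<inter> H j)"
  proof -
    have "finite (H i)" using Hg i(1) finite_ground finite_subset by metis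
    then show ?thesis by (intro card_mono) auto
  qed
  ultimately show False using comp Ii Ij r2 by linarith
qed

text \<open>Extend a basis of \<open>F\<close> to a basis \<open>J\<close> of \<open>G\<close>, and
  let \<open>I\<close> be \<open>J\<close> without one new element \<open>b\<close>. After
  contracting \<open>I\<close>, an element \<open>a\<close> of \<open>F\<close> outside its basis is
  a loop; \<open>b\<close> acquires a parallel element \<open>c\<close> because it is no coloop of
  \<open>M|G\<close>; and \<open>d\<close> is not spanned by anything in \<open>G\<close>.\<close>

lemma obstructionI:
  assumes F: "F \<subseteq> G" "F \<notin> indep M" and G: "G \<subseteq> ground M" "\<And>e. e \<in> G \<Longrightarrow> rk M (G - {e}) = rk M G"
    and lt: "rk M F < rk M G" and d: "d \<in> ground M" "rk M (insert d G) \<noteq> rk M G"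
  shows "obstruction M"
proof -
  obtain I\<^sub>F where IF: "I\<^sub>F \<in> indep M" "I\<^sub>F \<subseteq> F" "card I\<^sub>F = rk M F" by (rule rk_basis)
  obtain J where J: "J \<in> indep M" "I\<^sub>F \<subseteq> J" "J \<subseteq> G" "card J = rk M G"
    by (rule rk_extend[OF IF(1), of G]) (use IF F in auto)
  obtain b where b: "b \<in> J" "b \<notin> I\<^sub>F"
  proof -
    have "J \<noteq> I\<^sub>F" using IF J lt by auto
    then show thesis using that J by blast
  qed
  have "F \<noteq> I\<^sub>F" using F IF by auto
  then obtain a where a: "a \<in> F" "a \<notin> I\<^sub>F" using IF by blast
  define I where "I = J - {b}"
  have I: "I \<in> indep M" "I\<^sub>F \<subseteq> I" using J b indep_hereditary[of J I] by (auto simp: I_def)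
  have bI: "insert b I = J" using b by (auto simp: I_def)
  obtain K where K: "K \<in> indep M" "K \<subseteq> G - {b}" "card K = rk M (G - {b})" by (rule rk_basis)
  have cardJ: "card J = card I + 1"
    using card_Suc_Diff1[OF indep_finite[OF J(1)] b(1)] by (simp add: I_def)
  have "b \<in> G" using b(1) J(3) by blast
  then have "card I < card K" using K(3) J(4) G(2)[of b] cardJ by simp
  then obtain c where c: "c \<in> K" "c \<notin> I" "insert c I \<in> indep M"
    using indep_augment[OF I(1) K(1)] by blast
  have cb: "c \<noteq> b" "c \<in> G" using c K by auto
  have rkJ: "rk M J = rk M G" using J rk_indep by simp
  have rkc: "rk M (insert c I) = rk M G"
    using rk_indep[OF c(3)] c(2) indep_finite[OF I(1)] cardJ J(4) by simp
  have IG: "I \<subseteq> G" using J by (auto simp: I_def)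
  have dnot: "rk M (insert d X) \<noteq> rk M X" if "X \<subseteq> G" for X
    using d rk_insert_eq_mono[of d X G] that by auto
  have "insert d (insert b I) \<in> indep M"
    using indep_insertI[OF _ d(1) dnot[of J]] J by (simp add: bI)
  then have 1: "insert b (insert d I) \<in> indep M" by (simp add: insert_commute)
  have "insert d (insert c I) \<in> indep M"
    by (rule indep_insertI[OF c(3) d(1) dnot]) (use IG cb in auto)
  then have 2: "insert c (insert d I) \<in> indep M" by (simp add: insert_commute)
  have 3: "insert a I \<notin> indep M"
  proof
    assume "insert a I \<in> indep M"
    then have "insert a I\<^sub>F \<in> indep M" by (rule indep_hereditary) (use I in auto)
    then have "card (insert a I\<^sub>F) \<le> rk M F" using IF a by (intro card_le_rk) auto
    then show False using IF a indep_finite[OF IF(1)] by simp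
  qed
  have 4: "insert b (insert c I) \<notin> indep M"
  proof
    assume "insert b (insert c I) \<in> indep M"
    then have "card (insert b (insert c I)) \<le> rk M G"
      using IG cb b J by (intro card_le_rk) auto
    moreover have "insert b (insert c I) = insert c J" "c \<notin> J" using bI c cb by auto
    ultimately show False using J indep_finite[OF J(1)] by simp
  qed
  have "d \<notin> I" using d IG by (auto simp: insert_absorb)
  moreover have "a \<in> ground M" using a(1) F(1) G(1) by blast
  ultimately show ?thesis unfolding obstruction_def using 1 2 3 4 by blast
qed

lemma nested_proper_cyclic_flats_obstruction:
  assumes "loopless M" "proper_cyclic_flat M F" "proper_cyclic_flat M G" "F \<subset> G"
  shows "obstruction M"
proof -
  have F: "flat M F" "cyclic_set M F" "rk M F \<noteq> 0"
    and G: "flat M G" "cyclic_set M G" "G \<noteq> ground M"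
    using assms by (auto simp: proper_cyclic_flat_def proper_flat_def)
  obtain d where d: "d \<in> ground M" "d \<notin> G" using G flat_ground by blast
  have "F \<noteq> {}" using F by auto
  then obtain C where "circuit M C" "C \<subseteq> F" using F(2) unfolding cyclic_set_def by auto
  then have "F \<notin> indep M" using indep_hereditary unfolding circuit_def by blast
  moreover have "rk M F < rk M G" by (rule flat_rk_less[OF F(1) assms(4) flat_ground[OF G(1)]])
  moreover have "rk M (insert d G) \<noteq> rk M G" using flat_notinD[OF G(1) d subset_refl] by simp
  ultimately show ?thesis
    using obstructionI[of F G d] assms(4) G(2) d flat_ground[OF G(1)] by (auto simp: cyclic_iff)
qed

text \<open>If the non-loops are not uniform, some circuit \<open>C\<close> among them has smaller
  rank than \<open>M\<close> and fails to span some \<open>d\<close>. Contracting all but two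
  elements of \<open>C\<close> makes these two parallel, and a loop of \<open>M\<close> supplies
  \<open>a\<close>.\<close>

lemma loop_no_obstruction:
  assumes "\<not> loopless M" "\<not> obstruction M"
  shows "\<exists>N\<^sub>1 N\<^sub>2. is_direct_sum M N\<^sub>1 N\<^sub>2 \<and> uniform_matroid N\<^sub>1 \<and> rank0_matroid N\<^sub>2"
proof -
  define L where "L = {e \<in> ground M. {e} \<notin> indep M}"
  define E where "E = ground M - L"
  obtain a where a: "a \<in> ground M" "{a} \<notin> indep M" using assms unfolding loopless_def by blast
  have fin: "finite E" "finite L" "E \<inter> L = {}" using finite_ground by (auto simp: E_def L_def)
  have nl: "X \<inter> L = {}" if "X \<in> indep M" for X
    using that indep_hereditary[OF that, of "{_}"] by (auto simp: L_def)
  have ind: "X \<in> indep M" if X: "X \<subseteq> E" "card X \<le> rk M (ground M)" for X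
  proof (rule ccontr)
    assume "X \<notin> indep M"
    then obtain C where C: "circuit M C" "C \<subseteq> X"
      using dep_imp_circuit[of X] X by (auto simp: E_def)
    have finC: "finite C" using circuit_finite C by blast
    have Cg: "C \<subseteq> ground M" using C by (simp add: circuit_def)
    have "card C \<le> card X" using C X fin finite_subset by (intro card_mono) auto
    then have rkC: "rk M C < rk M (ground M)" using circuit_rk[OF C(1)] X by simp
    have "\<exists>d\<in>ground M. rk M (insert d C) \<noteq> rk M C"
    proof (rule ccontr)
      assume "\<not> ?thesis"
      then have "rk M (C \<union> ground M) = rk M C" by (intro rk_absorb) auto
      then show False using rkC Cg by (simp add: Un_absorb1)
    qed
    then obtain d where d: "d \<in> ground M" "rk M (insert d C) \<noteq> rk M C" by blast
    obtain b where b: "b \<in> C" using circuit_nonempty C by blast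
    have "C \<noteq> {b}" using C(1,2) X(1) b by (auto simp: circuit_def E_def L_def)
    then obtain c where c: "c \<in> C" "c \<noteq> b" using b by blast
    define I where "I = C - {b, c}"
    have bI: "insert b I = C - {c}" "insert c I = C - {b}" "insert b (insert c I) = C"
      using b c by (auto simp: I_def)
    have step: "insert d (C - {x}) \<in> indep M" if "x \<in> C" for x
      using d rk_insert_eq_mono[of d "C - {x}" C]
      by (intro indep_insertI circuit_remove_indep[OF C(1) that]) auto
    have "insert b (insert d I) \<in> indep M" "insert c (insert d I) \<in> indep M"
      using step[OF c(1)] step[OF b] unfolding bI(1,2)[symmetric] by (simp_all add: insert_commute)
    moreover have "insert a I \<notin> indep M" using a indep_hereditary[of "insert a I" "{a}"] by blast
    moreover have "insert b (insert c I) \<notin> indep M" using C bI by (simp add: circuit_def)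
    moreover have "d \<notin> I" using d by (auto simp: I_def insert_absorb)
    ultimately have "obstruction M" unfolding obstruction_def using a(1) by blast
    then show False using assms by blast
  qed
  have "X \<in> indep M \<longleftrightarrow> X \<in> indep (direct_sum (unif (rk M (ground M)) E) (unif 0 L))" for X
  proof
    assume X: "X \<in> indep M"
    then have Xg: "X \<subseteq> ground M" "X \<inter> L = {}" using indep_ground nl by auto
    then have "X \<subseteq> E" by (auto simp: E_def)
    then have "X \<inter> E = X" by auto
    then show "X \<in> indep (direct_sum (unif (rk M (ground M)) E) (unif 0 L))"
      unfolding direct_sum_unif_iff[OF fin] using card_le_rk[OF X Xg(1)] Xg \<open>X \<subseteq> E\<close> by auto
  next
    assume "X \<in> indep (direct_sum (unif (rk M (ground M)) E) (unif 0 L))"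
    then have X: "X \<subseteq> E \<union> L" "card (X \<inter> E) \<le> rk M (ground M)" "card (X \<inter> L) \<le> 0"
      unfolding direct_sum_unif_iff[OF fin] by auto
    then have "X \<inter> L = {}" using fin by simp
    then have "X \<subseteq> E" "X \<inter> E = X" using X by auto
    then show "X \<in> indep M" using ind X by simp
  qed
  moreover have "ground M = E \<union> L" by (auto simp: E_def L_def)
  ultimately have "M = direct_sum (unif (rk M (ground M)) E) (unif 0 L)"
    by (intro indep_system.equality) (auto simp: ground_direct_sum_unif)
  moreover have "rk M (ground M) \<le> card E"
  proof -
    obtain B where B: "B \<in> indep M" "B \<subseteq> ground M" "card B = rk M (ground M)" by (rule rk_basis)
    then have "B \<subseteq> E" using nl by (auto simp: E_def)
    then show ?thesis using B fin card_mono by metis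
  qed
  ultimately show ?thesis
    using fin unfolding is_direct_sum_def uniform_matroid_def rank0_matroid_def
    by (intro exI[of _ "unif (rk M (ground M)) E"] exI[of _ "unif 0 L"]) (auto simp: unif_def)
qed

text \<open>The coloops \<open>K\<close> split off as a free summand. If the rest \<open>E\<close>
  is not uniform, it has a circuit of rank below \<open>rk M E\<close>, and
  \<open>obstructionI\<close> applies with \<open>E\<close> as the larger set and a coloop as the
  outside element.\<close>

lemma coloop_no_obstruction:
  assumes "\<not> coloopless M" "\<not> obstruction M"
  shows "\<exists>N\<^sub>1 N\<^sub>2. is_direct_sum M N\<^sub>1 N\<^sub>2 \<and> uniform_matroid N\<^sub>1 \<and> free_matroid N\<^sub>2"
proof -
  define K where "K = {e \<in> ground M. \<forall>B. base M B \<longrightarrow> e \<in> B}"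
  define E where "E = ground M - K"
  obtain d where d: "d \<in> K" using assms unfolding coloopless_def K_def by blast
  have fin: "finite E" "finite K" "E \<inter> K = {}" using finite_ground by (auto simp: E_def K_def)
  have gEK: "ground M = E \<union> K" by (auto simp: E_def K_def)
  have addK: "X \<union> K \<in> indep M" if X: "X \<in> indep M" for X
  proof -
    obtain B where B: "B \<in> indep M" "X \<subseteq> B" "card B = rk M (ground M)"
      using rk_extend[OF X indep_ground[OF X]] by metis
    then have "base M B" by (simp add: base_iff)
    then have "X \<union> K \<subseteq> B" using B by (auto simp: K_def)
    then show ?thesis using B(1) indep_hereditary by blast
  qed
  have rkK: "rk M (X \<union> K) = rk M X + card K" if X: "X \<subseteq> E" for X
  proof -
    obtain I where I: "I \<in> indep M" "I \<subseteq> X" "card I = rk M X" by (rule rk_basis)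
    have "card (I \<union> K) \<le> rk M (X \<union> K)" using addK[OF I(1)] I by (intro card_le_rk) auto
    moreover have "card (I \<union> K) = card I + card K"
      using I X fin by (intro card_Un_disjoint) (auto intro: finite_subset)
    ultimately show ?thesis using I rk_union_le_card[of K X] fin by simp
  qed
  have rkE: "rk M (ground M) = rk M E + card K" using rkK[of E] gEK by simp
  \<comment> \<open>A base missing \<open>e\<close> still contains all coloops; its part outside
    \<open>K\<close> is a basis of \<open>E\<close> that misses \<open>e\<close>.\<close>
  have noco: "rk M (E - {e}) = rk M E" if "e \<in> E" for e
  proof -
    obtain B where B: "base M B" "e \<notin> B" using \<open>e \<in> E\<close> by (auto simp: E_def K_def)
    then have Bi: "B \<in> indep M" "card B = rk M (ground M)" by (auto simp: base_iff)
    have "K \<subseteq> B" using B by (auto simp: K_def)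
    moreover have "B - K \<subseteq> E - {e}" using Bi(1) indep_ground[of B] B(2) by (auto simp: E_def)
    moreover have "B - K \<in> indep M" using Bi(1) indep_hereditary by blast
    ultimately have "card (B - K) \<le> rk M (E - {e})" using card_le_rk by blast
    moreover have "card (B - K) = card B - card K" using \<open>K \<subseteq> B\<close> fin by (intro card_Diff_subset)
    ultimately show ?thesis using Bi rkE rk_mono[of "E - {e}" E] by simp
  qed
  have ind: "X \<in> indep M" if X: "X \<subseteq> E" "card X \<le> rk M E" for X
  proof (rule ccontr)
    assume "X \<notin> indep M"
    then obtain C where C: "circuit M C" "C \<subseteq> X"
      using dep_imp_circuit[of X] X by (auto simp: E_def)
    have "card C \<le> card X" using C X fin finite_subset by (intro card_mono) auto
    then have "rk M C < rk M E" using circuit_rk[OF C(1)] X by simp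
    moreover have "rk M (insert d E) \<noteq> rk M E"
    proof
      assume "rk M (insert d E) = rk M E"
      then have "rk M (insert d (E \<union> (K - {d}))) = rk M (E \<union> (K - {d}))"
        by (rule rk_insert_eq_mono) blast
      moreover have "insert d (E \<union> (K - {d})) = E \<union> K" using d by blast
      moreover have "rk M (E \<union> (K - {d})) \<le> rk M E + card (K - {d})"
        using fin by (intro rk_union_le_card) auto
      ultimately show False
        using rkK[of E] d fin card_Diff1_less[OF fin(2) d] by simp
    qed
    moreover have "C \<notin> indep M" using C by (simp add: circuit_def)
    ultimately have "obstruction M"
      using obstructionI[of C E d] C X noco d by (auto simp: E_def K_def)
    then show False using assms by blast
  qed
  have "X \<in> indep M \<longleftrightarrow> X \<in> indep (direct_sum (unif (rk M E) E) (unif (card K) K))" for X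
  proof
    assume X: "X \<in> indep M"
    then have "X \<inter> E \<in> indep M" using indep_hereditary by blast
    then show "X \<in> indep (direct_sum (unif (rk M E) E) (unif (card K) K))"
      unfolding direct_sum_unif_iff[OF fin]
      using card_le_rk[of "X \<inter> E" E] indep_ground[OF X] gEK fin by (auto intro: card_mono)
  next
    assume "X \<in> indep (direct_sum (unif (rk M E) E) (unif (card K) K))"
    then have X: "X \<subseteq> E \<union> K" "card (X \<inter> E) \<le> rk M E"
      unfolding direct_sum_unif_iff[OF fin] by auto
    then have "X \<inter> E \<union> K \<in> indep M" using ind addK by auto
    then show "X \<in> indep M" by (rule indep_hereditary) (use X in auto)
  qed
  then have "M = direct_sum (unif (rk M E) E) (unif (card K) K)"
    using gEK by (intro indep_system.equality) (auto simp: ground_direct_sum_unif)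
  then show ?thesis
    using fin rk_le_card[OF fin(1)] unfolding is_direct_sum_def uniform_matroid_def free_matroid_def
    by (intro exI[of _ "unif (rk M E) E"] exI[of _ "unif (card K) K"]) (auto simp: unif_def)
qed

text \<open>The closure of a circuit in \<open>F \<inter> G\<close> would be a proper cyclic flat
  below both, so \<open>F \<inter> G\<close> is independent; if \<open>F \<union> G\<close> did not
  span \<open>M\<close>, its closure would be one above both. Submodularity then becomes the
  inequality.\<close>

lemma clutter_proper_cyclic_flats_inter:
  assumes ll: "loopless M" and clut: "clutter {F. proper_cyclic_flat M F}"
    and F: "proper_cyclic_flat M F" and G: "proper_cyclic_flat M G" and neq: "F \<noteq> G"
  shows "card (F \<inter> G) + rk M (ground M) \<le> rk M F + rk M G"
proof -
  have fF: "flat M F" "cyclic_set M F" "F \<noteq> ground M" "rk M F \<noteq> 0" "F \<subseteq> ground M"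
    and fG: "flat M G" "cyclic_set M G" "G \<noteq> ground M" "G \<subseteq> ground M"
    using F G flat_ground by (auto simp: proper_cyclic_flat_def proper_flat_def)
  have eq: "A = B" if "proper_cyclic_flat M A" "proper_cyclic_flat M B" "A \<subseteq> B" for A B
    using that clut by (auto simp: clutter_def)
  have ind: "F \<inter> G \<in> indep M"
  proof (rule ccontr)
    assume "F \<inter> G \<notin> indep M"
    then obtain C where C: "circuit M C" "C \<subseteq> F \<inter> G" using dep_imp_circuit[of "F \<inter> G"] fF by auto
    have Cg: "C \<subseteq> ground M" using C fF by blast
    have sub: "cl C \<subseteq> F" "cl C \<subseteq> G" using C cl_mono_flat fF fG by auto
    have "proper_cyclic_flat M (cl C)"
      unfolding proper_cyclic_flat_def proper_flat_def
      using flat_cl[OF Cg] cyclic_cl[OF circuit_cyclic[OF C(1)]] sub fF rk_cl[OF Cg]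
        loopless_rk_pos[OF ll Cg circuit_nonempty[OF C(1)]] by auto
    then show False using eq F G sub neq by metis
  qed
  have "rk M (F \<union> G) = rk M (ground M)"
  proof (rule ccontr)
    assume ne: "rk M (F \<union> G) \<noteq> rk M (ground M)"
    have sub: "F \<union> G \<subseteq> ground M" using fF fG by auto
    obtain \<C> \<D> where "\<forall>C\<in>\<C>. circuit M C" "F = \<Union>\<C>" "\<forall>C\<in>\<D>. circuit M C" "G = \<Union>\<D>"
      using fF fG unfolding cyclic_set_def by auto
    then have "cyclic_set M (F \<union> G)"
      unfolding cyclic_set_def by (intro exI[of _ "\<C> \<union> \<D>"]) auto
    moreover have "rk M (F \<union> G) \<noteq> 0" using rk_mono[of F "F \<union> G"] fF by auto
    ultimately have "proper_cyclic_flat M (cl (F \<union> G))"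
      unfolding proper_cyclic_flat_def proper_flat_def
      using flat_cl[OF sub] cyclic_cl rk_cl[OF sub] ne by auto
    then show False using eq F G neq subset_cl[OF sub] by (metis Un_subset_iff)
  qed
  then show ?thesis using rk_submod[of F G] rk_indep[OF ind] by simp
qed

text \<open>Each proper cyclic flat is a hyperedge bounded by its rank. A dependent set that is not
  too large contains a short circuit and has too many elements in the closure of that
  circuit.\<close>

lemma clutter_elementary_split:
  assumes ll: "loopless M" and clut: "clutter {F. proper_cyclic_flat M F}"
  shows "elementary_split M"
proof -
  let ?P = "{F. proper_cyclic_flat M F}"
  have sub: "?P \<subseteq> Pow (ground M)"
    using flat_ground by (auto simp: proper_cyclic_flat_def proper_flat_def)
  then have "finite ?P" using finite_ground by (meson finite_Pow_iff finite_subset)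
  then obtain H where H: "bij_betw H {1..card ?P} ?P" using ex_bij_betw_nat_finite_1 by blast
  then have HP: "H ` {1..card ?P} = ?P" and Hinj: "inj_on H {1..card ?P}" by (auto simp: bij_betw_def)
  have pcf: "proper_cyclic_flat M (H i)" if "i \<in> {1..card ?P}" for i using HP that by blast
  have all: "(\<forall>i\<in>{1..card ?P}. Q (H i)) \<longleftrightarrow> (\<forall>F. proper_cyclic_flat M F \<longrightarrow> Q F)" for Q
  proof -
    have "(\<forall>i\<in>{1..card ?P}. Q (H i)) \<longleftrightarrow> (\<forall>F\<in>H ` {1..card ?P}. Q F)" by blast
    then show ?thesis unfolding HP by simp
  qed
  show ?thesis
    unfolding elementary_split_def
  proof (rule exI[of _ "rk M (ground M)"], rule exI[of _ "card ?P"],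
      rule exI[of _ "\<lambda>i. rk M (H i)"], rule exI[of _ H], intro conjI allI impI)
    show "rk M (ground M) \<le> card (ground M)" by (rule rk_le_card[OF finite_ground])
    show "\<forall>i\<in>{1..card ?P}. H i \<subseteq> ground M" using pcf sub by blast
    fix i j assume ij: "1 \<le> i \<and> i < j \<and> j \<le> card ?P"
    then have "H i \<noteq> H j" using inj_onD[OF Hinj, of i j] by auto
    then have "card (H i \<inter> H j) + rk M (ground M) \<le> rk M (H i) + rk M (H j)"
      using ij pcf by (intro clutter_proper_cyclic_flats_inter[OF ll clut]) auto
    then show "int (card (H i \<inter> H j)) \<le> int (rk M (H i)) + int (rk M (H j)) - int (rk M (ground M))"
      by simp
  next
    have "X \<in> indep M \<longleftrightarrow> X \<subseteq> ground M \<and> card X \<le> rk M (ground M) \<and>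
      (\<forall>F. proper_cyclic_flat M F \<longrightarrow> card (X \<inter> F) \<le> rk M F)" for X
    proof
      assume X: "X \<in> indep M"
      have "card (X \<inter> F) \<le> rk M F" for F
        using indep_hereditary[OF X, of "X \<inter> F"] by (intro card_le_rk) auto
      then show "X \<subseteq> ground M \<and> card X \<le> rk M (ground M) \<and>
        (\<forall>F. proper_cyclic_flat M F \<longrightarrow> card (X \<inter> F) \<le> rk M F)"
        using indep_ground[OF X] card_le_rk[OF X] by auto
    next
      assume X: "X \<subseteq> ground M \<and> card X \<le> rk M (ground M) \<and>
        (\<forall>F. proper_cyclic_flat M F \<longrightarrow> card (X \<inter> F) \<le> rk M F)"
      show "X \<in> indep M"
      proof (rule ccontr)
        assume "X \<notin> indep M"
        then obtain C where C: "circuit M C" "C \<subseteq> X" using dep_imp_circuit X by blast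
        have finX: "finite X" using X finite_ground finite_subset by blast
        have Cg: "C \<subseteq> ground M" using C X by blast
        have "card C \<le> card X" using C finX by (intro card_mono)
        then have "proper_cyclic_flat M (cl C)"
          using X by (intro proper_cyclic_flat_cl_circuit[OF ll C(1)]) auto
        then have "card (X \<inter> cl C) \<le> rk M C" using X rk_cl[OF Cg] by metis
        moreover have "card C \<le> card (X \<inter> cl C)"
          using C subset_cl[OF Cg] finX by (intro card_mono) auto
        ultimately show False using circuit_rk[OF C(1)] by simp
      qed
    qed
    then show "indep M = {X. X \<subseteq> ground M \<and> card X \<le> rk M (ground M) \<and>
        (\<forall>i\<in>{1..card ?P}. card (X \<inter> H i) \<le> rk M (H i))}"
      using all[of "\<lambda>F. card (_ \<inter> F) \<le> rk M F"] by (intro set_eqI) (simp only: mem_Collect_eq)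
  qed
qed

text \<open>Without loops and coloops, each side of a nontrivial separator is a proper cyclic flat.
  A circuit inside a side, of size at most the rank of that side, would have a proper cyclic flat
  strictly inside it as closure; hence both sides are uniform.\<close>

lemma clutter_disconnected_uniform_sum:
  assumes ll: "loopless M" and cl: "coloopless M" and clut: "clutter {F. proper_cyclic_flat M F}"
    and nc: "\<not> connected_matroid M"
  shows "\<exists>N\<^sub>1 N\<^sub>2. is_direct_sum M N\<^sub>1 N\<^sub>2 \<and> uniform_matroid N\<^sub>1 \<and> uniform_matroid N\<^sub>2"
proof -
  obtain X where X: "sep {} (ground M) X" "X \<noteq> {}" "X \<noteq> ground M"
    using nc unfolding connected_iff_conn conn_def by blast
  define Y where "Y = ground M - X"
  have Y: "sep {} (ground M) Y" using sep_compl[OF X(1)] by (simp add: Y_def)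
  have XY: "X \<union> Y = ground M" "X \<inter> Y = {}" "Y \<noteq> {}" "Y \<noteq> ground M"
    using X by (auto simp: Y_def sep_def)
  have small: "C \<notin> Pow Z \<or> card C > rk M Z"
    if Z: "sep {} (ground M) Z" "Z \<noteq> {}" "Z \<noteq> ground M" and C: "circuit M C" for Z C
  proof (rule ccontr)
    assume "\<not> ?thesis"
    then have CZ: "C \<subseteq> Z" "card C \<le> rk M Z" by auto
    have Zg: "Z \<subseteq> ground M" using Z by (simp add: sep_def)
    have Cg: "C \<subseteq> ground M" using C by (simp add: circuit_def)
    have "flat M Z"
      unfolding flat_def
    proof (intro conjI ballI Zg)
      fix e assume e: "e \<in> ground M - Z"
      show "rk M Z < rk M (insert e Z)"
      proof (rule ccontr)
        assume "\<not> ?thesis"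
        then have "rk M (insert e Z) = rk M Z" using rk_le_insert[of Z e] by simp
        then obtain D where D: "circuit M D" "e \<in> D" "D \<subseteq> insert e Z"
          by (rule span_imp_circuit[rotated 3]) (use e Zg in auto)
        then have "D \<inter> Z = {}" using sep_circuit[OF Z(1) D(1)] e by blast
        then have "D = {e}" using D by blast
        then show False using D(1) ll e by (auto simp: circuit_def loopless_def)
      qed
    qed
    moreover have "cyclic_set M Z"
      unfolding cyclic_iff
    proof (intro conjI ballI Zg)
      fix e assume e: "e \<in> Z"
      then have "rk M (insert e (ground M - {e})) = rk M (ground M - {e})"
        using cl Zg by (simp add: coloopless_iff insert_absorb subset_iff)
      then obtain D where D: "circuit M D" "e \<in> D" "D \<subseteq> insert e (ground M - {e})"
        by (rule span_imp_circuit[rotated 3]) (use e Zg in auto)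
      then have "D \<subseteq> Z" using sep_circuit[OF Z(1) D(1)] e by blast
      then have "rk M (insert e (Z - {e})) = rk M (Z - {e})"
        using D by (intro circuit_span[of D]) auto
      then show "rk M (Z - {e}) = rk M Z" using e by (simp add: insert_absorb)
    qed
    ultimately have pZ: "proper_cyclic_flat M Z"
      using Z loopless_rk_pos[OF ll Zg Z(2)] by (simp add: proper_cyclic_flat_def proper_flat_def)
    have "card C \<le> rk M (ground M)" using CZ rk_mono[OF Zg] by simp
    then have "proper_cyclic_flat M (cl C)" by (rule proper_cyclic_flat_cl_circuit[OF ll C])
    moreover have "cl C \<subseteq> Z" using cl_mono_flat CZ \<open>flat M Z\<close> by blast
    moreover have "cl C \<noteq> Z" using rk_cl[OF Cg] circuit_rk[OF C] CZ by auto
    ultimately show False using clut pZ unfolding clutter_def by blast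
  qed
  have fin: "finite X" "finite Y" using XY finite_ground by (metis finite_Un)+
  have "Z \<in> indep M \<longleftrightarrow> Z \<in> indep (direct_sum (unif (rk M X) X) (unif (rk M Y) Y))" for Z
  proof
    assume Z: "Z \<in> indep M"
    then have "Z \<inter> X \<in> indep M" "Z \<inter> Y \<in> indep M" using indep_hereditary by blast+
    then have "card (Z \<inter> X) \<le> rk M X" "card (Z \<inter> Y) \<le> rk M Y" using card_le_rk by auto
    then show "Z \<in> indep (direct_sum (unif (rk M X) X) (unif (rk M Y) Y))"
      unfolding direct_sum_unif_iff[OF fin XY(2)] using indep_ground[OF Z] XY by simp
  next
    assume "Z \<in> indep (direct_sum (unif (rk M X) X) (unif (rk M Y) Y))"
    then have Z: "Z \<subseteq> X \<union> Y" "card (Z \<inter> X) \<le> rk M X" "card (Z \<inter> Y) \<le> rk M Y"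
      unfolding direct_sum_unif_iff[OF fin XY(2)] by auto
    show "Z \<in> indep M"
    proof (rule ccontr)
      assume "Z \<notin> indep M"
      then obtain C where C: "circuit M C" "C \<subseteq> Z" using dep_imp_circuit[of Z] Z XY by auto
      have fZ: "finite Z" using Z fin finite_subset by blast
      from sep_circuit[OF X(1) C(1)] show False
      proof
        assume CX: "C \<subseteq> X"
        then have "card C \<le> card (Z \<inter> X)" using C fZ by (intro card_mono) auto
        then show False using small[OF X C(1)] CX Z by auto
      next
        assume "C \<inter> X = {}"
        then have CY: "C \<subseteq> Y" using C Z XY by blast
        then have "card C \<le> card (Z \<inter> Y)" using C fZ by (intro card_mono) auto
        then show False using small[OF Y XY(3,4) C(1)] CY Z by auto
      qed
    qed
  qed
  then have "M = direct_sum (unif (rk M X) X) (unif (rk M Y) Y)"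
    using XY by (intro indep_system.equality) (auto simp: ground_direct_sum_unif)
  then show ?thesis
    using fin XY rk_le_card[OF fin(1)] rk_le_card[OF fin(2)] unfolding is_direct_sum_def uniform_matroid_def
    by (intro exI[of _ "unif (rk M X) X"] exI[of _ "unif (rk M Y) Y"]) (auto simp: unif_def)
qed

end

section \<open>Incompatible flats\<close>

text \<open>Each value is spread evenly over its block; the strict bounds keep the quotients
  strictly between 0 and 1.\<close>

lemma three_blocks_point:
  fixes A B C :: "'a set" and p q s :: nat
  assumes disj: "A \<inter> B = {}" "A \<inter> C = {}" "B \<inter> C = {}"
    and bd: "0 < p" "p < card A" "0 < q" "q < card B" "0 < s" "s < card C"
  obtains x :: "'a \<Rightarrow> real" where "\<And>i. i \<in> A \<union> B \<union> C \<Longrightarrow> 0 < x i \<and> x i < 1"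
    "sum x A = p" "sum x B = q" "sum x C = s"
proof -
  define x where "x i = (if i \<in> A then p / card A else if i \<in> B then q / card B else s / card C)" for i
  have "sum x A = sum (\<lambda>_. real p / card A) A" by (rule sum.cong) (auto simp: x_def)
  moreover have "sum x B = sum (\<lambda>_. real q / card B) B"
    by (rule sum.cong) (use disj in \<open>auto simp: x_def\<close>)
  moreover have "sum x C = sum (\<lambda>_. real s / card C) C"
    by (rule sum.cong) (use disj in \<open>auto simp: x_def\<close>)
  ultimately have "sum x A = p" "sum x B = q" "sum x C = s" using bd by auto
  moreover have "0 < x i \<and> x i < 1" for i using bd by (auto simp: x_def)
  ultimately show thesis using that by blast
qed

context matroid
begin

text \<open>The description of the split flacets of a connected matroid; \<open>rk M F < card F\<close> excludes
  singletons.\<close>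

definition split_flat :: "'a set \<Rightarrow> bool" where
  "split_flat F \<longleftrightarrow> flat M F \<and> F \<noteq> {} \<and> F \<noteq> ground M \<and> conn {} F \<and> conn F (ground M) \<and>
     rk M F < card F"

text \<open>The hyperplanes of \<open>F\<close> and \<open>G\<close> meet in the relative interior of the hypersimplex.\<close>

definition crossing :: "'a set \<Rightarrow> 'a set \<Rightarrow> bool" where
  "crossing F G \<longleftrightarrow> (\<exists>x::'a \<Rightarrow> real. (\<forall>i\<in>ground M. 0 < x i \<and> x i < 1) \<and>
     sum x (ground M) = rk M (ground M) \<and> sum x F = rk M F \<and> sum x G = rk M G)"

text \<open>The dual of \<open>sep_restrict\<close>, with \<open>W\<close> contracted instead of
  restricted to; it follows from that lemma by submodularity.\<close>

lemma sep_dual_restrict: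
  assumes "sep A T X" "A \<subseteq> W" "W \<subseteq> T"
  shows "sep W T (W \<union> X)"
proof (rule sepI)
  have X: "A \<subseteq> X" "X \<subseteq> T" "rk M X + rk M (A \<union> (T - X)) = rk M T + rk M A"
    using assms by (auto simp: sep_def)
  show "W \<subseteq> W \<union> X" "W \<union> X \<subseteq> T" using assms X by auto
  have "rk M W + rk M A = rk M (W \<inter> X) + rk M (A \<union> (W - X))" by (rule sep_restrict[OF assms])
  moreover have "rk M (W \<union> X) + rk M (W \<inter> X) \<le> rk M W + rk M X" by (rule rk_submod)
  moreover have "rk M (W \<union> (A \<union> (T - X))) + rk M (W \<inter> (A \<union> (T - X))) \<le> rk M W + rk M (A \<union> (T - X))"
    by (rule rk_submod)
  moreover have "W \<inter> (A \<union> (T - X)) = A \<union> (W - X)" using X assms by auto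
  moreover have "W \<union> (A \<union> (T - X)) = W \<union> (T - (W \<union> X))" using X assms by auto
  ultimately show "rk M (W \<union> X) + rk M (W \<union> (T - (W \<union> X))) \<le> rk M T + rk M W" using X by simp
qed

lemma sep_lower_trans:
  assumes "sep A T X" "sep A X Y" shows "sep A T Y"
proof (rule sepI)
  have X: "A \<subseteq> X" "X \<subseteq> T" "rk M X + rk M (A \<union> (T - X)) = rk M T + rk M A"
    and Y: "A \<subseteq> Y" "Y \<subseteq> X" "rk M Y + rk M (A \<union> (X - Y)) = rk M X + rk M A"
    using assms by (auto simp: sep_def)
  show "A \<subseteq> Y" "Y \<subseteq> T" using X Y by auto
  have "(A \<union> (T - X)) \<union> (A \<union> (X - Y)) = A \<union> (T - Y)" "(A \<union> (T - X)) \<inter> (A \<union> (X - Y)) = A"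
    using X Y by auto
  then show "rk M Y + rk M (A \<union> (T - Y)) \<le> rk M T + rk M A"
    using rk_submod[of "A \<union> (T - X)" "A \<union> (X - Y)"] X Y by simp
qed

lemma sep_upper_trans:
  assumes "sep A T X" "sep X T Z" shows "sep A T Z"
proof (rule sepI)
  have X: "A \<subseteq> X" "X \<subseteq> T" "rk M X + rk M (A \<union> (T - X)) = rk M T + rk M A"
    and Z: "X \<subseteq> Z" "Z \<subseteq> T" "rk M Z + rk M (X \<union> (T - Z)) = rk M T + rk M X"
    using assms by (auto simp: sep_def)
  show "A \<subseteq> Z" "Z \<subseteq> T" using X Z by auto
  have "(X \<union> (T - Z)) \<union> (A \<union> (T - X)) = T" "(X \<union> (T - Z)) \<inter> (A \<union> (T - X)) = A \<union> (T - Z)"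
    using X Z by auto
  then show "rk M Z + rk M (A \<union> (T - Z)) \<le> rk M T + rk M A"
    using rk_submod[of "X \<union> (T - Z)" "A \<union> (T - X)"] X Z by simp
qed

text \<open>Descending through separators of separators ends at a connected component
  \<open>Y - A\<close> of the minor on \<open>T - A\<close>.\<close>

lemma minimal_sep:
  assumes "sep A T X" "X \<noteq> A" "finite T"
  obtains Y where "sep A T Y" "Y \<subseteq> X" "Y \<noteq> A" "conn A Y"
proof -
  have "finite X" using assms by (auto simp: sep_def intro: finite_subset)
  then have "\<exists>Y. sep A T Y \<and> Y \<subseteq> X \<and> Y \<noteq> A \<and> conn A Y" using assms(1,2)
  proof (induction X rule: finite_psubset_induct)
    case (psubset X)
    show ?case
    proof (cases "conn A X")
      case False
      then obtain Y where Y: "sep A X Y" "Y \<noteq> A" "Y \<noteq> X" by (auto simp: conn_def)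
      then have "Y \<subset> X" by (auto simp: sep_def)
      moreover have "sep A T Y" using sep_lower_trans psubset.prems(1) Y(1) by blast
      ultimately obtain Z where "sep A T Z \<and> Z \<subseteq> Y \<and> Z \<noteq> A \<and> conn A Z"
        using psubset.IH Y(2) by blast
      then show ?thesis using \<open>Y \<subset> X\<close> by (intro exI[of _ Z]) auto
    qed (use psubset.prems in auto)
  qed
  then show thesis using that by blast
qed

text \<open>The dual ascent: \<open>T - Y\<close> becomes a component, so that contracting
  \<open>Y\<close> leaves a connected matroid.\<close>

lemma maximal_sep:
  assumes "sep A T X" "X \<noteq> T" "finite T"
  obtains Y where "sep A T Y" "X \<subseteq> Y" "Y \<noteq> T" "conn Y T"
proof -
  have "\<exists>Y. sep A T Y \<and> X \<subseteq> Y \<and> Y \<noteq> T \<and> conn Y T" using assms(1,2)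
  proof (induction "card (T - X)" arbitrary: X rule: less_induct)
    case less
    show ?case
    proof (cases "conn X T")
      case False
      then obtain Y where Y: "sep X T Y" "Y \<noteq> X" "Y \<noteq> T" by (auto simp: conn_def)
      then have sub: "X \<subset> Y" "Y \<subseteq> T" by (auto simp: sep_def)
      moreover have "sep A T Y" using sep_upper_trans less.prems(1) Y(1) by blast
      moreover have "card (T - Y) < card (T - X)"
        using sub assms(3) by (intro psubset_card_mono) auto
      ultimately obtain Z where "sep A T Z \<and> Y \<subseteq> Z \<and> Z \<noteq> T \<and> conn Z T"
        using less.hyps Y(3) by blast
      then show ?thesis using sub by (intro exI[of _ Z]) auto
    qed (use less.prems in auto)
  qed
  then show thesis using that by blast
qed

text \<open>Since \<open>X\<close> is a separator over \<open>F\<close>, an element outside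
  \<open>X\<close> adds the same rank to \<open>X\<close> as to \<open>F\<close>.\<close>

lemma sep_flat_upper:
  assumes "sep F (ground M) X" "flat M F" shows "flat M X"
  unfolding flat_def
proof (intro conjI ballI)
  show Xg: "X \<subseteq> ground M" using assms by (simp add: sep_def)
  fix e assume e: "e \<in> ground M - X"
  have FX: "F \<subseteq> X" using assms by (simp add: sep_def)
  have "rk M (insert e X) + rk M F = rk M (insert e X \<inter> X) + rk M (F \<union> (insert e X - X))"
    by (rule sep_restrict[OF assms(1)]) (use e FX Xg in auto)
  moreover have "insert e X \<inter> X = X" "F \<union> (insert e X - X) = insert e F" using e by auto
  moreover have "rk M F < rk M (insert e F)" using e FX assms(2) by (intro flat_notinD[of F]) auto
  ultimately show "rk M X < rk M (insert e X)" by simp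
qed

lemma sep_flat_lower:
  assumes s: "sep {} G X" and "flat M G" "loopless M" shows "flat M X"
  unfolding flat_def
proof (intro conjI ballI)
  have XG: "X \<subseteq> G" using s by (simp add: sep_def)
  then show "X \<subseteq> ground M" using flat_ground[OF assms(2)] by blast
  fix e assume e: "e \<in> ground M - X"
  show "rk M X < rk M (insert e X)"
  proof (cases "e \<in> G")
    case True
    have "rk M (insert e X) + rk M {} = rk M (insert e X \<inter> X) + rk M ({} \<union> (insert e X - X))"
      by (rule sep_restrict[OF s]) (use True XG in auto)
    moreover have "insert e X \<inter> X = X" "insert e X - X = {e}" using e by auto
    ultimately show ?thesis using assms(3) e by (simp add: loopless_iff)
  next
    case False
    then show ?thesis using flat_notinD[OF assms(2) _ False XG] e by blast
  qed
qed

text \<open>Equality would make every element of \<open>T - A\<close> a coloop of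
  \<open>M|T\<close>. This supplies strict upper bounds for the blocks of an interior point.\<close>

lemma rk_diff_less:
  assumes "A \<subset> T" "T \<subseteq> ground M" "\<And>e. e \<in> T \<Longrightarrow> rk M (T - {e}) = rk M T"
  shows "rk M T < rk M A + card (T - A)"
proof (rule ccontr)
  have fin: "finite T" using assms(2) finite_ground finite_subset by blast
  assume "\<not> ?thesis"
  moreover have "rk M (A \<union> (T - A)) \<le> rk M A + card (T - A)"
    using fin by (intro rk_union_le_card) auto
  moreover have "A \<union> (T - A) = T" using assms(1) by blast
  ultimately have "rk M T = rk M A + card (T - A)" by simp
  moreover obtain e where "e \<in> T - A" using assms(1) by blast
  ultimately show False using coloop_of_rk_diff[of A T e] assms fin by auto
qed

text \<open>The last premise leaves open how \<open>F\<close> and \<open>G\<close> are composed of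
  the blocks, so that one rule serves nested, covering and disjoint pairs.\<close>

lemma crossingI:
  assumes "A \<union> B \<union> C = ground M" "A \<inter> B = {}" "A \<inter> C = {}" "B \<inter> C = {}"
    and "0 < p" "p < card A" "0 < q" "q < card B" "0 < s" "s < card C" "p + q + s = rk M (ground M)"
    and FG: "\<And>x. sum x A = real p \<Longrightarrow> sum x B = real q \<Longrightarrow> sum x C = real s \<Longrightarrow>
       sum x F = rk M F \<and> sum x G = rk M G"
  shows "crossing F G"
proof -
  obtain x :: "'a \<Rightarrow> real" where x: "\<And>i. i \<in> A \<union> B \<union> C \<Longrightarrow> 0 < x i \<and> x i < 1"
    "sum x A = p" "sum x B = q" "sum x C = s"
    using three_blocks_point[OF assms(2-10)] by metis
  have fin: "finite A" "finite B" "finite C" using assms(1) finite_ground by (metis finite_Un)+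
  have "sum x (A \<union> B \<union> C) = sum x (A \<union> B) + sum x C"
    using fin assms by (intro sum.union_disjoint) auto
  also have "sum x (A \<union> B) = sum x A + sum x B" using fin assms by (intro sum.union_disjoint) auto
  finally have "sum x (ground M) = rk M (ground M)" using x assms(1,11) by (simp flip: assms(11))
  then show ?thesis
    unfolding crossing_def using x(1) FG[OF x(2-4)] assms(1) by (intro exI[of _ x]) auto
qed

text \<open>The blocks \<open>F\<close>, \<open>G - F\<close> and the complement of \<open>G\<close>
  carry the successive rank increments. These are positive because the flats are nested and
  \<open>M\<close> is loopless; they stay below the block sizes because \<open>F\<close> is
  dependent and neither \<open>M|G\<close> nor \<open>M\<close> has coloops.\<close>

lemma nested_flats_crossing:
  assumes F: "split_flat F" and G: "split_flat G" and sub: "F \<subset> G"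
    and cyc: "\<And>e. e \<in> G \<Longrightarrow> rk M (G - {e}) = rk M G"
    and ll: "loopless M" and co: "coloopless M"
  shows "crossing F G"
proof (rule crossingI)
  have g: "F \<subseteq> ground M" "G \<subseteq> ground M" using F G flat_ground by (auto simp: split_flat_def)
  have fin: "finite F" "finite G" using g finite_ground finite_subset by auto
  have r1: "rk M F < rk M G" using F G sub g by (intro flat_rk_less) (auto simp: split_flat_def)
  have r2: "rk M G < rk M (ground M)" using G g by (intro flat_rk_less) (auto simp: split_flat_def)
  show "F \<union> (G - F) \<union> (ground M - G) = ground M" "F \<inter> (G - F) = {}" "F \<inter> (ground M - G) = {}"
    "(G - F) \<inter> (ground M - G) = {}" using sub g by auto
  show "0 < rk M F" using F g by (intro loopless_rk_pos[OF ll]) (auto simp: split_flat_def)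
  show "rk M F < card F" using F by (simp add: split_flat_def)
  show "0 < rk M G - rk M F" "0 < rk M (ground M) - rk M G" using r1 r2 by auto
  show "rk M G - rk M F < card (G - F)" using rk_diff_less[OF sub g(2) cyc] r1 by simp
  have "G \<subset> ground M" using r2 g by auto
  then show "rk M (ground M) - rk M G < card (ground M - G)"
    using rk_diff_less[of G "ground M"] co r2 by (simp add: coloopless_iff)
  show "rk M F + (rk M G - rk M F) + (rk M (ground M) - rk M G) = rk M (ground M)" using r1 r2 by simp
  fix x :: "'a \<Rightarrow> real"
  assume x: "sum x F = rk M F" "sum x (G - F) = real (rk M G - rk M F)"
  have "sum x G = sum x (G - F) + sum x F" using sub fin by (intro sum.subset_diff) auto
  then show "sum x F = rk M F \<and> sum x G = rk M G" using x r1 by simp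
qed

lemma upper_separators_crossing:
  assumes s1: "sep F (ground M) G\<^sub>1" and s2: "sep F (ground M) G\<^sub>2"
    and cov: "G\<^sub>1 \<union> G\<^sub>2 = ground M" and ne: "G\<^sub>1 \<noteq> ground M" "G\<^sub>2 \<noteq> ground M"
    and fl: "flat M F" and F: "F \<noteq> {}" "rk M F < card F"
    and ll: "loopless M" and co: "coloopless M"
  shows "crossing G\<^sub>1 G\<^sub>2"
proof (rule crossingI)
  let ?S = "ground M"
  have sub: "F \<subseteq> G\<^sub>1" "F \<subseteq> G\<^sub>2" "G\<^sub>1 \<subset> ?S" "G\<^sub>2 \<subset> ?S" using s1 s2 ne by (auto simp: sep_def)
  have fin: "finite G\<^sub>1" "finite G\<^sub>2" using sub(3,4) finite_ground finite_subset by (metis psubsetE)+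
  then have "finite F" using sub(1) finite_subset by blast
  note fin = fin this
  have coS: "rk M ?S < rk M A + card (?S - A)" if "A \<subset> ?S" for A
    using rk_diff_less[OF that] co by (simp add: coloopless_iff)
  have r1: "rk M G\<^sub>1 < rk M ?S" by (rule flat_rk_less[OF sep_flat_upper[OF s1 fl] sub(3)]) simp
  have r2: "rk M G\<^sub>2 < rk M ?S" by (rule flat_rk_less[OF sep_flat_upper[OF s2 fl] sub(4)]) simp
  \<comment> \<open>The separator makes \<open>G\<^sub>1\<close> and \<open>G\<^sub>2\<close> a
    modular pair. With the coranks on the two complements and the rank of the intersection on the
    third block, the values therefore add up to the rank of \<open>M\<close>.\<close>
  have eq: "rk M G\<^sub>1 + rk M G\<^sub>2 = rk M (G\<^sub>1 \<inter> G\<^sub>2) + rk M ?S"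
  proof -
    have "rk M G\<^sub>2 + rk M F = rk M (G\<^sub>2 \<inter> G\<^sub>1) + rk M (F \<union> (G\<^sub>2 - G\<^sub>1))"
      by (rule sep_restrict[OF s1]) (use sub in auto)
    moreover have "G\<^sub>2 - G\<^sub>1 = ?S - G\<^sub>1" using cov by blast
    moreover have "rk M G\<^sub>1 + rk M (F \<union> (?S - G\<^sub>1)) = rk M ?S + rk M F" using s1 by (simp add: sep_def)
    ultimately show ?thesis by (simp add: Int_commute)
  qed
  show "(?S - G\<^sub>1) \<union> (?S - G\<^sub>2) \<union> (G\<^sub>1 \<inter> G\<^sub>2) = ?S" "(?S - G\<^sub>1) \<inter> (?S - G\<^sub>2) = {}"
    "(?S - G\<^sub>1) \<inter> (G\<^sub>1 \<inter> G\<^sub>2) = {}" "(?S - G\<^sub>2) \<inter> (G\<^sub>1 \<inter> G\<^sub>2) = {}" using sub cov by auto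
  show "0 < rk M ?S - rk M G\<^sub>1" "0 < rk M ?S - rk M G\<^sub>2" using r1 r2 by auto
  show "rk M ?S - rk M G\<^sub>1 < card (?S - G\<^sub>1)" "rk M ?S - rk M G\<^sub>2 < card (?S - G\<^sub>2)"
    using coS[OF sub(3)] coS[OF sub(4)] r1 r2 by auto
  show "0 < rk M (G\<^sub>1 \<inter> G\<^sub>2)" using sub F by (intro loopless_rk_pos[OF ll]) auto
  \<comment> \<open>The third block is dependent because it contains \<open>F\<close>, which gives
    its strict bound.\<close>
  have FI: "F \<union> (G\<^sub>1 \<inter> G\<^sub>2 - F) = G\<^sub>1 \<inter> G\<^sub>2" using sub by auto
  have "rk M (F \<union> (G\<^sub>1 \<inter> G\<^sub>2 - F)) \<le> rk M F + card (G\<^sub>1 \<inter> G\<^sub>2 - F)"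
    using fin by (intro rk_union_le_card) auto
  also have "\<dots> < card F + card (G\<^sub>1 \<inter> G\<^sub>2 - F)" using F by simp
  also have "\<dots> = card (F \<union> (G\<^sub>1 \<inter> G\<^sub>2 - F))" using fin by (intro card_Un_disjoint[symmetric]) auto
  finally show "rk M (G\<^sub>1 \<inter> G\<^sub>2) < card (G\<^sub>1 \<inter> G\<^sub>2)" unfolding FI .
  show "(rk M ?S - rk M G\<^sub>1) + (rk M ?S - rk M G\<^sub>2) + rk M (G\<^sub>1 \<inter> G\<^sub>2) = rk M ?S" using eq r1 r2 by simp
  fix x :: "'a \<Rightarrow> real"
  assume x: "sum x (?S - G\<^sub>1) = real (rk M ?S - rk M G\<^sub>1)" "sum x (?S - G\<^sub>2) = real (rk M ?S - rk M G\<^sub>2)"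
    "sum x (G\<^sub>1 \<inter> G\<^sub>2) = real (rk M (G\<^sub>1 \<inter> G\<^sub>2))"
  have "sum x G\<^sub>1 = sum x (G\<^sub>1 - G\<^sub>1 \<inter> G\<^sub>2) + sum x (G\<^sub>1 \<inter> G\<^sub>2)"
    "sum x G\<^sub>2 = sum x (G\<^sub>2 - G\<^sub>1 \<inter> G\<^sub>2) + sum x (G\<^sub>1 \<inter> G\<^sub>2)"
    using fin by (auto intro!: sum.subset_diff)
  moreover have "G\<^sub>1 - G\<^sub>1 \<inter> G\<^sub>2 = ?S - G\<^sub>2" "G\<^sub>2 - G\<^sub>1 \<inter> G\<^sub>2 = ?S - G\<^sub>1" using cov by auto
  ultimately show "sum x G\<^sub>1 = rk M G\<^sub>1 \<and> sum x G\<^sub>2 = rk M G\<^sub>2" using x eq r1 r2 by simp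
qed

text \<open>Ranks of disjoint separators of \<open>M|G\<close> add up and stay below the rank of
  \<open>M\<close>. Neither separator is independent, since its elements would be coloops of
  \<open>M|G\<close>.\<close>

lemma lower_separators_crossing:
  assumes s1: "sep {} G B\<^sub>1" and s2: "sep {} G B\<^sub>2" and dis: "B\<^sub>1 \<inter> B\<^sub>2 = {}"
    and ne: "B\<^sub>1 \<noteq> {}" "B\<^sub>2 \<noteq> {}" and G: "G \<subset> ground M" "rk M G < rk M (ground M)"
    and cyc: "\<And>e. e \<in> G \<Longrightarrow> rk M (G - {e}) = rk M G"
    and ll: "loopless M" and co: "coloopless M"
  shows "crossing B\<^sub>1 B\<^sub>2"
proof (rule crossingI)
  let ?S = "ground M"
  have sub: "B\<^sub>1 \<subseteq> G" "B\<^sub>2 \<subseteq> G" using s1 s2 by (auto simp: sep_def)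
  then have subS: "B\<^sub>1 \<subseteq> ?S" "B\<^sub>2 \<subseteq> ?S" "B\<^sub>1 \<union> B\<^sub>2 \<subset> ?S" using G by auto
  have finS: "finite ?S" by (rule finite_ground)
  have fin: "finite B\<^sub>1" "finite B\<^sub>2" using subS finS finite_subset by auto
  have eq: "rk M (B\<^sub>1 \<union> B\<^sub>2) = rk M B\<^sub>1 + rk M B\<^sub>2"
  proof -
    have "rk M (B\<^sub>1 \<union> B\<^sub>2) + rk M {} = rk M ((B\<^sub>1 \<union> B\<^sub>2) \<inter> B\<^sub>1) + rk M ({} \<union> (B\<^sub>1 \<union> B\<^sub>2 - B\<^sub>1))"
      by (rule sep_restrict[OF s1]) (use sub in auto)
    moreover have "(B\<^sub>1 \<union> B\<^sub>2) \<inter> B\<^sub>1 = B\<^sub>1" "{} \<union> (B\<^sub>1 \<union> B\<^sub>2 - B\<^sub>1) = B\<^sub>2" using dis by auto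
    ultimately show ?thesis by simp
  qed
  have small: "rk M B < card B" if "sep {} G B" "B \<noteq> {}" for B
  proof -
    have B: "B \<subseteq> G" "rk M B + rk M (G - B) = rk M G" using that by (auto simp: sep_def)
    have "rk M G < rk M (G - B) + card (G - (G - B))"
      by (rule rk_diff_less) (use B that G cyc in auto)
    moreover have "G - (G - B) = B" using B by blast
    ultimately show ?thesis using B by simp
  qed
  have r: "rk M B\<^sub>1 + rk M B\<^sub>2 < rk M ?S" using rk_mono[of "B\<^sub>1 \<union> B\<^sub>2" G] sub G eq by simp
  show "B\<^sub>1 \<union> B\<^sub>2 \<union> (?S - (B\<^sub>1 \<union> B\<^sub>2)) = ?S" "B\<^sub>1 \<inter> (?S - (B\<^sub>1 \<union> B\<^sub>2)) = {}" "B\<^sub>2 \<inter> (?S - (B\<^sub>1 \<union> B\<^sub>2)) = {}"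
    using subS by auto
  show "B\<^sub>1 \<inter> B\<^sub>2 = {}" by (rule dis)
  show "0 < rk M B\<^sub>1" "0 < rk M B\<^sub>2" using loopless_rk_pos[OF ll] subS ne by auto
  show "rk M B\<^sub>1 < card B\<^sub>1" "rk M B\<^sub>2 < card B\<^sub>2" using small s1 s2 ne by auto
  show "0 < rk M ?S - (rk M B\<^sub>1 + rk M B\<^sub>2)" using r by simp
  have "rk M ?S < rk M (B\<^sub>1 \<union> B\<^sub>2) + card (?S - (B\<^sub>1 \<union> B\<^sub>2))"
    using rk_diff_less[OF subS(3)] co by (simp add: coloopless_iff)
  then show "rk M ?S - (rk M B\<^sub>1 + rk M B\<^sub>2) < card (?S - (B\<^sub>1 \<union> B\<^sub>2))" using eq r by simp
  show "rk M B\<^sub>1 + rk M B\<^sub>2 + (rk M ?S - (rk M B\<^sub>1 + rk M B\<^sub>2)) = rk M ?S" using r by simp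
qed simp

text \<open>The point is connectedness of \<open>M|G\<close>. The connected set \<open>F\<close>
  lies on one side of any separator of \<open>M|G\<close>; the side missing \<open>F\<close> would
  then separate \<open>M\<close> itself, because \<open>G\<close> is a separator over
  \<open>F\<close>.\<close>

lemma split_flat_upper_separator:
  assumes c: "conn {} (ground M)"
    and F: "flat M F" "F \<noteq> {}" "conn {} F" "rk M F < card F"
    and s: "sep F (ground M) G" "G \<noteq> ground M" "conn G (ground M)"
  shows "split_flat G"
proof -
  have FG: "F \<subseteq> G" "G \<subseteq> ground M" using s by (auto simp: sep_def)
  have fin: "finite G" using FG finite_ground finite_subset by blast
  have "conn {} G"
    unfolding conn_def
  proof (intro allI impI)
    fix Z assume Z: "sep {} G Z"
    have key: "Q = {}" if Q: "sep {} G Q" "F \<inter> Q = {}" for Q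
    proof -
      have QG: "Q \<subseteq> G" "rk M Q + rk M (G - Q) = rk M G" using Q by (auto simp: sep_def)
      have "sep {} (ground M) Q"
      proof (rule sepI)
        have "(G - Q) \<union> (F \<union> (ground M - G)) = ground M - Q" "(G - Q) \<inter> (F \<union> (ground M - G)) = F"
          using QG FG Q by auto
        then have "rk M (ground M - Q) + rk M F \<le> rk M (G - Q) + rk M (F \<union> (ground M - G))"
          using rk_submod[of "G - Q" "F \<union> (ground M - G)"] by simp
        then show "rk M Q + rk M ({} \<union> (ground M - Q)) \<le> rk M (ground M) + rk M {}"
          using s QG by (simp add: sep_def)
      qed (use QG FG in auto)
      then have "Q = {} \<or> Q = ground M" using c by (simp add: conn_def)
      then show ?thesis using F Q FG by auto
    qed
    have "sep {} F (F \<inter> Z)"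
    proof (rule sepI)
      have "rk M F + rk M {} = rk M (F \<inter> Z) + rk M ({} \<union> (F - Z))"
        by (rule sep_restrict[OF Z]) (use FG in auto)
      moreover have "F - F \<inter> Z = F - Z" by auto
      ultimately show "rk M (F \<inter> Z) + rk M ({} \<union> (F - F \<inter> Z)) \<le> rk M F + rk M {}" by simp
    qed auto
    then have "F \<inter> Z = {} \<or> F \<inter> Z = F" using F by (simp add: conn_def)
    then show "Z = {} \<or> Z = G"
    proof
      assume "F \<inter> Z = F"
      then have "F \<inter> ({} \<union> (G - Z)) = {}" by blast
      from key[OF sep_compl[OF Z] this] have "G - Z = {}" by simp
      moreover have "Z \<subseteq> G" using Z by (simp add: sep_def)
      ultimately show ?thesis by blast
    next
      assume "F \<inter> Z = {}"
      from key[OF Z this] show ?thesis by simp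
    qed
  qed
  moreover have "rk M G < card G"
  proof -
    have "rk M (F \<union> (G - F)) \<le> rk M F + card (G - F)" using fin by (intro rk_union_le_card) auto
    also have "\<dots> < card F + card (G - F)" using F by simp
    also have "\<dots> = card (F \<union> (G - F))"
      using fin FG by (intro card_Un_disjoint[symmetric]) (auto intro: finite_subset)
    finally show ?thesis using FG by (simp add: Un_absorb1)
  qed
  moreover have "flat M G" by (rule sep_flat_upper[OF s(1) F(1)])
  ultimately show ?thesis using s F FG by (auto simp: split_flat_def)
qed

text \<open>The dual situation, in which connectedness of \<open>M/B\<close> is the point. As
  \<open>M/G\<close> is connected, one side of any separator of \<open>M/B\<close> stays inside
  \<open>G\<close>, and removing \<open>B\<close> from that side leaves a separator of
  \<open>M\<close>.\<close>

lemma split_flat_lower_separator: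
  assumes c: "conn {} (ground M)" and ll: "loopless M"
    and G: "flat M G" "G \<noteq> ground M" "conn G (ground M)"
    and cyc: "\<And>e. e \<in> G \<Longrightarrow> rk M (G - {e}) = rk M G"
    and s: "sep {} G B" "B \<noteq> {}" "conn {} B"
  shows "split_flat B"
proof -
  have BG: "B \<subseteq> G" "G \<subseteq> ground M" using s flat_ground[OF G(1)] by (auto simp: sep_def)
  have BS: "rk M B + rk M (G - B) = rk M G" using s by (simp add: sep_def)
  have "conn B (ground M)"
    unfolding conn_def
  proof (intro allI impI)
    fix Z assume Z: "sep B (ground M) Z"
    have key: "Q = B" if Q: "sep B (ground M) Q" "Q \<subseteq> G" for Q
    proof -
      have BQ: "B \<subseteq> Q" "rk M Q + rk M (B \<union> (ground M - Q)) = rk M (ground M) + rk M B"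
        using Q by (auto simp: sep_def)
      have "rk M Q + rk M {} = rk M (Q \<inter> B) + rk M ({} \<union> (Q - B))"
        by (rule sep_restrict[OF s(1)]) (use Q in auto)
      moreover have "Q \<inter> B = B" using BQ by blast
      ultimately have "rk M (Q - B) + rk M (B \<union> (ground M - Q)) = rk M (ground M)" using BQ by simp
      moreover have "ground M - (Q - B) = B \<union> (ground M - Q)" using BQ Q BG by auto
      ultimately have "sep {} (ground M) (Q - B)" using Q BG by (auto simp: sep_def)
      then have "Q - B = {} \<or> Q - B = ground M" using c unfolding conn_def by blast
      then show ?thesis using BQ Q BG G s by auto
    qed
    have "sep G (ground M) (G \<union> Z)" using sep_dual_restrict[OF Z BG] .
    then have "G \<union> Z = G \<or> G \<union> Z = ground M" using G by (simp add: conn_def)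
    then show "Z = B \<or> Z = ground M"
    proof
      assume "G \<union> Z = ground M"
      then have "B \<union> (ground M - Z) \<subseteq> G" using BG by blast
      from key[OF sep_compl[OF Z] this] have "ground M - Z \<subseteq> B" by blast
      moreover have "B \<subseteq> Z" "Z \<subseteq> ground M" using Z by (auto simp: sep_def)
      ultimately show ?thesis by blast
    next
      assume "G \<union> Z = G"
      then have "Z \<subseteq> G" by blast
      from key[OF Z this] show ?thesis by simp
    qed
  qed
  moreover have "rk M B < card B"
  proof -
    have "rk M G < rk M (G - B) + card (G - (G - B))"
      by (rule rk_diff_less) (use BG s cyc in auto)
    moreover have "G - (G - B) = B" using BG by blast
    ultimately show ?thesis using BS by simp
  qed
  moreover have "flat M B" by (rule sep_flat_lower[OF s(1) G(1) ll])
  ultimately show ?thesis using s BG G by (auto simp: split_flat_def)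
qed

lemma nested_cyclic_flats_crossing:
  assumes c: "conn {} (ground M)" and ll: "loopless M" and co: "coloopless M"
    and F: "proper_cyclic_flat M F" and G: "proper_cyclic_flat M G" and FG: "F \<subset> G"
  shows "\<exists>F' G'. split_flat F' \<and> split_flat G' \<and> F' \<noteq> G' \<and> crossing F' G'"
proof -
  let ?S = "ground M"
  have F0: "flat M F" "F \<noteq> {}" "F \<subseteq> ?S" "\<And>e. e \<in> F \<Longrightarrow> rk M (F - {e}) = rk M F"
    using F rk_empty by (auto simp: proper_cyclic_flat_def proper_flat_def cyclic_iff)
  have G0: "flat M G" "G \<subset> ?S" "\<And>e. e \<in> G \<Longrightarrow> rk M (G - {e}) = rk M G"
    using G by (auto simp: proper_cyclic_flat_def proper_flat_def cyclic_iff)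
  have finS: "finite ?S" by (rule finite_ground)
  have coS: "rk M (?S - {e}) = rk M ?S" if "e \<in> ?S" for e using co that by (simp add: coloopless_iff)
  have fin: "finite F" "finite G"
    using finite_subset[OF F0(3) finS] finite_subset[OF psubset_imp_subset[OF G0(2)] finS] by auto
  have sF: "sep {} F F" by (simp add: sep_def)
  obtain F\<^sub>1 where F1: "sep {} F F\<^sub>1" "F\<^sub>1 \<subseteq> F" "F\<^sub>1 \<noteq> {}" "conn {} F\<^sub>1"
    by (rule minimal_sep[OF sF F0(2) fin(1)])
  have fF1: "flat M F\<^sub>1" by (rule sep_flat_lower[OF F1(1) F0(1) ll])
  \<comment> \<open>Were \<open>F\<^sub>1\<close> independent, its elements would be coloops of
    \<open>M|F\<close>.\<close>
  have dF1: "rk M F\<^sub>1 < card F\<^sub>1"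
  proof -
    have "rk M F < rk M (F - F\<^sub>1) + card (F - (F - F\<^sub>1))"
      by (rule rk_diff_less) (use F0 F1 in auto)
    moreover have "F - (F - F\<^sub>1) = F\<^sub>1" using F1 by blast
    moreover have "rk M F\<^sub>1 + rk M (F - F\<^sub>1) = rk M F" using F1 by (simp add: sep_def)
    ultimately show ?thesis by simp
  qed
  have F1S: "F\<^sub>1 \<subseteq> ?S" "F\<^sub>1 \<noteq> ?S" using F1(2) F0(3) FG G0(2) by auto
  show ?thesis
  proof (cases "conn F\<^sub>1 ?S")
    case False
    then obtain X where X: "sep F\<^sub>1 ?S X" "X \<noteq> F\<^sub>1" "X \<noteq> ?S" unfolding conn_def by blast
    let ?Y = "F\<^sub>1 \<union> (?S - X)"
    have XF: "F\<^sub>1 \<subseteq> X" "X \<subseteq> ?S" using X by (auto simp: sep_def)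
    have Y: "sep F\<^sub>1 ?S ?Y" "?Y \<noteq> ?S" using sep_compl[OF X(1)] X XF by auto
    \<comment> \<open>Both sides of the separator are enlarged until their contractions are
      connected; they still cover the ground set, and so they differ.\<close>
    obtain G\<^sub>1 where G1: "sep F\<^sub>1 ?S G\<^sub>1" "X \<subseteq> G\<^sub>1" "G\<^sub>1 \<noteq> ?S" "conn G\<^sub>1 ?S"
      by (rule maximal_sep[OF X(1) X(3) finS])
    obtain G\<^sub>2 where G2: "sep F\<^sub>1 ?S G\<^sub>2" "?Y \<subseteq> G\<^sub>2" "G\<^sub>2 \<noteq> ?S" "conn G\<^sub>2 ?S"
      by (rule maximal_sep[OF Y finS])
    have cov: "G\<^sub>1 \<union> G\<^sub>2 = ?S" using G1(1,2) G2(1,2) by (auto simp: sep_def)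
    have "split_flat G\<^sub>1" by (rule split_flat_upper_separator[OF c fF1 F1(3,4) dF1 G1(1,3,4)])
    moreover have "split_flat G\<^sub>2" by (rule split_flat_upper_separator[OF c fF1 F1(3,4) dF1 G2(1,3,4)])
    moreover have "crossing G\<^sub>1 G\<^sub>2"
      by (rule upper_separators_crossing[OF G1(1) G2(1) cov G1(3) G2(3) fF1 F1(3) dF1 ll co])
    moreover have "G\<^sub>1 \<noteq> G\<^sub>2" using cov G1(3) by auto
    ultimately show ?thesis by blast
  next
    case True
    have sfF: "split_flat F\<^sub>1" using True F1 fF1 dF1 F1S by (simp add: split_flat_def)
    have sG: "sep G ?S G" "G \<noteq> ?S" using G0(2) by (auto simp: sep_def Un_absorb1)
    obtain G\<^sub>1 where G1: "sep G ?S G\<^sub>1" "G \<subseteq> G\<^sub>1" "G\<^sub>1 \<noteq> ?S" "conn G\<^sub>1 ?S"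
      by (rule maximal_sep[OF sG finS])
    have G1S: "G\<^sub>1 \<subset> ?S" "rk M G\<^sub>1 + rk M (G \<union> (?S - G\<^sub>1)) = rk M ?S + rk M G"
      using G1 by (auto simp: sep_def)
    have fG1: "flat M G\<^sub>1" by (rule sep_flat_upper[OF G1(1) G0(1)])
    \<comment> \<open>Enlarging \<open>G\<close> creates no coloops: elements of \<open>G\<close>
      are spanned within \<open>G\<close>, and any other coloop of \<open>M|G\<^sub>1\<close> would
      be a coloop of \<open>M\<close>, because \<open>G\<^sub>1\<close> is a separator over
      \<open>G\<close>.\<close>
    have cyc: "rk M (G\<^sub>1 - {e}) = rk M G\<^sub>1" if e: "e \<in> G\<^sub>1" for e
    proof (cases "e \<in> G")
      case True
      then have "rk M (insert e (G - {e})) = rk M (G - {e})" using G0(3) by (simp add: insert_absorb)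
      then have "rk M (insert e (G\<^sub>1 - {e})) = rk M (G\<^sub>1 - {e})"
        by (rule rk_insert_eq_mono) (use G1 in auto)
      then show ?thesis using e by (simp add: insert_absorb)
    next
      case False
      have "(G\<^sub>1 - {e}) \<union> (G \<union> (?S - G\<^sub>1)) = ?S - {e}" "(G\<^sub>1 - {e}) \<inter> (G \<union> (?S - G\<^sub>1)) = G"
        using False G1(2) G1S(1) e by auto
      then have "rk M (?S - {e}) + rk M G \<le> rk M (G\<^sub>1 - {e}) + rk M (G \<union> (?S - G\<^sub>1))"
        using rk_submod[of "G\<^sub>1 - {e}" "G \<union> (?S - G\<^sub>1)"] by simp
      then have "rk M G\<^sub>1 \<le> rk M (G\<^sub>1 - {e})" using coS[of e] e G1S by auto
      then show ?thesis using rk_mono[of "G\<^sub>1 - {e}" G\<^sub>1] by simp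
    qed
    have F1G1: "F\<^sub>1 \<subset> G\<^sub>1" using F1(2) FG G1(2) by blast
    have finG1: "finite G\<^sub>1" using G1S finS finite_subset by blast
    show ?thesis
    proof (cases "conn {} G\<^sub>1")
      case True
      have "rk M G\<^sub>1 < card G\<^sub>1"
        using rk_diff_less[of "{}" G\<^sub>1] cyc F1G1 G1S by auto
      then have "split_flat G\<^sub>1" using True fG1 F1G1 G1 by (auto simp: split_flat_def)
      then show ?thesis
        using nested_flats_crossing[OF sfF _ F1G1 cyc ll co] sfF F1G1 by blast
    next
      case False
      then obtain X where X: "sep {} G\<^sub>1 X" "X \<noteq> {}" "X \<noteq> G\<^sub>1" unfolding conn_def by blast
      have XG: "X \<subseteq> G\<^sub>1" using X by (simp add: sep_def)
      have Y: "sep {} G\<^sub>1 (G\<^sub>1 - X)" "G\<^sub>1 - X \<noteq> {}" using sep_compl[OF X(1)] X XG by auto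
      obtain B\<^sub>1 where B1: "sep {} G\<^sub>1 B\<^sub>1" "B\<^sub>1 \<subseteq> X" "B\<^sub>1 \<noteq> {}" "conn {} B\<^sub>1"
        by (rule minimal_sep[OF X(1,2) finG1])
      obtain B\<^sub>2 where B2: "sep {} G\<^sub>1 B\<^sub>2" "B\<^sub>2 \<subseteq> G\<^sub>1 - X" "B\<^sub>2 \<noteq> {}" "conn {} B\<^sub>2"
        by (rule minimal_sep[OF Y finG1])
      have dis: "B\<^sub>1 \<inter> B\<^sub>2 = {}" using B1 B2 by blast
      have "split_flat B\<^sub>1" by (rule split_flat_lower_separator[OF c ll fG1 G1(3,4) cyc B1(1,3,4)])
      moreover have "split_flat B\<^sub>2" by (rule split_flat_lower_separator[OF c ll fG1 G1(3,4) cyc B2(1,3,4)])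
      moreover have "crossing B\<^sub>1 B\<^sub>2"
        using flat_rk_less[OF fG1 G1S(1)]
        by (intro lower_separators_crossing[OF B1(1) B2(1) dis B1(3) B2(3) G1S(1) _ cyc ll co]) auto
      moreover have "B\<^sub>1 \<noteq> B\<^sub>2" using dis B1 by auto
      ultimately show ?thesis by blast
    qed
  qed
qed

end

section \<open>Splits along a hyperplane\<close>

text \<open>The cells are all faces of the two halves. Points strictly on either side make both
  halves maximal, and the interior point \<open>z\<close> makes their common face span the whole
  hyperplane section.\<close>

lemma halves_cells:
  fixes P :: "'v::euclidean_space set"
  assumes cv: "convex P" and pol: "polytope (P \<inter> {x. a \<bullet> x \<le> b})" "polytope (P \<inter> {x. a \<bullet> x \<ge> b})"
    and ext: "\<And>v. v extreme_point_of (P \<inter> {x. a \<bullet> x \<le> b}) \<Longrightarrow> v extreme_point_of P"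
      "\<And>v. v extreme_point_of (P \<inter> {x. a \<bullet> x \<ge> b}) \<Longrightarrow> v extreme_point_of P"
    and lt: "\<exists>x\<in>P. a \<bullet> x < b" and gt: "\<exists>x\<in>P. a \<bullet> x > b"
    and z: "z \<in> rel_interior P" "a \<bullet> z = b"
  shows "\<exists>\<C>. is_split P \<C> \<and> split_hyperplane \<C> = {x. a \<bullet> x = b} \<inter> affine hull P"
proof -
  define P1 where "P1 = P \<inter> {x. a \<bullet> x \<le> b}"
  define P2 where "P2 = P \<inter> {x. a \<bullet> x \<ge> b}"
  define P0 where "P0 = P \<inter> {x. a \<bullet> x = b}"
  define \<C> where "\<C> = {F. F face_of P1} \<union> {F. F face_of P2}"
  have cvx: "convex P1" "convex P2" using pol polytope_imp_convex by (auto simp: P1_def P2_def)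
  have int: "P1 \<inter> P2 = P0" by (auto simp: P1_def P2_def P0_def)
  have P0_1: "P0 face_of P1"
  proof -
    have "(P1 \<inter> {x. a \<bullet> x = b}) face_of P1"
      by (rule face_of_Int_supporting_hyperplane_le[OF cvx(1)]) (simp add: P1_def)
    moreover have "P1 \<inter> {x. a \<bullet> x = b} = P0" by (auto simp: P1_def P0_def)
    ultimately show ?thesis by simp
  qed
  have P0_2: "P0 face_of P2"
  proof -
    have "(P2 \<inter> {x. a \<bullet> x = b}) face_of P2"
      by (rule face_of_Int_supporting_hyperplane_ge[OF cvx(2)]) (simp add: P2_def)
    moreover have "P2 \<inter> {x. a \<bullet> x = b} = P0" by (auto simp: P2_def P0_def)
    ultimately show ?thesis by simp
  qed
  \<comment> \<open>Faces of different halves meet inside the common face \<open>P0\<close>, on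
    which both leave a face as trace.\<close>
  have mixed: "C \<inter> D face_of C \<and> C \<inter> D face_of D" if C: "C face_of P1" and D: "D face_of P2" for C D
  proof -
    have sub: "C \<subseteq> P1" "D \<subseteq> P2" using C D face_of_imp_subset by auto
    have "C \<inter> P0 face_of P0"
      using face_of_subset[OF face_of_Int[OF C P0_1], of P0] face_of_imp_subset[OF P0_1] by simp
    moreover have "D \<inter> P0 face_of P0"
      using face_of_subset[OF face_of_Int[OF D P0_2], of P0] face_of_imp_subset[OF P0_2] by simp
    ultimately have "(C \<inter> P0) \<inter> (D \<inter> P0) face_of P0" by (rule face_of_Int)
    moreover have "(C \<inter> P0) \<inter> (D \<inter> P0) = C \<inter> D" using sub int by blast
    ultimately have CD: "C \<inter> D face_of P0" by simp
    have "C \<inter> D face_of C"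
      using face_of_subset[OF face_of_trans[OF CD P0_1], of C] sub by blast
    moreover have "C \<inter> D face_of D"
      using face_of_subset[OF face_of_trans[OF CD P0_2], of D] sub by blast
    ultimately show ?thesis by blast
  qed
  have same: "C \<inter> D face_of C \<and> C \<inter> D face_of D" if "C face_of Q" "D face_of Q" for C D Q :: "'v set"
  proof -
    have "C \<inter> D face_of Q" using that by (rule face_of_Int)
    moreover have "C \<subseteq> Q" "D \<subseteq> Q" using that face_of_imp_subset by auto
    ultimately show ?thesis using face_of_subset by (metis inf_le1 inf_le2)
  qed
  have selfs: "P1 face_of P1" "P2 face_of P2" using cvx by (auto intro: face_of_refl)
  have sub: "polytopal_subdivision P \<C>"
    unfolding polytopal_subdivision_def
  proof (intro conjI ballI allI impI)
    show "finite \<C>"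
      using finite_polytope_faces pol by (auto simp: \<C>_def P1_def P2_def)
    show "polytope C" if "C \<in> \<C>" for C
      using that pol face_of_polytope_polytope by (auto simp: \<C>_def P1_def P2_def)
    have "\<Union>\<C> \<subseteq> P1 \<union> P2" using face_of_imp_subset by (auto simp: \<C>_def)
    moreover have "P1 \<union> P2 \<subseteq> \<Union>\<C>" using selfs by (auto simp: \<C>_def)
    moreover have "P1 \<union> P2 = P" by (auto simp: P1_def P2_def)
    ultimately show "\<Union>\<C> = P" by simp
    show "F \<in> \<C>" if "C \<in> \<C>" "F face_of C" for C F
      using that face_of_trans by (auto simp: \<C>_def)
    fix C D assume "C \<in> \<C>" "D \<in> \<C>"
    then have "(\<exists>Q. C face_of Q \<and> D face_of Q) \<or> (C face_of P1 \<and> D face_of P2) \<or>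
        (D face_of P1 \<and> C face_of P2)"
      by (auto simp: \<C>_def)
    then have "C \<inter> D face_of C \<and> C \<inter> D face_of D"
      using same mixed[of C D] mixed[of D C] by (metis Int_commute)
    then show "C \<inter> D face_of C" "C \<inter> D face_of D" by auto
  qed
  have n12: "\<not> P1 \<subseteq> P2" "\<not> P2 \<subseteq> P1" using lt gt by (auto simp: P1_def P2_def)
  have "maximal_cells \<C> = {P1, P2}"
  proof (intro equalityI subsetI)
    fix C assume C: "C \<in> maximal_cells \<C>"
    then have "C \<subseteq> P1 \<or> C \<subseteq> P2" using face_of_imp_subset by (auto simp: maximal_cells_def \<C>_def)
    moreover have "P1 \<in> \<C>" "P2 \<in> \<C>" using selfs by (auto simp: \<C>_def)
    ultimately show "C \<in> {P1, P2}" using C unfolding maximal_cells_def by blast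
  next
    fix C assume C: "C \<in> {P1, P2}"
    have "D \<subseteq> P1 \<or> D \<subseteq> P2" if "D \<in> \<C>" for D using that face_of_imp_subset by (auto simp: \<C>_def)
    then show "C \<in> maximal_cells \<C>"
      using C n12 selfs unfolding maximal_cells_def \<C>_def by blast
  qed
  moreover have "P1 \<noteq> P2" using n12 by auto
  ultimately have maxc: "card (maximal_cells \<C>) = 2" "\<Inter>(maximal_cells \<C>) = P0" using int by auto
  have "v extreme_point_of P" if C: "C \<in> \<C>" and v: "v extreme_point_of C" for C v
  proof -
    have "C face_of P1 \<or> C face_of P2" using C by (auto simp: \<C>_def)
    then have "v extreme_point_of P1 \<or> v extreme_point_of P2" using extreme_point_of_face v by blast
    then show ?thesis using ext by (auto simp: P1_def P2_def)
  qed
  then have "is_split P \<C>" using sub maxc by (simp add: is_split_def)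
  moreover have "affine hull P0 = {x. a \<bullet> x = b} \<inter> affine hull P"
  proof -
    define A where "A = {x. a \<bullet> x = b} \<inter> affine hull P"
    have aff: "affine A" unfolding A_def by (intro affine_Int affine_hyperplane affine_affine_hull)
    then have hullA: "affine hull A = A" by (simp add: affine_hull_eq)
    \<comment> \<open>Near \<open>z\<close> the section of the affine hull stays within
      \<open>P\<close>, and a nonempty relatively open part of an affine set spans it.\<close>
    obtain T where T: "open T" "rel_interior P = affine hull P \<inter> T"
      using openin_rel_interior[of P] unfolding openin_open by blast
    have z': "z \<in> A \<inter> T"
      using z T subsetD[OF rel_interior_subset z(1)] hull_inc[of z P affine] by (auto simp: A_def)
    have "A = affine hull (A \<inter> T)"
      using affine_hull_affine_Int_open[OF aff T(1)] z' hullA by auto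
    also have "\<dots> \<subseteq> affine hull P0"
      using T rel_interior_subset[of P] by (intro hull_mono) (auto simp: A_def P0_def)
    finally have "A \<subseteq> affine hull P0" .
    moreover have "affine hull P0 \<subseteq> A"
      using aff hull_inc[of _ P affine] by (intro hull_minimal) (auto simp: P0_def A_def)
    ultimately show ?thesis unfolding A_def by (rule subset_antisym[rotated])
  qed
  ultimately show ?thesis using maxc by (auto simp: split_hyperplane_def)
qed

section \<open>The hypersimplex\<close>

definition slice :: "nat \<Rightarrow> 'a set \<Rightarrow> (real ^ 'a::finite) set" where
  "slice r S = {x \<in> unit_cube S. (\<Sum>i\<in>S. x $ i) = r}"

text \<open>The bound is a natural number: integrality is what keeps the vertices 0-1 vectors. Empty
  \<open>F\<close> and \<open>k = 0\<close> recover \<open>slice\<close>, so facts about slices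
  follow from facts about half-slices.\<close>

definition half_slice :: "nat \<Rightarrow> 'a set \<Rightarrow> 'a set \<Rightarrow> nat \<Rightarrow> (real ^ 'a::finite) set" where
  "half_slice r S F k = {x \<in> slice r S. (\<Sum>i\<in>F. x $ i) \<le> k}"

lemma inner_char_vec: "char_vec F \<bullet> x = (\<Sum>i\<in>F. x $ i)"
  for x :: "real ^ 'a::finite"
proof -
  have "char_vec F \<bullet> x = (\<Sum>i\<in>UNIV. if i \<in> F then x $ i else 0)"
    unfolding inner_vec_def char_vec_def by (intro sum.cong) auto
  also have "\<dots> = (\<Sum>i\<in>F. x $ i)" by (simp add: sum.If_cases)
  finally show ?thesis .
qed

lemma mem_slice_iff:
  "x \<in> slice r S \<longleftrightarrow> (\<forall>i. i \<notin> S \<longrightarrow> x $ i = 0) \<and> (\<forall>i\<in>S. 0 \<le> x $ i \<and> x $ i \<le> 1) \<and> (\<Sum>i\<in>S. x $ i) = r"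
  by (auto simp: slice_def unit_cube_def coord_space_def)

lemma convex_half_slice: "convex (half_slice r S F k)" and closed_half_slice: "closed (half_slice r S F k)"
  for S :: "'a::finite set"
proof -
  have eq: "half_slice r S F k = (\<Inter>i\<in>-S. {x. axis i 1 \<bullet> x = 0}) \<inter>
    (\<Inter>i\<in>S. {x. axis i 1 \<bullet> x \<ge> 0} \<inter> {x. axis i 1 \<bullet> x \<le> 1}) \<inter> {x. char_vec S \<bullet> x = r} \<inter>
    {x. char_vec F \<bullet> x \<le> k}"
    by (auto simp: half_slice_def mem_slice_iff inner_char_vec inner_axis')
  show "convex (half_slice r S F k)" unfolding eq
    by (intro convex_Int convex_INT convex_hyperplane convex_halfspace_ge convex_halfspace_le)
  show "closed (half_slice r S F k)" unfolding eq
    by (intro closed_Int closed_INT ballI closed_hyperplane closed_halfspace_ge closed_halfspace_le)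
qed

lemma slice_eq_half: "slice r S = half_slice r S {} 0"
  by (simp add: half_slice_def)

lemma compact_half_slice: "compact (half_slice r S F k)"
proof -
  have "0 \<le> x $ i \<and> x $ i \<le> 1" if "x \<in> half_slice r S F k" for x i
    using that by (cases "i \<in> S") (auto simp: half_slice_def mem_slice_iff)
  then have "half_slice r S F k \<subseteq> cbox 0 1" by (auto simp: mem_box_cart)
  then show ?thesis
    using closed_half_slice bounded_cbox bounded_subset compact_eq_bounded_closed by blast
qed

section \<open>Vertices of half-slices\<close>

lemma sum_exchange:
  fixes x :: "real ^ 'a::finite"
  shows "(\<Sum>l\<in>F. (x + e *\<^sub>R (axis i 1 - axis j 1)) $ l)
    = (\<Sum>l\<in>F. x $ l) + e * ((if i \<in> F then 1 else 0) - (if j \<in> F then 1 else 0))"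
proof -
  have "(\<Sum>l\<in>F. axis i (1::real) $ l) = (if i \<in> F then 1 else 0)" for i :: 'a
    by (simp add: axis_def)
  then show ?thesis by (simp add: sum.distrib sum_distrib_left[symmetric] sum_subtractf)
qed

lemma exchange_in_slice:
  assumes x: "x \<in> slice r S" and ij: "i \<in> S" "j \<in> S" "i \<noteq> j"
    and e: "\<bar>e\<bar> \<le> x $ i" "\<bar>e\<bar> \<le> 1 - x $ i" "\<bar>e\<bar> \<le> x $ j" "\<bar>e\<bar> \<le> 1 - x $ j"
  shows "x + e *\<^sub>R (axis i 1 - axis j 1) \<in> slice r S"
proof -
  have "(\<Sum>l\<in>S. (x + e *\<^sub>R (axis i 1 - axis j 1)) $ l) = r"
    unfolding sum_exchange using x ij by (simp add: mem_slice_iff)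
  moreover have "0 \<le> (x + e *\<^sub>R (axis i 1 - axis j 1)) $ l \<and> (x + e *\<^sub>R (axis i 1 - axis j 1)) $ l \<le> 1"
    if "l \<in> S" for l
    using x that e ij unfolding mem_slice_iff by (auto simp: axis_def)
  moreover have "(x + e *\<^sub>R (axis i 1 - axis j 1)) $ l = 0" if "l \<notin> S" for l
    using x that ij by (auto simp: mem_slice_iff axis_def)
  ultimately show ?thesis unfolding mem_slice_iff by blast
qed

text \<open>Weight can be shifted between \<open>i\<close> and \<open>j\<close> in either direction:
  the sum over \<open>F\<close> either does not change or has slack.\<close>

lemma not_extreme_half_slice:
  assumes x: "x \<in> half_slice r S F k" and ij: "i \<in> S" "j \<in> S" "i \<noteq> j"
    and fr: "0 < x $ i" "x $ i < 1" "0 < x $ j" "x $ j < 1"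
    and side: "(i \<in> F \<longleftrightarrow> j \<in> F) \<or> (\<Sum>l\<in>F. x $ l) < k"
  shows "\<not> x extreme_point_of half_slice r S F k"
proof -
  define d :: "real ^ 'a" where "d = axis i 1 - axis j 1"
  \<comment> \<open>Small enough for the four cube bounds and, where the bound on \<open>F\<close>
    is slack, for that slack.\<close>
  define e where "e = Min ({x $ i, 1 - x $ i, x $ j, 1 - x $ j} \<union>
    (if (\<Sum>l\<in>F. x $ l) < k then {k - (\<Sum>l\<in>F. x $ l)} else {}))"
  have e0: "0 < e" using fr by (auto simp: e_def)
  have eb: "e \<le> x $ i" "e \<le> 1 - x $ i" "e \<le> x $ j" "e \<le> 1 - x $ j" by (auto simp: e_def)
  have ek: "e \<le> k - (\<Sum>l\<in>F. x $ l)" if "(\<Sum>l\<in>F. x $ l) < k" using that by (auto simp: e_def)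
  have mem: "x + t *\<^sub>R d \<in> half_slice r S F k" if t: "\<bar>t\<bar> = e" for t
  proof -
    have "x + t *\<^sub>R d \<in> slice r S"
      unfolding d_def by (rule exchange_in_slice) (use x ij eb t in \<open>auto simp: half_slice_def\<close>)
    moreover have "(\<Sum>l\<in>F. (x + t *\<^sub>R d) $ l) \<le> k"
      unfolding d_def sum_exchange using side x ek t by (auto simp: half_slice_def)
    ultimately show ?thesis by (simp add: half_slice_def)
  qed
  have "d $ i = 1" using ij by (simp add: d_def axis_def)
  then have "(x + e *\<^sub>R d) $ i \<noteq> (x + (- e) *\<^sub>R d) $ i" using e0 by simp
  then have "x + e *\<^sub>R d \<noteq> x + (- e) *\<^sub>R d" by metis
  moreover have "x = midpoint (x + e *\<^sub>R d) (x + (- e) *\<^sub>R d)"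
    by (simp add: midpoint_def vec_eq_iff)
  ultimately have "x \<in> open_segment (x + e *\<^sub>R d) (x + (- e) *\<^sub>R d)"
    using midpoint_in_open_segment by metis
  then show ?thesis
    using mem[of e] mem[of "- e"] e0 unfolding extreme_point_of_def by auto
qed

lemma single_fraction_sum:
  fixes x :: "'a \<Rightarrow> real"
  assumes "finite A" "i \<in> A" "0 < x i" "x i < 1" "\<And>l. l \<in> A - {i} \<Longrightarrow> x l = 0 \<or> x l = 1"
  shows "sum x A \<noteq> real n"
proof
  assume "sum x A = real n"
  moreover have "sum x A = x i + sum x (A - {i})" using assms by (simp add: sum.remove)
  moreover have "sum x (A - {i}) = real (card {l \<in> A - {i}. x l = 1})"
  proof -
    have "sum x (A - {i}) = sum (\<lambda>l. if x l = 1 then 1 else 0) (A - {i})"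
      using assms by (intro sum.cong) auto
    also have "\<dots> = real (card {l \<in> A - {i}. x l = 1})"
      using assms by (simp add: sum.If_cases Int_def)
    finally show ?thesis .
  qed
  ultimately have "x i = of_int (int n - int (card {l \<in> A - {i}. x l = 1}))" by simp
  then show False using assms by (metis of_int_0_less_iff of_int_less_1_iff int_one_le_iff_zero_less not_le)
qed

text \<open>Two fractional coordinates must lie on opposite sides of \<open>F\<close> with the bound
  tight, or weight could be shifted between them. A single one contradicts the integral total
  \<open>r\<close>; a pair leaves exactly one in \<open>F\<close>, which contradicts the integral
  value \<open>k\<close>.\<close>

lemma extreme_half_slice:
  assumes FS: "F \<subseteq> S" and x: "x extreme_point_of half_slice r S F k"
  shows "\<exists>X\<subseteq>S. card X = r \<and> x = char_vec X"
proof -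
  have xh: "x \<in> half_slice r S F k" using x by (simp add: extreme_point_of_def)
  then have xs: "\<And>i. i \<notin> S \<Longrightarrow> x $ i = 0" "\<And>i. i \<in> S \<Longrightarrow> 0 \<le> x $ i \<and> x $ i \<le> 1" "(\<Sum>i\<in>S. x $ i) = r"
    and xF: "(\<Sum>i\<in>F. x $ i) \<le> k"
    by (auto simp: half_slice_def mem_slice_iff)
  define Fr where "Fr = {i \<in> S. 0 < x $ i \<and> x $ i < 1}"
  have nF: "x $ i = 0 \<or> x $ i = 1" if "i \<in> S" "i \<notin> Fr" for i
    using xs(2)[OF that(1)] that by (auto simp: Fr_def)
  have opp: "(i \<in> F) \<noteq> (j \<in> F) \<and> (\<Sum>i\<in>F. x $ i) = k" if "i \<in> Fr" "j \<in> Fr" "i \<noteq> j" for i j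
  proof (rule ccontr)
    assume "\<not> ?thesis"
    then have "(i \<in> F \<longleftrightarrow> j \<in> F) \<or> (\<Sum>l\<in>F. x $ l) < k" using xF by auto
    then have "\<not> x extreme_point_of half_slice r S F k"
      using that by (intro not_extreme_half_slice[OF xh, of i j]) (auto simp: Fr_def)
    then show False using x by blast
  qed
  have finS: "finite S" "finite F" by auto
  have "Fr = {}"
  proof (rule ccontr)
    assume "Fr \<noteq> {}"
    then obtain i where i: "i \<in> Fr" by blast
    have "\<exists>j\<in>Fr. j \<noteq> i"
    proof (rule ccontr)
      assume "\<not> ?thesis"
      then have "(\<Sum>l\<in>S. x $ l) \<noteq> real r"
        using i nF by (intro single_fraction_sum[of S i]) (auto simp: Fr_def)
      then show False using xs by simp
    qed
    then obtain j where j: "j \<in> Fr" "j \<noteq> i" by blast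
    then obtain g where g: "g \<in> Fr" "g \<in> F" using opp[OF i j(1)] i by metis
    have "x $ l = 0 \<or> x $ l = 1" if l: "l \<in> F - {g}" for l
    proof (rule nF)
      show "l \<in> S" using l FS by blast
      show "l \<notin> Fr" using opp[OF g(1), of l] l g(2) by blast
    qed
    moreover have "0 < x $ g" "x $ g < 1" using g(1) by (auto simp: Fr_def)
    ultimately have "(\<Sum>l\<in>F. x $ l) \<noteq> real k"
      using g(2) by (intro single_fraction_sum[of F g]) auto
    then show False using opp[OF i j(1)] j by auto
  qed
  then have x01: "x $ i = 0 \<or> x $ i = 1" if "i \<in> S" for i using nF that by blast
  define X where "X = {i \<in> S. x $ i = 1}"
  have "x = char_vec X" using x01 xs(1) by (auto simp: char_vec_def X_def vec_eq_iff)
  moreover have "card X = r"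
  proof -
    have "(\<Sum>i\<in>S. x $ i) = (\<Sum>i\<in>S. if x $ i = 1 then 1 else 0)" using x01 by (intro sum.cong) auto
    also have "\<dots> = real (card X)" by (simp add: sum.If_cases X_def Int_def)
    finally show ?thesis using xs by simp
  qed
  moreover have "X \<subseteq> S" by (auto simp: X_def)
  ultimately show ?thesis by blast
qed

text \<open>By Krein-Milman, a compact convex set with finitely many extreme points is a
  polytope.\<close>

lemma polytope_half_slice:
  assumes "F \<subseteq> S" shows "polytope (half_slice r S F k)"
proof -
  have "{x. x extreme_point_of half_slice r S F k} \<subseteq> char_vec ` Pow S"
    using extreme_half_slice[OF assms] by blast
  then have "finite {x. x extreme_point_of half_slice r S F k}"
    by (rule finite_subset) simp
  then show ?thesis
    unfolding polytope_def
    using Krein_Milman_Minkowski[OF compact_half_slice convex_half_slice] by blast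
qed

lemma char_vec_nth: "char_vec X $ i = (if i \<in> X then 1 else 0)"
  by (simp add: char_vec_def)

lemma sum_char_vec: "(\<Sum>i\<in>F. char_vec X $ i) = real (card (X \<inter> F))"
  for F :: "'a::finite set"
  by (simp add: char_vec_nth sum.If_cases Int_commute)

lemma char_vec_in_slice: "X \<subseteq> S \<Longrightarrow> card X = r \<Longrightarrow> char_vec X \<in> slice r S"
  unfolding mem_slice_iff sum_char_vec by (auto simp: char_vec_nth Int_absorb2)

lemma extreme_slice:
  assumes "X \<subseteq> S" "card X = r" shows "char_vec X extreme_point_of slice r S"
  unfolding extreme_point_of_def
proof (intro conjI ballI char_vec_in_slice[OF assms])
  fix a b assume ab: "a \<in> slice r S" "b \<in> slice r S"
  show "char_vec X \<notin> open_segment a b"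
  proof
    assume "char_vec X \<in> open_segment a b"
    then obtain u where u: "a \<noteq> b" "0 < u" "u < 1" "char_vec X = (1 - u) *\<^sub>R a + u *\<^sub>R b"
      by (auto simp: in_segment)
    have "a $ i = b $ i" for i
    proof -
      have bd: "0 \<le> a $ i" "a $ i \<le> 1" "0 \<le> b $ i" "b $ i \<le> 1"
        using ab by (cases "i \<in> S"; auto simp: mem_slice_iff)+
      have eq: "char_vec X $ i = (1 - u) * a $ i + u * b $ i" using u(4) by simp
      show ?thesis
      proof (cases "i \<in> X")
        case True
        then have "(1 - u) * (1 - a $ i) + u * (1 - b $ i) = 0"
          using eq by (simp add: char_vec_nth algebra_simps)
        moreover have "0 \<le> (1 - u) * (1 - a $ i)" "0 \<le> u * (1 - b $ i)" using bd u by auto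
        ultimately have "(1 - u) * (1 - a $ i) = 0" "u * (1 - b $ i) = 0" by linarith+
        then show ?thesis using u by auto
      next
        case False
        then have "(1 - u) * a $ i + u * b $ i = 0" using eq by (simp add: char_vec_nth)
        moreover have "0 \<le> (1 - u) * a $ i" "0 \<le> u * b $ i" using bd u by auto
        ultimately have "(1 - u) * a $ i = 0" "u * b $ i = 0" by linarith+
        then show ?thesis using u by auto
      qed
    qed
    then show False using u(1) by (simp add: vec_eq_iff)
  qed
qed

lemma hypersimplex_eq_slice: "hypersimplex r S = slice r S"
proof
  have "convex (slice r S)" unfolding slice_eq_half by (rule convex_half_slice)
  then show "hypersimplex r S \<subseteq> slice r S"
    unfolding hypersimplex_def by (intro hull_minimal) (auto intro: char_vec_in_slice)
  have "slice r S = convex hull {x. x extreme_point_of slice r S}"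
    using Krein_Milman_Minkowski[of "slice r S"] compact_half_slice convex_half_slice
    unfolding slice_eq_half by blast
  also have "\<dots> \<subseteq> hypersimplex r S"
    unfolding hypersimplex_def slice_eq_half
    using extreme_half_slice[of "{}" S _ r 0] by (intro hull_mono) blast
  finally show "slice r S \<subseteq> hypersimplex r S" .
qed

section \<open>Affine hull and relative interior of a slice\<close>

lemma affine_hull_slice_subset: "affine hull (slice r S) \<subseteq> {x \<in> coord_space S. (\<Sum>i\<in>S. x $ i) = r}"
proof (rule hull_minimal)
  have "{x \<in> coord_space S. (\<Sum>i\<in>S. x $ i) = r} =
    (\<Inter>i\<in>-S. {x. axis i 1 \<bullet> x = 0}) \<inter> {x. char_vec S \<bullet> x = r}"
    by (auto simp: coord_space_def inner_char_vec inner_axis')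
  then show "affine {x \<in> coord_space S. (\<Sum>i\<in>S. x $ i) = r}"
    by (auto intro!: affine_Int affine_Inter affine_hyperplane)
qed (auto simp: mem_slice_iff coord_space_def)

lemma rel_interior_sliceI:
  assumes x: "x \<in> coord_space S" "(\<Sum>i\<in>S. x $ i) = real r" "\<And>i. i \<in> S \<Longrightarrow> 0 < x $ i \<and> x $ i < 1"
  shows "x \<in> rel_interior (slice r S)"
  unfolding mem_rel_interior_ball
proof (intro conjI)
  show "x \<in> slice r S" using x by (auto simp: mem_slice_iff coord_space_def less_imp_le)
  \<comment> \<open>The inserted 1 keeps the minimum meaningful for empty \<open>S\<close>.\<close>
  define e where "e = Min (insert 1 ((\<lambda>i. min (x $ i) (1 - x $ i)) ` S))"
  have "0 < e" using x by (auto simp: e_def)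
  moreover have "ball x e \<inter> affine hull slice r S \<subseteq> slice r S"
  proof
    fix y assume y: "y \<in> ball x e \<inter> affine hull slice r S"
    then have ya: "y \<in> coord_space S" "(\<Sum>i\<in>S. y $ i) = r" using affine_hull_slice_subset by blast+
    have "0 \<le> y $ i \<and> y $ i \<le> 1" if i: "i \<in> S" for i
    proof -
      have "\<bar>y $ i - x $ i\<bar> \<le> norm (y - x)" using component_le_norm_cart[of "y - x" i] by simp
      also have "\<dots> < e" using y by (simp add: dist_norm norm_minus_commute)
      also have "e \<le> min (x $ i) (1 - x $ i)" unfolding e_def using i by (intro Min_le) auto
      finally show ?thesis by auto
    qed
    then show "y \<in> slice r S" using ya by (auto simp: mem_slice_iff coord_space_def)
  qed
  ultimately show "\<exists>e>0. ball x e \<inter> affine hull slice r S \<subseteq> slice r S" by blast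
qed

lemma rel_interior_sliceD:
  assumes x: "x \<in> rel_interior (slice r S)" and r: "0 < r" "r < card S" and i: "i \<in> S"
  shows "0 < x $ i \<and> x $ i < 1"
proof -
  \<comment> \<open>The centre of the slice. The segment from it to \<open>x\<close> can be
    prolonged beyond \<open>x\<close>, which a coordinate equal to 0 or 1 would forbid.\<close>
  define c :: "real ^ 'a" where "c = (\<chi> i. if i \<in> S then r / card S else 0)"
  have c01: "0 < c $ i" "c $ i < 1" using i r by (auto simp: c_def)
  have "c \<in> slice r S" using r by (auto simp: mem_slice_iff c_def)
  moreover have cv: "convex (slice r S)" unfolding slice_eq_half by (rule convex_half_slice)
  ultimately obtain e where e: "e > 1" "(1 - e) *\<^sub>R c + e *\<^sub>R x \<in> slice r S"
    using x convex_rel_interior_iff[of "slice r S" x] by blast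
  have xs: "0 \<le> x $ i" "x $ i \<le> 1" using subsetD[OF rel_interior_subset x] i by (auto simp: mem_slice_iff)
  have y: "0 \<le> (1 - e) * c $ i + e * x $ i" "(1 - e) * c $ i + e * x $ i \<le> 1"
    using e(2) i unfolding mem_slice_iff by auto
  have "x $ i \<noteq> 0"
  proof
    assume "x $ i = 0"
    then have "0 \<le> (1 - e) * c $ i" using y by simp
    then show False using e c01 by (simp add: zero_le_mult_iff)
  qed
  moreover have "x $ i \<noteq> 1"
  proof
    assume "x $ i = 1"
    then have "(e - 1) * (1 - c $ i) \<le> 0" using y by (simp add: algebra_simps)
    then show False using e c01 by (simp add: mult_le_0_iff)
  qed
  ultimately show ?thesis using xs by simp
qed

lemma hyperplane_splits_slice:
  assumes F: "F \<subseteq> S" "F \<noteq> {}" "F \<noteq> S" "k \<le> r"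
    and z: "z \<in> coord_space S" "(\<Sum>i\<in>S. z $ i) = real r" "\<And>i. i \<in> S \<Longrightarrow> 0 < z $ i \<and> z $ i < 1"
      "(\<Sum>i\<in>F. z $ i) = real k"
  shows "\<exists>\<C>. is_split (slice r S) \<C> \<and>
    split_hyperplane \<C> = {x. char_vec F \<bullet> x = k} \<inter> affine hull (slice r S)"
proof (rule halves_cells)
  \<comment> \<open>The upper half for \<open>F\<close> is the lower half for the complement with
    bound \<open>r - k\<close>, so the same vertex lemma covers both halves.\<close>
  have upper: "slice r S \<inter> {x. real k \<le> char_vec F \<bullet> x} = half_slice r S (S - F) (r - k)"
  proof -
    have "(\<Sum>i\<in>S. x $ i) = (\<Sum>i\<in>S - F. x $ i) + (\<Sum>i\<in>F. x $ i)" for x :: "real ^ 'a"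
      using F by (intro sum.subset_diff) auto
    then show ?thesis
      using F(4) by (auto simp: half_slice_def inner_char_vec mem_slice_iff of_nat_diff)
  qed
  have lower: "slice r S \<inter> {x. char_vec F \<bullet> x \<le> real k} = half_slice r S F k"
    by (auto simp: half_slice_def inner_char_vec)
  show "convex (slice r S)" unfolding slice_eq_half by (rule convex_half_slice)
  show "polytope (slice r S \<inter> {x. char_vec F \<bullet> x \<le> real k})"
    "polytope (slice r S \<inter> {x. char_vec F \<bullet> x \<ge> real k})"
    unfolding upper lower using F by (auto intro: polytope_half_slice)
  show "v extreme_point_of slice r S" if "v extreme_point_of (slice r S \<inter> {x. char_vec F \<bullet> x \<le> real k})" for v
    using extreme_half_slice[OF F(1)] extreme_slice that unfolding lower by blast
  show "v extreme_point_of slice r S" if "v extreme_point_of (slice r S \<inter> {x. char_vec F \<bullet> x \<ge> real k})" for v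
    using extreme_half_slice[of "S - F"] extreme_slice that unfolding upper by blast
  show zr: "z \<in> rel_interior (slice r S)" by (rule rel_interior_sliceI[OF z(1-3)])
  show "char_vec F \<bullet> z = real k" using z by (simp add: inner_char_vec)
  \<comment> \<open>Shifting weight between an element of \<open>F\<close> and one outside moves
    \<open>z\<close> off the hyperplane to either side.\<close>
  obtain i j where ij: "i \<in> F" "j \<in> S" "j \<notin> F" using F by blast
  define e where "e = Min {z $ i, 1 - z $ i, z $ j, 1 - z $ j}"
  have e: "0 < e" "e \<le> z $ i" "e \<le> 1 - z $ i" "e \<le> z $ j" "e \<le> 1 - z $ j"
    using z(3)[of i] z(3)[of j] ij F by (auto simp: e_def)
  have zs: "z \<in> slice r S" using zr rel_interior_subset by blast
  have mem: "z + t *\<^sub>R (axis i 1 - axis j 1) \<in> slice r S" if "\<bar>t\<bar> = e" for t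
    by (rule exchange_in_slice[OF zs]) (use ij F e that in auto)
  have val: "char_vec F \<bullet> (z + t *\<^sub>R (axis i 1 - axis j 1)) = k + t" for t :: real
    unfolding inner_char_vec sum_exchange using ij z by simp
  show "\<exists>x\<in>slice r S. char_vec F \<bullet> x < real k"
    using mem[of "- e"] val[of "- e"] e by (intro bexI[of _ "z + (- e) *\<^sub>R (axis i 1 - axis j 1)"]) auto
  show "\<exists>x\<in>slice r S. real k < char_vec F \<bullet> x"
    using mem[of e] val[of e] e by (intro bexI[of _ "z + e *\<^sub>R (axis i 1 - axis j 1)"]) auto
qed

section \<open>The base polytope\<close>

text \<open>A vector on \<open>T\<close> with zero sum is a combination of the differences
  \<open>axis i 1 - axis j 1\<close> for one fixed \<open>j\<close> in \<open>T\<close>.\<close>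

lemma supported_in_subspace:
  fixes d :: "real ^ 'a::finite"
  assumes V: "subspace V" and ax: "\<And>i j. i \<in> T \<Longrightarrow> j \<in> T \<Longrightarrow> axis i 1 - axis j 1 \<in> V"
    and d: "\<And>i. i \<notin> T \<Longrightarrow> d $ i = 0" "(\<Sum>i\<in>T. d $ i) = 0"
  shows "d \<in> V"
proof (cases "T = {}")
  case True
  then have "d = 0" using d by (simp add: vec_eq_iff)
  then show ?thesis using V by (simp add: subspace_0)
next
  case False
  then obtain j where j: "j \<in> T" by blast
  have "d = (\<Sum>i\<in>T. d $ i *\<^sub>R (axis i 1 - axis j 1))"
  proof (rule vec_eq_iff[THEN iffD2], rule allI)
    fix l
    have "(\<Sum>i\<in>T. d $ i *\<^sub>R (axis i 1 - axis j 1)) $ l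
      = (\<Sum>i\<in>T. d $ i * axis i 1 $ l) - (\<Sum>i\<in>T. d $ i) * axis j 1 $ l"
      by (simp add: right_diff_distrib sum_subtractf sum_distrib_right)
    also have "(\<Sum>i\<in>T. d $ i * axis i 1 $ l) = (\<Sum>i\<in>T. if i = l then d $ l else 0)"
      by (intro sum.cong) (auto simp: axis_def)
    also have "\<dots> = d $ l" using d(1)[of l] by simp
    finally show "d $ l = (\<Sum>i\<in>T. d $ i *\<^sub>R (axis i 1 - axis j 1)) $ l" using d by simp
  qed
  moreover have "(\<Sum>i\<in>T. d $ i *\<^sub>R (axis i 1 - axis j 1)) \<in> V"
    using V ax j by (intro subspace_sum subspace_mul) auto
  ultimately show ?thesis by simp
qed

lemma affine_directions_subspace:
  assumes A: "affine A" and b: "b \<in> A"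
  shows "subspace {v. b + v \<in> A}"
proof -
  have "v + w \<in> {v. b + v \<in> A}" if "v \<in> {v. b + v \<in> A}" "w \<in> {v. b + v \<in> A}" for v w
    using mem_affine_3_minus[OF A, of "b + v" "b + w" b 1] that b by (simp add: algebra_simps)
  moreover have "c *\<^sub>R v \<in> {v. b + v \<in> A}" if "v \<in> {v. b + v \<in> A}" for c v
    using mem_affine_3_minus[OF A, of b "b + v" b c] that b by simp
  ultimately show ?thesis using b by (simp add: subspace_def)
qed

locale finite_type_matroid = matroid M for M :: "'a::finite indep_system"
begin

abbreviation S :: "'a set" where "S \<equiv> ground M"

definition sum_plane :: "(real ^ 'a) set" where
  "sum_plane = {x \<in> coord_space S. (\<Sum>i\<in>S. x $ i) = real (rk M S)}"

lemma affine_sum_plane: "affine sum_plane"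
proof -
  have "sum_plane = (\<Inter>i\<in>-S. {x. axis i 1 \<bullet> x = 0}) \<inter> {x. char_vec S \<bullet> x = real (rk M S)}"
    by (auto simp: sum_plane_def coord_space_def inner_char_vec inner_axis')
  then show ?thesis by (auto intro!: affine_Int affine_Inter affine_hyperplane)
qed

lemma base_subset: "base M B \<Longrightarrow> B \<subseteq> S"
  using indep_ground by (simp add: base_iff)

lemma base_polytope_subset_slice: "base_polytope M \<subseteq> slice (rk M S) S"
proof -
  have "convex (slice (rk M S) S)" unfolding slice_eq_half by (rule convex_half_slice)
  moreover have "char_vec B \<in> slice (rk M S) S" if "base M B" for B
    using char_vec_in_slice[OF base_subset[OF that]] that by (simp add: base_iff)
  ultimately show ?thesis unfolding base_polytope_def by (intro hull_minimal) auto
qed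

lemma slice_subset_sum_plane: "slice (rk M S) S \<subseteq> sum_plane"
  by (auto simp: sum_plane_def mem_slice_iff coord_space_def)

lemma base_polytope_rank_bound: "x \<in> base_polytope M \<Longrightarrow> (\<Sum>i\<in>F. x $ i) \<le> rk M F"
proof -
  have "char_vec ` {B. base M B} \<subseteq> {x. char_vec F \<bullet> x \<le> rk M F}"
  proof clarify
    fix B assume "base M B"
    then have "B \<inter> F \<in> indep M" using indep_hereditary by (auto simp: base_iff)
    then show "char_vec F \<bullet> char_vec B \<le> rk M F"
      using card_le_rk[of "B \<inter> F" F] by (simp add: inner_char_vec sum_char_vec)
  qed
  then have "base_polytope M \<subseteq> {x. char_vec F \<bullet> x \<le> rk M F}"
    unfolding base_polytope_def by (intro hull_minimal convex_halfspace_le)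
  then show "x \<in> base_polytope M \<Longrightarrow> (\<Sum>i\<in>F. x $ i) \<le> rk M F" by (auto simp: inner_char_vec)
qed

lemma convex_base_polytope: "convex (base_polytope M)"
  by (simp add: base_polytope_def convex_convex_hull)

lemma flat_face_eq: "flat_face M F = base_polytope M \<inter> {x. char_vec F \<bullet> x = rk M F}"
  using base_polytope_subset_slice
  by (fastforce simp: flat_face_def flat_hyperplane_def inner_char_vec mem_slice_iff coord_space_def)

lemma flat_face_face: "flat_face M F face_of base_polytope M"
  unfolding flat_face_eq
  by (rule face_of_Int_supporting_hyperplane_le[OF convex_base_polytope])
    (simp add: inner_char_vec base_polytope_rank_bound)

lemma char_vec_base: "base M B \<Longrightarrow> char_vec B \<in> base_polytope M"
  unfolding base_polytope_def by (intro hull_inc) simp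

lemma char_vec_flat_face:
  assumes "base M B" "card (B \<inter> F) = rk M F" shows "char_vec B \<in> flat_face M F"
  using assms by (simp add: flat_face_eq char_vec_base inner_char_vec sum_char_vec)

lemma tight_base: obtains B where "base M B" "card (B \<inter> F) = rk M F"
proof -
  obtain I where I: "I \<in> indep M" "I \<subseteq> F" "card I = rk M F" by (rule rk_basis)
  obtain B where B: "B \<in> indep M" "I \<subseteq> B" "card B = rk M S"
    using rk_extend[OF I(1) indep_ground[OF I(1)]] by metis
  have "card I \<le> card (B \<inter> F)" using B I indep_finite by (intro card_mono) auto
  moreover have "card (B \<inter> F) \<le> rk M F" using B indep_hereditary[of B "B \<inter> F"] by (intro card_le_rk) auto
  ultimately show thesis using that[of B] B I by (simp add: base_iff)
qed

text \<open>If the exchanges between bases that are tight for \<open>A\<close> and \<open>T\<close> have directions in \<open>V\<close>, then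
  the classes of the relation \<open>axis i 1 - axis j 1 \<in> V\<close> are separators.\<close>

lemma conn_exchange_directions:
  assumes V: "subspace V" and B: "base M B" and AT: "A \<subseteq> T" "T \<subseteq> S"
    and tight: "card (B \<inter> A) = rk M A" "card (B \<inter> T) = rk M T"
    and dir: "\<And>B'. base M B' \<Longrightarrow> card (B' \<inter> A) = rk M A \<Longrightarrow> card (B' \<inter> T) = rk M T \<Longrightarrow>
       char_vec B' - char_vec B \<in> V"
    and c: "conn A T" and ij: "i \<in> T - A" "j \<in> T - A"
  shows "(axis i 1 - axis j 1 :: real ^ 'a) \<in> V"
proof -
  have Bi: "B \<in> indep M" "card B = rk M S" using B by (auto simp: base_iff)
  have sub: "axis i 1 - axis k 1 \<in> V" if "axis i 1 - axis j 1 \<in> V" "axis j 1 - axis k 1 \<in> V"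
    for i j k :: 'a
    using subspace_add[OF V that] by simp
  have neg: "axis j 1 - axis i 1 \<in> V" if "axis i 1 - axis j 1 \<in> V" for i j :: 'a
    using subspace_neg[OF V that] by simp
  \<comment> \<open>Otherwise some \<open>e\<close> in \<open>W\<close> can be added to
    \<open>B \<inter> W\<close>. Its fundamental circuit in \<open>B \<inter> T\<close> leaves
    \<open>W\<close>, and exchanging along it gives a base tight for \<open>A\<close> and
    \<open>T\<close> whose direction in \<open>V\<close> joins \<open>W - A\<close> to
    \<open>T - W\<close>.\<close>
  have full: "rk M W = card (B \<inter> W)"
    if W: "A \<subseteq> W" "W \<subseteq> T" "\<And>e f. e \<in> W - A \<Longrightarrow> f \<in> T - W \<Longrightarrow> axis e 1 - axis f 1 \<notin> V" for W
  proof (rule ccontr)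
    assume ne: "rk M W \<noteq> card (B \<inter> W)"
    have BW: "B \<inter> W \<in> indep M" using Bi indep_hereditary by blast
    have "card (B \<inter> W) \<le> rk M W" using BW by (intro card_le_rk) auto
    then have lt: "card (B \<inter> W) < rk M W" using ne by simp
    obtain J where J: "J \<in> indep M" "J \<subseteq> W" "card J = rk M W" by (rule rk_basis)
    obtain e where e: "e \<in> J" "e \<notin> B \<inter> W" "insert e (B \<inter> W) \<in> indep M"
      using indep_augment[OF BW J(1)] lt J(3) by auto
    have eW: "e \<in> W" "e \<notin> B" using e J by auto
    have eA: "e \<notin> A"
    proof
      assume "e \<in> A"
      have "insert e (B \<inter> A) \<in> indep M" by (rule indep_hereditary[OF e(3)]) (use W in auto)
      then have "card (insert e (B \<inter> A)) \<le> rk M A" using \<open>e \<in> A\<close> by (intro card_le_rk) auto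
      then show False using tight eW indep_finite[OF Bi(1)] by simp
    qed
    have BT: "B \<inter> T \<in> indep M" using Bi indep_hereditary by blast
    have "rk M (insert e (B \<inter> T)) \<le> rk M T" using eW W by (intro rk_mono) auto
    then have "rk M (insert e (B \<inter> T)) = rk M (B \<inter> T)"
      using rk_indep[OF BT] tight rk_le_insert[of "B \<inter> T" e] by simp
    then obtain C where C: "circuit M C" "e \<in> C" "C \<subseteq> insert e (B \<inter> T)"
      by (rule span_imp_circuit[rotated 3]) (use eW W AT indep_ground[OF BT] in auto)
    have "\<not> C \<subseteq> insert e (B \<inter> W)"
      using C(1) e(3) indep_hereditary unfolding circuit_def by blast
    then obtain f where f: "f \<in> C" "f \<in> B" "f \<in> T" "f \<notin> W" using C(3) eW(1) by blast
    define B' where "B' = insert e (B - {f})"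
    have finB: "finite B" by (rule indep_finite[OF Bi(1)])
    have cB': "card B' = card B"
      using f(2) eW(2) finB by (simp add: B'_def card_Suc_Diff1 del: card_Diff_insert)
    have "insert f B' = insert e B" using f by (auto simp: B'_def)
    then have "rk M (insert e B) = rk M B'"
      using circuit_span[OF C(1) f(1), of B'] C f by (auto simp: B'_def)
    moreover have "rk M B \<le> rk M (insert e B)" by (rule rk_le_insert)
    ultimately have "card B' \<le> rk M B'" using cB' rk_indep[OF Bi(1)] by simp
    moreover have "rk M B' \<le> card B'" by (rule rk_le_card) simp
    moreover have "B' \<subseteq> S" using eW W AT base_subset[OF B] by (auto simp: B'_def)
    ultimately have "B' \<in> indep M" by (simp add: indep_iff_rk)
    then have base': "base M B'" using cB' Bi by (simp add: base_iff)
    have "B' \<inter> A = B \<inter> A" using eA f W by (auto simp: B'_def)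
    moreover have "card (B' \<inter> T) = card (B \<inter> T)"
    proof -
      have "B' \<inter> T = insert e (B \<inter> T - {f})" using eW W by (auto simp: B'_def)
      then show ?thesis
        using f eW finB by (simp add: card_Suc_Diff1 del: card_Diff_insert)
    qed
    ultimately have "char_vec B' - char_vec B \<in> V" using dir[OF base'] tight by simp
    moreover have "char_vec B' - char_vec B = (axis e 1 - axis f 1 :: real ^ 'a)"
      using eW f by (auto simp: vec_eq_iff char_vec_nth axis_def B'_def)
    ultimately show False using W(3)[of e f] eW eA f by auto
  qed
  \<comment> \<open>The class of \<open>j\<close> together with \<open>A\<close>. No direction of
    \<open>V\<close> crosses its border, so \<open>B\<close> has full rank on it and on its
    complement with \<open>A\<close>, and the two ranks add up.\<close>
  define X where "X = A \<union> {i \<in> T - A. axis i 1 - axis j 1 \<in> V}"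
  have AX: "A \<subseteq> X" "X \<subseteq> T" using AT by (auto simp: X_def)
  have rX: "rk M X = card (B \<inter> X)"
  proof (rule full[OF AX])
    fix e f assume ef: "e \<in> X - A" "f \<in> T - X"
    show "axis e 1 - axis f 1 \<notin> V"
    proof
      assume "axis e 1 - axis f 1 \<in> V"
      then have "axis f 1 - axis e 1 \<in> V" by (rule neg)
      moreover have "axis e 1 - axis j 1 \<in> V" using ef by (auto simp: X_def)
      ultimately have "axis f 1 - axis j 1 \<in> V" by (rule sub)
      then show False using ef by (auto simp: X_def)
    qed
  qed
  have rY: "rk M (A \<union> (T - X)) = card (B \<inter> (A \<union> (T - X)))"
  proof (rule full)
    fix e f assume ef: "e \<in> A \<union> (T - X) - A" "f \<in> T - (A \<union> (T - X))"
    show "axis e 1 - axis f 1 \<notin> V"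
    proof
      assume "axis e 1 - axis f 1 \<in> V"
      moreover have "axis f 1 - axis j 1 \<in> V" using ef by (auto simp: X_def)
      ultimately have "axis e 1 - axis j 1 \<in> V" by (rule sub)
      then show False using ef by (auto simp: X_def)
    qed
  qed (use AT in auto)
  have "card (B \<inter> X) + card (B \<inter> (A \<union> (T - X)))
    = card (B \<inter> X \<union> B \<inter> (A \<union> (T - X))) + card ((B \<inter> X) \<inter> (B \<inter> (A \<union> (T - X))))"
    by (rule card_Un_Int) simp_all
  moreover have "B \<inter> X \<union> B \<inter> (A \<union> (T - X)) = B \<inter> T" "(B \<inter> X) \<inter> (B \<inter> (A \<union> (T - X))) = B \<inter> A"
    using AX by auto
  ultimately have "sep A T X" using AX rX rY tight by (simp add: sep_def)
  moreover have "j \<in> X" using ij subspace_0[OF V] by (simp add: X_def)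
  ultimately have "X = T" using c ij by (auto simp: conn_def)
  then show ?thesis using ij by (auto simp: X_def)
qed

text \<open>Connectedness of \<open>M|F\<close> and \<open>M/F\<close> yields all exchange
  directions inside \<open>F\<close> and inside \<open>S - F\<close>. A vector with zero sum on both
  parts is composed of these.\<close>

lemma affine_hull_flat_face_supset:
  assumes F: "F \<subseteq> S" and c: "conn {} F" "conn F S"
  shows "sum_plane \<inter> {x. char_vec F \<bullet> x = rk M F} \<subseteq> affine hull (flat_face M F)"
proof
  fix x assume "x \<in> sum_plane \<inter> {x. char_vec F \<bullet> x = rk M F}"
  then have x: "x \<in> coord_space S" "(\<Sum>i\<in>S. x $ i) = rk M S" "(\<Sum>i\<in>F. x $ i) = rk M F"
    by (auto simp: sum_plane_def inner_char_vec)
  obtain B where B: "base M B" "card (B \<inter> F) = rk M F" by (rule tight_base)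
  have BS: "card (B' \<inter> S) = rk M S" if "base M B'" for B'
    using that base_subset[OF that] by (simp add: base_iff Int_absorb2)
  let ?A = "affine hull (flat_face M F)"
  define V where "V = {v. char_vec B + v \<in> ?A}"
  have bA: "char_vec B \<in> ?A" by (intro hull_inc char_vec_flat_face B)
  have V: "subspace V"
    unfolding V_def by (rule affine_directions_subspace[OF affine_affine_hull bA])
  have dir: "char_vec B' - char_vec B \<in> V" if "base M B'" "card (B' \<inter> F) = rk M F" for B'
    using char_vec_flat_face[OF that] by (simp add: V_def hull_inc)
  have dF: "axis i 1 - axis j 1 \<in> V" if "i \<in> F" "j \<in> F" for i j
    by (rule conn_exchange_directions[OF V B(1) _ _ _ _ _ c(1)]) (use F B dir that in auto)
  have dC: "axis i 1 - axis j 1 \<in> V" if "i \<in> S - F" "j \<in> S - F" for i j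
    by (rule conn_exchange_directions[OF V B(1) _ _ _ _ _ c(2)]) (use F B BS dir that in auto)
  have split: "(\<Sum>i\<in>S. y $ i) = (\<Sum>i\<in>S - F. y $ i) + (\<Sum>i\<in>F. y $ i)" for y :: "real ^ 'a"
    using F by (intro sum.subset_diff) auto
  define d where "d = x - char_vec B"
  have d0: "d $ i = 0" if "i \<notin> S" for i
    using that x(1) base_subset[OF B(1)] by (auto simp: d_def coord_space_def char_vec_nth)
  have dsum: "(\<Sum>i\<in>F. d $ i) = 0" "(\<Sum>i\<in>S. d $ i) = 0"
    using x B BS[OF B(1)] by (auto simp: d_def sum_subtractf sum_char_vec)
  then have dsumC: "(\<Sum>i\<in>S - F. d $ i) = 0" using split[of d] by simp
  define d1 :: "real ^ 'a" where "d1 = (\<chi> i. if i \<in> F then d $ i else 0)"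
  define d2 :: "real ^ 'a" where "d2 = (\<chi> i. if i \<in> S - F then d $ i else 0)"
  have "d1 \<in> V"
    by (rule supported_in_subspace[OF V dF]) (use dsum in \<open>auto simp: d1_def\<close>)
  moreover have "d2 \<in> V"
  proof (rule supported_in_subspace[OF V dC])
    have "(\<Sum>i\<in>S - F. d2 $ i) = (\<Sum>i\<in>S - F. d $ i)" by (intro sum.cong) (auto simp: d2_def)
    then show "(\<Sum>i\<in>S - F. d2 $ i) = 0" using dsumC by simp
  qed (auto simp: d2_def)
  moreover have "d = d1 + d2" using d0 F by (auto simp: d1_def d2_def vec_eq_iff)
  ultimately have "d \<in> V" using subspace_add[OF V] by simp
  then show "x \<in> ?A" by (simp add: V_def d_def)
qed

lemma flat_face_whole: "flat_face M {} = base_polytope M"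
  by (auto simp: flat_face_eq inner_char_vec)

lemma affine_hull_base_polytope:
  assumes "conn {} S" shows "affine hull (base_polytope M) = sum_plane"
proof
  show "affine hull (base_polytope M) \<subseteq> sum_plane"
    using base_polytope_subset_slice slice_subset_sum_plane affine_sum_plane by (intro hull_minimal) auto
  have "conn {} {}" by (auto simp: conn_def sep_def)
  then show "sum_plane \<subseteq> affine hull (base_polytope M)"
    using affine_hull_flat_face_supset[of "{}"] assms flat_face_whole by (auto simp: inner_char_vec)
qed

lemma ambient_polytope_eq:
  assumes "conn {} S" shows "ambient_polytope M = slice (rk M S) S"
  unfolding ambient_polytope_def affine_hull_base_polytope[OF assms]
  by (auto simp: slice_def sum_plane_def unit_cube_def)

section \<open>Flacets and split matroids\<close>

lemma exchange_in_sum_plane: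
  assumes "x \<in> sum_plane" "i \<in> S" "j \<in> S"
  shows "x + (axis i 1 - axis j 1) \<in> sum_plane"
  using assms sum_exchange[of x 1 i j S] by (auto simp: sum_plane_def coord_space_def axis_def)

text \<open>The affine hull of the face is exactly the hyperplane section, so the dimension drops by
  one. It allows shifts between any two elements of \<open>F\<close>; a smaller flat with the same
  face would contain one element of such a pair but not the other, and its sum would change.\<close>

lemma split_flat_flacet:
  assumes c: "conn {} S" and F: "split_flat F" shows "flacet M F"
  unfolding flacet_def
proof (intro conjI allI impI)
  have FS: "F \<subseteq> S" "F \<noteq> {}" "F \<noteq> S" and fl: "flat M F" and cF: "conn {} F" "conn F S"
    using F flat_ground by (auto simp: split_flat_def)
  show "flat M F" by (rule fl)
  let ?H = "{x. char_vec F \<bullet> x = real (rk M F)}"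
  note sup = affine_hull_flat_face_supset[OF FS(1) cF]
  have hull: "affine hull (flat_face M F) = sum_plane \<inter> ?H"
  proof
    have "flat_face M F \<subseteq> sum_plane \<inter> ?H"
      using base_polytope_subset_slice slice_subset_sum_plane by (auto simp: flat_face_eq)
    then show "affine hull (flat_face M F) \<subseteq> sum_plane \<inter> ?H"
      by (intro hull_minimal affine_Int affine_sum_plane affine_hyperplane)
  qed (rule sup)
  obtain B where B: "base M B" "card (B \<inter> F) = rk M F" by (rule tight_base)
  have x: "char_vec B \<in> flat_face M F" by (rule char_vec_flat_face[OF B])
  then have xU: "char_vec B \<in> sum_plane" "char_vec F \<bullet> char_vec B = real (rk M F)"
    using hull hull_inc[OF x, of affine] by auto
  obtain i j where ij: "i \<in> F" "j \<in> S" "j \<notin> F" using FS by blast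
  have mv: "char_vec G \<bullet> (y + (axis i 1 - axis j 1))
      = char_vec G \<bullet> y + ((if i \<in> G then 1 else 0) - (if j \<in> G then 1 else 0))"
    for y :: "real ^ 'a" and G i j
    using sum_exchange[of y 1 i j G] by (simp add: inner_char_vec)
  have nsub: "\<not> sum_plane \<subseteq> ?H"
  proof
    assume "sum_plane \<subseteq> ?H"
    moreover have "char_vec B + (axis i 1 - axis j 1) \<in> sum_plane"
      using xU ij FS by (intro exchange_in_sum_plane) auto
    ultimately show False using mv[of F "char_vec B" i j] xU(2) ij by auto
  qed
  have "aff_dim (sum_plane \<inter> ?H) = aff_dim sum_plane - 1"
    using aff_dim_affine_Int_hyperplane[OF affine_sum_plane, of "char_vec F" "real (rk M F)"] nsub xU
    by auto
  then have ad: "aff_dim (flat_face M F) = aff_dim (base_polytope M) - 1"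
    using aff_dim_affine_hull[of "flat_face M F"] aff_dim_affine_hull[of "base_polytope M"]
    unfolding hull affine_hull_base_polytope[OF c] by simp
  then show "flat_face M F facet_of base_polytope M"
    using x flat_face_face by (auto simp: facet_of_def)
  fix G assume G: "flat M G \<and> flat_face M G = flat_face M F"
  show "\<not> G \<subset> F"
  proof
    assume GF: "G \<subset> F"
    have "G \<noteq> {}" using ad G flat_face_whole by auto
    then obtain g h where gh: "g \<in> G" "h \<in> F" "h \<notin> G" using GF by blast
    let ?y = "char_vec B + (axis g 1 - axis h 1)"
    have "?y \<in> sum_plane" using xU gh GF FS by (intro exchange_in_sum_plane) auto
    moreover have "char_vec F \<bullet> ?y = rk M F" using mv[of F "char_vec B" g h] xU gh GF by auto
    ultimately have "?y \<in> affine hull (flat_face M G)" using hull G by simp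
    moreover have "affine hull (flat_face M G) \<subseteq> {x. char_vec G \<bullet> x = real (rk M G)}"
      by (intro hull_minimal affine_hyperplane) (simp add: flat_face_eq)
    ultimately have "char_vec G \<bullet> ?y = real (rk M G)" by blast
    moreover have "char_vec B \<in> flat_face M G" using x G by simp
    then have "char_vec G \<bullet> char_vec B = real (rk M G)" by (simp add: flat_face_eq)
    ultimately show False using mv[of G "char_vec B" g h] gh by simp
  qed
qed

lemma split_alongI:
  assumes F: "F \<subseteq> S" "F \<noteq> {}" "F \<noteq> S"
    and x: "\<forall>i\<in>S. 0 < x i \<and> x i < (1::real)" "sum x S = rk M S" "sum x F = rk M F"
  shows "\<exists>\<C>. split_along (slice (rk M S) S) (flat_hyperplane M F) \<C>"
proof -
  define z :: "real ^ 'a" where "z = (\<chi> i. if i \<in> S then x i else 0)"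
  have zs: "(\<Sum>i\<in>G. z $ i) = sum x G" if "G \<subseteq> S" for G
    using that by (intro sum.cong) (auto simp: z_def)
  have "\<exists>\<C>. is_split (slice (rk M S) S) \<C> \<and>
    split_hyperplane \<C> = {y. char_vec F \<bullet> y = real (rk M F)} \<inter> affine hull (slice (rk M S) S)"
    by (rule hyperplane_splits_slice[of F S _ _ z])
      (use F x zs[of S] zs[OF F(1)] rk_mono[OF F(1)] in \<open>auto simp: z_def coord_space_def\<close>)
  moreover have "{y. char_vec F \<bullet> y = real (rk M F)} \<inter> affine hull (slice (rk M S) S)
    = flat_hyperplane M F \<inter> affine hull (slice (rk M S) S)"
    using affine_hull_slice_subset[of "rk M S" S] by (auto simp: flat_hyperplane_def inner_char_vec)
  ultimately show ?thesis by (auto simp: split_along_def)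
qed

text \<open>The crossing point serves twice: it turns both hyperplanes into actual splits, and it
  shows these splits to be incompatible.\<close>

lemma split_matroid_no_crossing:
  assumes c: "conn {} S" and sm: "split_matroid M"
    and F: "split_flat F" and G: "split_flat G" and ne: "F \<noteq> G"
  shows "\<not> crossing F G"
proof
  assume "crossing F G"
  then obtain x where x: "\<forall>i\<in>S. 0 < x i \<and> x i < (1::real)" "sum x S = rk M S"
    "sum x F = rk M F" "sum x G = rk M G"
    by (auto simp: crossing_def)
  have FS: "F \<subseteq> S" "F \<noteq> {}" "F \<noteq> S" and GS: "G \<subseteq> S" "G \<noteq> {}" "G \<noteq> S"
    using F G flat_ground by (auto simp: split_flat_def)
  let ?P = "slice (rk M S) S"
  obtain \<C> where C: "split_along ?P (flat_hyperplane M F) \<C>" using split_alongI[OF FS x(1,2,3)] by blast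
  obtain \<D> where D: "split_along ?P (flat_hyperplane M G) \<D>" using split_alongI[OF GS x(1,2,4)] by blast
  have "split_flacet M F" "split_flacet M G"
    unfolding split_flacet_def defines_split_def hypersimplex_eq_slice
    using split_flat_flacet[OF c] F G C D by auto
  then have comp: "compatible_splits ?P \<C> \<D>"
    using sm ne C D unfolding split_matroid_def ambient_polytope_eq[OF c] by blast
  define z :: "real ^ 'a" where "z = (\<chi> i. if i \<in> S then x i else 0)"
  have zs: "(\<Sum>i\<in>G. z $ i) = sum x G" if "G \<subseteq> S" for G
    using that by (intro sum.cong) (auto simp: z_def)
  have zc: "z \<in> coord_space S" by (simp add: z_def coord_space_def)
  have zr: "z \<in> rel_interior ?P"
    by (rule rel_interior_sliceI[OF zc]) (use x zs in \<open>auto simp: z_def\<close>)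
  have "z \<in> affine hull ?P" by (rule hull_inc[OF subsetD[OF rel_interior_subset zr]])
  moreover have "z \<in> flat_hyperplane M F" "z \<in> flat_hyperplane M G"
    using zc zs FS GS x by (auto simp: flat_hyperplane_def)
  ultimately have "z \<in> split_hyperplane \<C>" "z \<in> split_hyperplane \<D>"
    using C D by (auto simp: split_along_def)
  then show False using comp zr by (auto simp: compatible_splits_def)
qed

text \<open>A base of full rank on the complement also lies on the face of \<open>G\<close>, so it
  has full rank on both sides.\<close>

lemma whole_face_sep:
  assumes G: "G \<subseteq> S" and whole: "flat_face M G = base_polytope M" shows "sep {} S G"
proof (rule sepI)
  obtain B where B: "base M B" "card (B \<inter> (S - G)) = rk M (S - G)" by (rule tight_base)
  then have "char_vec B \<in> flat_face M G" using whole char_vec_base by simp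
  then have "card (B \<inter> G) = rk M G" by (simp add: flat_face_eq inner_char_vec sum_char_vec)
  moreover have "card (B \<inter> G) + card (B \<inter> (S - G)) = card B"
  proof -
    have "B \<inter> (S - G) = B - G" using base_subset[OF B(1)] by blast
    then show ?thesis using card_Int_Diff[of B G] by simp
  qed
  ultimately show "rk M G + rk M ({} \<union> (S - G)) \<le> rk M S + rk M {}"
    using B by (simp add: base_iff)
qed (use G in auto)

text \<open>If \<open>e\<close> is a coloop of \<open>M|F\<close>, the bound
  \<open>x $ e \<le> 1\<close> puts the face of \<open>F\<close> inside that of
  \<open>F - {e}\<close>. By minimality the latter is larger, hence the whole polytope, and
  \<open>F - {e}\<close> separates \<open>M\<close> unless it is empty.\<close>

lemma flacet_singleton_or_cyclic:
  assumes c: "conn {} S" and ll: "loopless M" and fl: "flacet M F"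
  shows "(\<exists>e\<in>S. F = {e}) \<or> proper_cyclic_flat M F"
proof -
  have F: "flat M F" "flat_face M F facet_of base_polytope M"
    and min: "\<And>G. flat M G \<Longrightarrow> flat_face M G = flat_face M F \<Longrightarrow> \<not> G \<subset> F"
    using fl by (auto simp: flacet_def)
  have FS: "F \<subseteq> S" by (rule flat_ground[OF F(1)])
  have ad: "aff_dim (flat_face M F) = aff_dim (base_polytope M) - 1" using F by (simp add: facet_of_def)
  then have neP: "flat_face M F \<noteq> base_polytope M" by auto
  have "F \<noteq> S"
  proof
    assume "F = S"
    then have "flat_face M F = base_polytope M"
      using base_polytope_subset_slice by (auto simp: flat_face_eq inner_char_vec mem_slice_iff)
    then show False using neP by simp
  qed
  have "F \<noteq> {}" using neP flat_face_whole by auto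
  then have pf: "proper_flat M F"
    using F \<open>F \<noteq> S\<close> loopless_rk_pos[OF ll FS] by (simp add: proper_flat_def)
  show ?thesis
  proof (rule ccontr)
    assume no: "\<not> ?thesis"
    then have "\<not> cyclic_set M F" using pf by (simp add: proper_cyclic_flat_def)
    then obtain e where e: "e \<in> F" "rk M (F - {e}) \<noteq> rk M F" using FS by (auto simp: cyclic_iff)
    let ?G = "F - {e}"
    have ie: "insert e ?G = F" using e by blast
    have rG: "rk M F = rk M ?G + 1"
      using e(2) rk_insert_le[of e ?G] rk_le_insert[of ?G e] unfolding ie by linarith
    have fG: "flat M ?G"
      unfolding flat_def
    proof (intro conjI ballI)
      fix g assume g: "g \<in> S - ?G"
      show "rk M ?G < rk M (insert g ?G)"
      proof (cases "g = e")
        case True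
        then show ?thesis using rG ie by simp
      next
        case False
        then show ?thesis using g by (intro flat_notinD[OF F(1)]) auto
      qed
    qed (use FS in auto)
    have "?G \<noteq> {}" using no e FS by blast
    have sub: "flat_face M F \<subseteq> flat_face M ?G"
    proof
      fix x assume x: "x \<in> flat_face M F"
      then have xP: "x \<in> base_polytope M" "(\<Sum>i\<in>F. x $ i) = rk M F"
        by (auto simp: flat_face_eq inner_char_vec)
      have "(\<Sum>i\<in>F. x $ i) = x $ e + (\<Sum>i\<in>?G. x $ i)" using e by (simp add: sum.remove)
      moreover have "x $ e \<le> 1"
        using subsetD[OF base_polytope_subset_slice xP(1)] e FS by (auto simp: mem_slice_iff)
      ultimately have "(\<Sum>i\<in>?G. x $ i) \<ge> rk M ?G" using xP rG by simp
      then have "(\<Sum>i\<in>?G. x $ i) = rk M ?G" using base_polytope_rank_bound[OF xP(1), of ?G] by simp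
      then show "x \<in> flat_face M ?G" using xP by (simp add: flat_face_eq inner_char_vec)
    qed
    have "flat_face M ?G \<noteq> flat_face M F" using min[OF fG] e by blast
    moreover have "flat_face M F face_of flat_face M ?G"
      using face_of_subset[OF flat_face_face sub] face_of_imp_subset[OF flat_face_face] by blast
    moreover have "convex (flat_face M ?G)" using face_of_imp_convex[OF flat_face_face] .
    ultimately have "aff_dim (flat_face M F) < aff_dim (flat_face M ?G)"
      using face_of_aff_dim_lt by metis
    then have "flat_face M ?G = base_polytope M"
      using face_of_aff_dim_lt[OF convex_base_polytope flat_face_face[of ?G]] ad by fastforce
    then have "sep {} S ?G" by (rule whole_face_sep[rotated]) (use FS in auto)
    then show False using c \<open>?G \<noteq> {}\<close> e FS by (auto simp: conn_def)
  qed
qed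

text \<open>At a common interior point the sums over \<open>F\<close> and \<open>G\<close> add up to
  at most \<open>rk M S + card (F \<inter> G)\<close>, and to less unless \<open>F\<close> and
  \<open>G\<close> are disjoint and cover \<open>S\<close>. The clutter inequality leaves only that
  case, in which \<open>F\<close> would separate \<open>M\<close>.\<close>

lemma clutter_split_matroid:
  assumes c: "conn {} S" and ll: "loopless M" and co: "coloopless M"
    and clut: "clutter {F. proper_cyclic_flat M F}"
  shows "split_matroid M"
  unfolding split_matroid_def ambient_polytope_eq[OF c]
proof (intro conjI allI impI)
  let ?P = "slice (rk M S) S"
  show "defines_split ?P (flat_hyperplane M F)" if "split_flacet M F" for F
    using that by (simp add: split_flacet_def hypersimplex_eq_slice)
  fix F G \<C> \<D>
  assume as: "split_flacet M F \<and> split_flacet M G \<and> F \<noteq> G \<and>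
    split_along ?P (flat_hyperplane M F) \<C> \<and> split_along ?P (flat_hyperplane M G) \<D>"
  then have fl: "flacet M F" "flacet M G" by (auto simp: split_flacet_def)
  have FS: "F \<subseteq> S" "G \<subseteq> S" using fl flat_ground by (auto simp: flacet_def)
  show "compatible_splits ?P \<C> \<D>"
    unfolding compatible_splits_def
  proof (rule ccontr)
    assume "split_hyperplane \<C> \<inter> split_hyperplane \<D> \<inter> rel_interior ?P \<noteq> {}"
    then obtain x where x: "x \<in> rel_interior ?P" "x \<in> flat_hyperplane M F" "x \<in> flat_hyperplane M G"
      using as by (auto simp: split_along_def)
    have xF: "(\<Sum>i\<in>F. x $ i) = rk M F" and xG: "(\<Sum>i\<in>G. x $ i) = rk M G"
      using x by (auto simp: flat_hyperplane_def)
    have xS: "(\<Sum>i\<in>S. x $ i) = rk M S" using subsetD[OF rel_interior_subset x(1)] by (simp add: mem_slice_iff)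
    have x01: "0 < x $ i \<and> x $ i < 1" if "i \<in> S" for i
    proof (rule rel_interior_sliceD[OF x(1) _ _ that])
      show "0 < rk M S" using that by (intro loopless_rk_pos[OF ll]) auto
      have "rk M S < rk M {} + card (S - {})"
        using co that by (intro rk_diff_less) (auto simp: coloopless_iff)
      then show "rk M S < card S" by simp
    qed
    \<comment> \<open>A singleton flacet would force an integral coordinate, which an interior point
      does not have.\<close>
    have ns: False if e: "e \<in> S" "(\<Sum>i\<in>{e}. x $ i) = real k" for e k
      using x01[OF e(1)] e(2) by auto
    have "proper_cyclic_flat M F" "proper_cyclic_flat M G"
      using flacet_singleton_or_cyclic[OF c ll] fl xF xG ns by blast+
    then have ineq: "card (F \<inter> G) + rk M S \<le> rk M F + rk M G"
      using as by (intro clutter_proper_cyclic_flats_inter[OF ll clut]) auto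
    have nn: "F \<noteq> {}" "F \<noteq> S"
      using \<open>proper_cyclic_flat M F\<close> by (auto simp: proper_cyclic_flat_def proper_flat_def)
    have tot: "(\<Sum>i\<in>F. x $ i) + (\<Sum>i\<in>G. x $ i) = (\<Sum>i\<in>F \<union> G. x $ i) + (\<Sum>i\<in>F \<inter> G. x $ i)"
      by (simp add: sum.union_inter)
    have le1: "(\<Sum>i\<in>F \<inter> G. x $ i) \<le> card (F \<inter> G)"
      using sum_bounded_above[of "F \<inter> G" "\<lambda>i. x $ i" 1] x01 FS by (auto simp: less_imp_le subset_iff)
    have Sdiff: "(\<Sum>i\<in>S. x $ i) = (\<Sum>i\<in>S - (F \<union> G). x $ i) + (\<Sum>i\<in>F \<union> G. x $ i)"
      using FS by (intro sum.subset_diff) auto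
    have ge0: "0 \<le> (\<Sum>i\<in>S - (F \<union> G). x $ i)" using x01 by (intro sum_nonneg) (auto simp: less_imp_le)
    have "real (card (F \<inter> G)) + real (rk M S) \<le> real (rk M F) + real (rk M G)" using ineq by linarith
    then have eqs: "(\<Sum>i\<in>F \<inter> G. x $ i) = card (F \<inter> G)" "(\<Sum>i\<in>S - (F \<union> G). x $ i) = 0"
      using tot xF xG xS le1 Sdiff ge0 by linarith+
    have "F \<inter> G = {}"
    proof (rule ccontr)
      assume "F \<inter> G \<noteq> {}"
      then have "(\<Sum>i\<in>F \<inter> G. x $ i) < (\<Sum>i\<in>F \<inter> G. 1)"
        using x01 FS by (intro sum_strict_mono) auto
      then show False using eqs by simp
    qed
    moreover have "S - (F \<union> G) = {}"
    proof (rule ccontr)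
      assume "S - (F \<union> G) \<noteq> {}"
      then have "0 < (\<Sum>i\<in>S - (F \<union> G). x $ i)" using x01 by (intro sum_pos) auto
      then show False using eqs by simp
    qed
    ultimately have GC: "G = S - F" using FS by blast
    have "rk M F + rk M G = rk M S"
      using tot xF xG xS Sdiff eqs \<open>F \<inter> G = {}\<close> by simp
    then have "sep {} S F" using FS GC by (simp add: sep_def)
    then show False using c nn by (auto simp: conn_def)
  qed
qed

lemma connected_split_clutter:
  assumes c: "conn {} S" and ll: "loopless M" and co: "coloopless M" and sm: "split_matroid M"
  shows "clutter {F. proper_cyclic_flat M F}"
  unfolding clutter_def
proof (intro ballI notI)
  fix F G assume "F \<in> {F. proper_cyclic_flat M F}" "G \<in> {F. proper_cyclic_flat M F}" and FG: "F \<subset> G"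
  then have "proper_cyclic_flat M F" "proper_cyclic_flat M G" by auto
  from nested_cyclic_flats_crossing[OF c ll co this FG] obtain F' G'
    where FG': "split_flat F'" "split_flat G'" "F' \<noteq> G'" "crossing F' G'" by (elim exE conjE)
  from split_matroid_no_crossing[OF c sm FG'(1-3)] FG'(4) show False by (rule notE)
qed

end

text \<open>On at most one element connectedness says nothing and a loop or coloop may occur; such a
  matroid is the sum of a uniform and the empty matroid. From two elements on, common circuits
  exclude loops and coloops.\<close>

lemma connected_split_cases:
  fixes M :: "'a::finite indep_system"
  assumes M: "matroid M" and c: "connected_matroid M" and sm: "split_matroid M"
  shows "(loopless M \<and> coloopless M \<and> clutter {F. proper_cyclic_flat M F}) \<or>
    (\<exists>N\<^sub>1 N\<^sub>2. is_direct_sum M N\<^sub>1 N\<^sub>2 \<and> uniform_matroid N\<^sub>1 \<and> uniform_matroid N\<^sub>2)"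
proof -
  interpret finite_type_matroid M using M by (simp add: finite_type_matroid_def)
  show ?thesis
  proof (cases "\<exists>e. ground M \<subseteq> {e}")
    case True
    then obtain e where e: "ground M \<subseteq> {e}" by blast
    let ?r = "rk M (ground M)"
    have "X \<in> indep M \<longleftrightarrow> X \<subseteq> ground M \<and> card X \<le> ?r" for X
    proof
      show "X \<in> indep M \<Longrightarrow> X \<subseteq> ground M \<and> card X \<le> ?r"
        using indep_ground card_le_rk by blast
      assume X: "X \<subseteq> ground M \<and> card X \<le> ?r"
      then have "X = {} \<or> X = ground M" using e by blast
      then show "X \<in> indep M"
      proof
        assume "X = ground M"
        then show ?thesis using X rk_le_card[OF finite_ground] by (simp add: indep_iff_rk)
      qed (simp add: indep_empty)
    qed
    then have "X \<in> indep M \<longleftrightarrow> X \<in> indep (direct_sum (unif ?r (ground M)) (unif 0 {}))" for X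
      unfolding direct_sum_unif_iff[OF finite_ground finite.emptyI Int_empty_right]
      by (auto simp: Int_absorb2)
    then have "M = direct_sum (unif ?r (ground M)) (unif 0 {})"
      by (intro indep_system.equality) (auto simp: ground_direct_sum_unif)
    moreover have "uniform_matroid (unif ?r (ground M))"
      unfolding uniform_matroid_def using rk_le_card[OF finite_ground] finite_ground by blast
    moreover have "uniform_matroid (unif 0 {} :: 'a indep_system)"
      unfolding uniform_matroid_def by (rule exI[of _ 0], rule exI[of _ "{}"]) simp
    moreover have "ground (unif ?r (ground M)) \<inter> ground (unif 0 {} :: 'a indep_system) = {}"
      by (simp add: unif_def)
    ultimately show ?thesis unfolding is_direct_sum_def by blast
  next
    case False
    have circ: "\<exists>C. circuit M C \<and> e \<in> C \<and> C \<noteq> {e}" if "e \<in> ground M" for e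
    proof -
      obtain f where f: "f \<in> ground M" "f \<noteq> e" using False by blast
      then have "\<exists>C. circuit M C \<and> e \<in> C \<and> f \<in> C"
        using c that unfolding connected_matroid_def by simp
      then show ?thesis using f by blast
    qed
    have ll: "loopless M"
      unfolding loopless_def
    proof
      fix e assume "e \<in> ground M"
      then obtain C where "circuit M C" "e \<in> C" "C \<noteq> {e}" using circ by blast
      then have "{e} \<subset> C" by blast
      then show "{e} \<in> indep M" using \<open>circuit M C\<close> by (simp add: circuit_def)
    qed
    have co: "coloopless M"
      unfolding coloopless_iff
    proof
      fix e assume e: "e \<in> ground M"
      then obtain C where C: "circuit M C" "e \<in> C" using circ by blast
      then have "rk M (insert e (ground M - {e})) = rk M (ground M - {e})"
        by (intro circuit_span[of C e]) (auto simp: circuit_def)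
      then show "rk M (ground M - {e}) = rk M (ground M)" using e by (simp add: insert_absorb)
    qed
    have "clutter {F. proper_cyclic_flat M F}"
      using connected_split_clutter ll co sm c by (simp add: connected_iff_conn)
    then show ?thesis using ll co by blast
  qed
qed

theorem theorem11:
  fixes M :: "'a::finite indep_system"
  assumes "matroid M"
  defines "cond_i \<equiv> elementary_split M"
    and "cond_ii \<equiv> \<not> (\<exists>N. minor_of N M \<and> isomorphic N forbidden_matroid)"
    and "cond_iii \<equiv>
      (loopless M \<and> coloopless M \<and> clutter {F. proper_cyclic_flat M F}) \<or>
      (\<exists>N\<^sub>1 N\<^sub>2. is_direct_sum M N\<^sub>1 N\<^sub>2 \<and> uniform_matroid N\<^sub>1 \<and>
         (rank0_matroid N\<^sub>2 \<or> free_matroid N\<^sub>2))"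
    and "cond_iv \<equiv>
      (connected_matroid M \<and> split_matroid M) \<or>
      (\<exists>N\<^sub>1 N\<^sub>2. is_direct_sum M N\<^sub>1 N\<^sub>2 \<and> uniform_matroid N\<^sub>1 \<and> uniform_matroid N\<^sub>2)"
  shows "(cond_i \<longleftrightarrow> cond_ii) \<and> (cond_ii \<longleftrightarrow> cond_iii) \<and> (cond_iii \<longleftrightarrow> cond_iv)"
proof -
  interpret finite_type_matroid M using assms(1) by (simp add: finite_type_matroid_def)
  have ii_iff: "cond_ii \<longleftrightarrow> \<not> obstruction M" unfolding cond_ii_def forbidden_minor_iff ..
  have "cond_ii" if cond_i
    using that elementary_split_no_obstruction unfolding cond_i_def ii_iff by blast
  moreover have "cond_iii" if cond_ii
  proof -
    have no: "\<not> obstruction M" using that ii_iff by blast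
    show ?thesis
    proof (cases "loopless M \<and> coloopless M")
      case True
      then have "clutter {F. proper_cyclic_flat M F}"
        using nested_proper_cyclic_flats_obstruction no unfolding clutter_def by blast
      then show ?thesis using True unfolding cond_iii_def by blast
    next
      case False
      then show ?thesis
        using loop_no_obstruction coloop_no_obstruction no unfolding cond_iii_def by blast
    qed
  qed
  moreover have "cond_iv" if cond_iii
    using that unfolding cond_iii_def
  proof
    assume a: "loopless M \<and> coloopless M \<and> clutter {F. proper_cyclic_flat M F}"
    show cond_iv
    proof (cases "connected_matroid M")
      case True
      then have "split_matroid M" using clutter_split_matroid a by (simp add: connected_iff_conn)
      then show ?thesis using True unfolding cond_iv_def by blast
    next
      case False
      then show ?thesis using clutter_disconnected_uniform_sum a unfolding cond_iv_def by blast
    qed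
  next
    have "uniform_matroid N" if "rank0_matroid N \<or> free_matroid N" for N :: "'a indep_system"
      using that unfolding rank0_matroid_def free_matroid_def uniform_matroid_def by blast
    moreover assume "\<exists>N\<^sub>1 N\<^sub>2. is_direct_sum M N\<^sub>1 N\<^sub>2 \<and> uniform_matroid N\<^sub>1 \<and>
         (rank0_matroid N\<^sub>2 \<or> free_matroid N\<^sub>2)"
    ultimately show cond_iv unfolding cond_iv_def by blast
  qed
  \<comment> \<open>The cycle closes here: a connected split matroid has a clutter to serve as
    hyperedges or is again a sum of two uniform matroids.\<close>
  moreover have "cond_i" if cond_iv
    using that connected_split_cases[OF assms(1)] clutter_elementary_split elementary_split_uniform_sum
    unfolding cond_iv_def cond_i_def by blast
  ultimately show ?thesis by blast
qed

end
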